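(* Fix an integer $r\ge2$ and let $k=n^{\beta+o(1)}$. Consider the Gaussian additive model $Y=\sqrt\lambda X+Z$ in $\mathbb R^{n^r}$ with $X=\mathrm{vec}(v^{\otimes r})$, where $v\in\mathbb R^n$ has i.i.d. entries with $\mathbb P(v_i=1)=\mathbb P(v_i=-1)=k/(2n)$ and $v_i=0$ otherwise (sparse Rademacher tensor PCA). Let $\lambda_{\mathrm{ALG}}=\widetilde\Theta(\min\{1,n^{r/2}/k^r\})$ and $D_n=\lfloor(1-\beta)\log n\rfloor$. Then for all $\lambda>0$ the following holds. If $\beta\in(\tfrac12,1)$, then $$\mathrm{MMSE}^{\le D_n}\!\left(\frac{1}{D_n^{r-2}\log^{(3r+2)/2}n}\Big(\lambda+\mathbf\Delta_{a_n}\mathcal F_{\mathrm{ann},\lambda}\Big|_{q=q(D_n)}\Big)\right)=k^r-\widetilde O\Big(\frac{k^r}{n^{r/2}}\Big)=(1+o(1))\,\mathrm{MMSE}^{\mathrm{trivial}}.$$ In particular, since for some $\lambda=\widetilde\Theta(n^{r/2}/k^r)=\widetilde\Theta(\lambda_{\mathrm{ALG}})$ one has $\mathbf\Delta_{a_n}\mathcal F_{\mathrm{ann},\lambda}\big|_{q(D_n)}\ge0$, it follows that $\mathrm{MMSE}^{\le D_n}(\widetilde\Theta(\lambda_{\mathrm{ALG}}))\ge(1+o(1))\,\mathrm{MMSE}^{\mathrm{trivial}}$. If $\beta\in(0,\tfrac12)$, then $$\mathrm{MMSE}^{\le D_n}\!\left(\frac{1}{\log^{3}n}\Big(\lambda+\mathbf\Delta_{a_n}\mathcal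 F_{\mathrm{ann},\lambda}\Big|_{q=q(D_n)}\Big)\right)=k^r-\widetilde O(1)=(1+o(1))\,\mathrm{MMSE}^{\mathrm{trivial}}.$$ In particular, since for some $\lambda=\widetilde\Theta(1)=\widetilde\Theta(\lambda_{\mathrm{ALG}})$ one has $\mathbf\Delta_{a_n}\mathcal F_{\mathrm{ann},\lambda}\big|_{q(D_n)}\ge0$, it follows that $\mathrm{MMSE}^{\le D_n}(\widetilde\Theta(\lambda_{\mathrm{ALG}}))\ge(1+o(1))\,\mathrm{MMSE}^{\mathrm{trivial}}$.
   Context: In the Gaussian additive model, $Z$ is a standard Gaussian vector independent of $X$ and $\lambda$ is the signal-to-noise ratio. Low-degree MMSE: with $\mathbb R[Y]_{\le D}$ the polynomials in $Y$ of total degree at most $D$, $\mathrm{MMSE}^{\le D}(\lambda):=\inf_{f_j\in\mathbb R[Y]_{\le D}}\mathbb E\big[\sum_j(f_j(Y)-X_j)^2\big]$, where $Y=\sqrt\lambda X+Z$ and $j$ ranges over the coordinates of $X$. $\mathrm{MMSE}^{\mathrm{trivial}}:=\mathbb E\|X\|^2-\|\mathbb E X\|^2$ is the mean squared error of the best constant estimator. Overlap quantile: for i.i.d. copies $X,X'$ and $D>0$, $q(D):=\inf\{y:\mathbb P(|\langle X,X'\rangle|\le y)\ge1-e^{-D}\}$. Note $\langle X,X'\rangle=\langle v,v'\rangle^r$. Annealed Franz–Parisi potential: $\mathcal F_{\mathrm{ann},\lambda}(q)=-\log\mathbb E[1_{\langle X,X'\rangle=q}e^{\lambda\langle X,X'\rangle}]=-\lambda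 q-\log\mathbb P(\langle X,X'\rangle=q)$ for $q$ in the support of $\langle X,X'\rangle$. Discrete derivative: for an overlap value $q=s^r$ with $s\ge0$ an integer, the step is $a_n=(s+2)^r-s^r$ and $\mathbf\Delta_{a_n}f(q)=\dfrac{f((s+2)^r)-f(s^r)}{(s+2)^r-s^r}$. Asymptotics are as $n\to\infty$; $\widetilde O,\widetilde\Theta$ hide factors polylogarithmic in $n$.
   Formalization: The equality MMSE = k^r − Õ(·) is false as written, since E‖X‖² exceeds k^r by order k^{r−1}; proved instead: MMSE = E‖X‖² − err with 0 ≤ err = Õ(·), hence MMSE ≥ k^r − err, with both MMSE and k^r − err equal to (1+o(1)) MMSE^trivial. *)

theory Defs
  imports "HOL-Probability.Probability" "HOL-Library.Landau_Symbols"
begin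

section \<open>Soft asymptotic notation\<close>

definition soft_O :: "(nat \<Rightarrow> real) \<Rightarrow> (nat \<Rightarrow> real) set" where
  "soft_O g = {f. \<exists>c::nat. f \<in> O(\<lambda>n. ln (real n) ^ c * g n)}"

definition soft_Theta :: "(nat \<Rightarrow> real) \<Rightarrow> (nat \<Rightarrow> real) set" where
  "soft_Theta g = {f. f \<in> soft_O g \<and> g \<in> soft_O f}"

section \<open>The Gaussian additive model\<close>

text \<open>Vectors with coordinates in a finite index set \<open>I\<close> are functions on the index type; only
  the values on \<open>I\<close> matter.  The law of the signal is a pmf \<open>P\<close>.\<close>

definition exponents_upto :: "'i set \<Rightarrow> nat \<Rightarrow> ('i \<Rightarrow> nat) set" where
  "exponents_upto I D = {a. (\<forall>i. i \<notin> I \<longrightarrow> a i = 0) \<and> (\<Sum>i\<in>I. a i) \<le> D}"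

definition polys_upto :: "'i set \<Rightarrow> nat \<Rightarrow> (('i \<Rightarrow> real) \<Rightarrow> real) set" where
  "polys_upto I D =
     {p. \<exists>c. p = (\<lambda>y. \<Sum>a\<in>exponents_upto I D. c a * (\<Prod>i\<in>I. y i ^ a i))}"

lemma finite_exponents_upto:
  assumes "finite I"
  shows "finite (exponents_upto I D)"
proof (rule finite_subset)
  show "exponents_upto I D \<subseteq> {a. \<forall>i. (i \<in> I \<longrightarrow> a i \<in> {..D}) \<and> (i \<notin> I \<longrightarrow> a i = 0)}"
  proof
    fix a assume a: "a \<in> exponents_upto I D"
    have "a i \<le> D" if "i \<in> I" for i
      using member_le_sum[of i I a] that assms a by (force simp: exponents_upto_def)
    with a show "a \<in> {a. \<forall>i. (i \<in> I \<longrightarrow> a i \<in> {..D}) \<and> (i \<notin> I \<longrightarrow> a i = 0)}"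
      by (auto simp: exponents_upto_def)
  qed
  show "finite {a. \<forall>i. (i \<in> I \<longrightarrow> a i \<in> {..D}) \<and> (i \<notin> I \<longrightarrow> a i = (0::nat))}"
    using assms by (intro finite_set_of_finite_funs) auto
qed

definition std_gaussian :: "'i set \<Rightarrow> ('i \<Rightarrow> real) measure" where
  "std_gaussian I = (\<Pi>\<^sub>M i\<in>I. density lborel (\<lambda>z. ennreal (std_normal_density z)))"

text \<open>\<open>Y = sqrt lam * X + Z\<close> on the product space, so that \<open>X\<close> and \<open>Z\<close> are independent.  When
  \<open>P\<close> has finite support, as below, the integrand is always integrable.\<close>

definition lowdeg_MMSE :: "'i set \<Rightarrow> ('i \<Rightarrow> real) pmf \<Rightarrow> nat \<Rightarrow> real \<Rightarrow> real" where
  "lowdeg_MMSE I P D lam =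
     (INF f \<in> {f. \<forall>j\<in>I. f j \<in> polys_upto I D}.
        \<integral>(x, z). (\<Sum>j\<in>I. (f j (\<lambda>i. sqrt lam * x i + z i) - x j)\<^sup>2)
          \<partial>(measure_pmf P \<Otimes>\<^sub>M std_gaussian I))"

definition second_moment :: "'i set \<Rightarrow> ('i \<Rightarrow> real) pmf \<Rightarrow> real" where
  "second_moment I P = measure_pmf.expectation P (\<lambda>x. \<Sum>j\<in>I. (x j)\<^sup>2)"

definition trivial_MMSE :: "'i set \<Rightarrow> ('i \<Rightarrow> real) pmf \<Rightarrow> real" where
  "trivial_MMSE I P =
     second_moment I P - (\<Sum>j\<in>I. (measure_pmf.expectation P (\<lambda>x. x j))\<^sup>2)"

section \<open>Overlap and the annealed Franz--Parisi potential\<close>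

definition overlap :: "'i set \<Rightarrow> ('i \<Rightarrow> real) \<Rightarrow> ('i \<Rightarrow> real) \<Rightarrow> real" where
  "overlap I x x' = (\<Sum>j\<in>I. x j * x' j)"

definition overlap_quantile :: "'i set \<Rightarrow> ('i \<Rightarrow> real) pmf \<Rightarrow> real \<Rightarrow> real" where
  "overlap_quantile I P D =
     Inf {y. measure_pmf.prob (pair_pmf P P) {(x, x'). \<bar>overlap I x x'\<bar> \<le> y} \<ge> 1 - exp (- D)}"

text \<open>Meaningful only for \<open>q\<close> in the support of the overlap (elsewhere \<open>ln 0 = 0\<close>).\<close>

definition annealed_FP :: "'i set \<Rightarrow> ('i \<Rightarrow> real) pmf \<Rightarrow> real \<Rightarrow> real \<Rightarrow> real" where
  "annealed_FP I P lam q =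
     - ln (measure_pmf.expectation (pair_pmf P P)
         (\<lambda>(x, x'). of_bool (overlap I x x' = q) * exp (lam * overlap I x x')))"

text \<open>Used only at values \<open>q = s ^ r\<close> with \<open>s\<close> a natural number and \<open>r > 0\<close>.\<close>

definition discrete_deriv :: "nat \<Rightarrow> (real \<Rightarrow> real) \<Rightarrow> real \<Rightarrow> real" where
  "discrete_deriv r f q =
     (let s = (THE s::nat. real s ^ r = q)
      in (f (real (s + 2) ^ r) - f (real s ^ r)) / (real (s + 2) ^ r - real s ^ r))"

section \<open>Sparse Rademacher tensor PCA\<close>

text \<open>\<open>bernoulli_pmf\<close> clips its parameter to the unit interval; nothing is clipped for
  \<open>0 \<le> k \<le> n\<close>.\<close>

definition sparse_rademacher :: "nat \<Rightarrow> real \<Rightarrow> real pmf" where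
  "sparse_rademacher n k =
     bind_pmf (bernoulli_pmf (k / real n)) (\<lambda>nonzero.
       if nonzero then map_pmf (\<lambda>pos. if pos then 1 else - 1) (bernoulli_pmf (1 / 2))
       else return_pmf 0)"

definition tensor_index :: "nat \<Rightarrow> nat \<Rightarrow> nat list set" where
  "tensor_index r n = {js. length js = r \<and> set js \<subseteq> {..<n}}"

text \<open>The coordinates of the \<open>r\<close>-th tensor power of \<open>v\<close> are the values at the lists of length \<open>r\<close>.\<close>

definition tensor_power :: "(nat \<Rightarrow> real) \<Rightarrow> nat list \<Rightarrow> real" where
  "tensor_power v js = (\<Prod>j\<leftarrow>js. v j)"

definition tensor_prior :: "nat \<Rightarrow> real \<Rightarrow> (nat list \<Rightarrow> real) pmf" where
  "tensor_prior n k = map_pmf tensor_power (Pi_pmf {..<n} 0 (\<lambda>_. sparse_rademacher n k))"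

lemma tensor_index_Suc:
  "tensor_index (Suc r) n = (\<lambda>(j, js). j # js) ` ({..<n} \<times> tensor_index r n)"
  by (force simp: tensor_index_def length_Suc_conv)

lemma overlap_tensor_power:
  "overlap (tensor_index r n) (tensor_power v) (tensor_power v') = (\<Sum>j<n. v j * v' j) ^ r"
proof (induction r)
  case 0
  have "tensor_index 0 n = {[]}" by (auto simp: tensor_index_def)
  then show ?case by (simp add: overlap_def tensor_power_def)
next
  case (Suc r)
  have "inj_on (\<lambda>(j, js). j # js) ({..<n} \<times> tensor_index r n)" by (auto simp: inj_on_def)
  then have "overlap (tensor_index (Suc r) n) (tensor_power v) (tensor_power v') =
     (\<Sum>(j, js)\<in>{..<n} \<times> tensor_index r n.
        (v j * v' j) * (tensor_power v js * tensor_power v' js))"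
    unfolding overlap_def tensor_index_Suc
    by (simp add: sum.reindex tensor_power_def case_prod_unfold algebra_simps)
  also have "\<dots> = (\<Sum>j<n. v j * v' j) * overlap (tensor_index r n) (tensor_power v) (tensor_power v')"
    by (simp add: overlap_def sum_product sum.cartesian_product)
  finally show ?case using Suc by simp
qed

abbreviation tpca_MMSE :: "nat \<Rightarrow> nat \<Rightarrow> real \<Rightarrow> nat \<Rightarrow> real \<Rightarrow> real" where
  "tpca_MMSE r n k \<equiv> lowdeg_MMSE (tensor_index r n) (tensor_prior n k)"

abbreviation tpca_second_moment :: "nat \<Rightarrow> nat \<Rightarrow> real \<Rightarrow> real" where
  "tpca_second_moment r n k \<equiv> second_moment (tensor_index r n) (tensor_prior n k)"

abbreviation tpca_trivial_MMSE :: "nat \<Rightarrow> nat \<Rightarrow> real \<Rightarrow> real" where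
  "tpca_trivial_MMSE r n k \<equiv> trivial_MMSE (tensor_index r n) (tensor_prior n k)"

abbreviation tpca_FP_deriv :: "nat \<Rightarrow> nat \<Rightarrow> real \<Rightarrow> nat \<Rightarrow> real \<Rightarrow> real" where
  "tpca_FP_deriv r n k D lam \<equiv>
     discrete_deriv r (annealed_FP (tensor_index r n) (tensor_prior n k) lam)
       (overlap_quantile (tensor_index r n) (tensor_prior n k) (real D))"

definition degree_cutoff :: "real \<Rightarrow> nat \<Rightarrow> nat" where
  "degree_cutoff \<beta> n = nat \<lfloor>(1 - \<beta>) * ln (real n)\<rfloor>"

text \<open>\<open>M = k ^ r - soft_O g = (1 + o(1)) * T\<close>.  Since \<open>E (norm X)^2 = E (norm v)^(2 * r)\<close> exceeds
  \<open>k ^ r\<close> by order \<open>k ^ (r - 1)\<close>, which is not \<open>soft_O g\<close> for the rates \<open>g\<close> of interest, an exact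
  equality is only possible with \<open>E (norm X)^2\<close> (the argument \<open>S\<close>) as main term; with
  \<open>K = k ^ r\<close> the same error gives a lower bound.\<close>

definition MMSE_expansion ::
  "(nat \<Rightarrow> real) \<Rightarrow> (nat \<Rightarrow> real) \<Rightarrow> (nat \<Rightarrow> real) \<Rightarrow> (nat \<Rightarrow> real) \<Rightarrow> (nat \<Rightarrow> real) \<Rightarrow> bool" where
  "MMSE_expansion M S K T g \<longleftrightarrow>
     (\<exists>err \<in> soft_O g.
        (\<forall>\<^sub>F n in sequentially. 0 \<le> err n \<and> M n = S n - err n \<and> M n \<ge> K n - err n) \<and>
        (\<lambda>n. K n - err n) \<sim>[sequentially] T) \<and>
     M \<sim>[sequentially] T"

definition asymp_at_least :: "(nat \<Rightarrow> real) \<Rightarrow> (nat \<Rightarrow> real) \<Rightarrow> bool" where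
  "asymp_at_least M T \<longleftrightarrow>
     (\<exists>\<delta>. \<delta> \<longlonglongrightarrow> 0 \<and> (\<forall>\<^sub>F n in sequentially. M n \<ge> (1 + \<delta> n) * T n))"

end

theory Submission
  imports Defs "HOL-Computational_Algebra.Polynomial" "HOL-Real_Asymp.Real_Asymp"
begin

text \<open>For the upper bound on the correlation, a polynomial \<open>w\<close> in the noise \<open>Z\<close> alone with
  \<open>E (w f(Y)) = E (X\<^sub>j f(Y))\<close> for all \<open>f\<close> of degree at most \<open>D\<close> certifies
  \<open>E (f(Y) - X\<^sub>j)^2 \<ge> E X\<^sub>j^2 - E w^2\<close>, because \<open>2 f w - f^2 \<le> w^2\<close>.  In the Hermite basis the
  conditions on \<open>w\<close> form a unitriangular system whose off-diagonal part is a contraction once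
  \<open>\<Sum>\<^sub>d (lam D)^d E \<langle>X, X'\<rangle>^d / d!\<close> over \<open>1 \<le> d \<le> D\<close> is small.

  The overlap is \<open>T^r\<close> for a lazy symmetric random walk \<open>T\<close>, and \<open>lam + FP'\<close> is a finite difference
  of \<open>ln P(T = s)\<close>, hence independent of \<open>lam\<close>.  Its size follows from a three-term recurrence for
  \<open>P(T = s)\<close> and monotonicity in \<open>\<bar>s\<bar>\<close>; the quantile \<open>s\<close> is located with exponential moments and
  the Paley--Zygmund inequality.\<close>

section \<open>Hermite polynomials\<close>

text \<open>A certificate in the noise alone has an explicit norm, because Hermite products are
  orthogonal under the Gaussian law. The price is the triangular system: \<open>Y\<close> is
  \<open>Z\<close> shifted by a random vector. The rest is a balance of powers of one scale. With
  \<sigma> = k / sqrt n, the standard deviation of the walk, the overlap moments of degree up to D +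
  1 grow by at most a factor of order (r (D + 1) \<sigma>)^r per degree, while for \<beta> > 1/2 the
  slope at the quantile is at most 2^r / \<sigma>^r. The powers of \<sigma> cancel, and the
  prefactor absorbs the remaining powers of D with one logarithm to spare. For \<beta> < 1/2 the
  variance V = k^2 / n tends to 0 polynomially, so exponential moments stay bounded up to \<theta> =
  - ln V, of order log n; the quantile and the moment scale are then bounded, and the slope is at
  most of order log n. As lam + FP' is the same sequence L for every lam, one MMSE bound at pref * L
  serves all claims, and L itself is a signal-to-noise ratio at which the derivative
  vanishes.\<close>

definition std_normal :: "real measure" where
  "std_normal = density lborel (\<lambda>z. ennreal (std_normal_density z))"

lemma std_gaussian_eq: "std_gaussian I = (\<Pi>\<^sub>M i\<in>I. std_normal)"
  by (simp add: std_gaussian_def std_normal_def)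

lemma prob_space_std_normal: "prob_space std_normal"
  unfolding std_normal_def by (rule prob_space_normal_density) simp

interpretation std_normal: prob_space std_normal
  by (rule prob_space_std_normal)

lemma sets_std_normal [simp, measurable_cong]: "sets std_normal = sets borel"
  by (simp add: std_normal_def)

lemma space_std_normal [simp]: "space std_normal = UNIV"
  by (simp add: std_normal_def)

lemma integrable_std_normal_power: "integrable std_normal (\<lambda>x. x ^ n)"
  unfolding std_normal_def
  by (subst integrable_density) (auto intro: integrable_std_normal_moment)

lemma integrable_std_normal_poly: "integrable std_normal (poly q)"
  unfolding poly_altdef
  by (intro Bochner_Integration.integrable_sum integrable_mult_right integrable_std_normal_power)

text \<open>A functional on formal polynomials, so that integration by parts becomes an algebraic
  identity between multiplication by \<open>[:0,1:]\<close> and \<open>pderiv\<close>.\<close>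

definition gauss_poly :: "real poly \<Rightarrow> real" where
  "gauss_poly q = (\<integral>x. poly q x \<partial>std_normal)"

lemma gauss_poly_add: "gauss_poly (p + q) = gauss_poly p + gauss_poly q"
  by (simp add: gauss_poly_def Bochner_Integration.integral_add integrable_std_normal_poly)

lemma gauss_poly_diff: "gauss_poly (p - q) = gauss_poly p - gauss_poly q"
  by (simp add: gauss_poly_def Bochner_Integration.integral_diff integrable_std_normal_poly)

lemma gauss_poly_smult: "gauss_poly (smult c p) = c * gauss_poly p"
  by (simp add: gauss_poly_def)

lemma gauss_poly_const: "gauss_poly [:c:] = c"
  using std_normal.prob_space by (simp add: gauss_poly_def)

lemma gauss_poly_1: "gauss_poly 1 = 1"
  using gauss_poly_const[of 1] by (simp add: pCons_one)

lemma gauss_poly_lborel: "gauss_poly q = (\<integral>x. std_normal_density x * poly q x \<partial>lborel)"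
proof -
  have "poly q \<in> borel_measurable borel"
    using borel_measurable_integrable[OF integrable_std_normal_poly[of q]]
    by (simp cong: measurable_cong_sets)
  then show ?thesis
    unfolding gauss_poly_def std_normal_def by (subst integral_density) auto
qed

lemma gauss_poly_power_even: "gauss_poly ([:0,1:] ^ (2 * k)) = fact (2 * k) / (2 ^ k * fact k)"
  using integral_std_normal_moment_even[of k] by (simp add: gauss_poly_lborel poly_power)

lemma gauss_poly_power_odd: "gauss_poly ([:0,1:] ^ (2 * k + 1)) = 0"
  using integral_std_normal_moment_odd[of k] by (simp add: gauss_poly_lborel poly_power)

text \<open>Integration by parts on monomials, read off the closed forms of the moments: odd ones
  vanish, and consecutive even ones satisfy E x^(m+2) = (m+1) E x^m.\<close>

lemma gauss_poly_power_Suc: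
  "gauss_poly ([:0,1:] * [:0,1:] ^ n) = gauss_poly (pderiv ([:0,1:] ^ n))"
proof (cases n)
  case 0
  then show ?thesis using gauss_poly_power_odd[of 0] by (simp add: gauss_poly_const[of 0, simplified])
next
  case (Suc m)
  have d: "pderiv ([:0,1:] ^ Suc m) = smult (real (Suc m)) ([:0,1:] ^ m)"
    by (subst pderiv_power_Suc) (simp add: pderiv_pCons)
  show ?thesis
  proof (cases "even m")
    case True
    then obtain k where m: "m = 2 * k" by blast
    have "[:0,1:] * [:0,1:] ^ n = ([:0,1:] ^ (2 * Suc k) :: real poly)"
      by (simp add: Suc m)
    then have "gauss_poly ([:0,1:] * [:0,1:] ^ n) = fact (2 * Suc k) / (2 ^ Suc k * fact (Suc k))"
      by (simp only: gauss_poly_power_even)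
    also have "\<dots> = real (Suc m) * (fact (2 * k) / (2 ^ k * fact k))"
    proof -
      have "fact (2 * Suc k) = 2 * (real k + 1) * (2 * real k + 1) * (fact (2 * k) :: real)"
        by (simp add: algebra_simps)
      moreover have "2 ^ Suc k * fact (Suc k) = 2 * (real k + 1) * (2 ^ k * fact k)"
        by (simp add: algebra_simps)
      ultimately show ?thesis
        by (simp only:) (simp add: m)
    qed
    finally show ?thesis
      by (simp only: Suc d gauss_poly_smult) (simp add: m gauss_poly_power_even)
  next
    case False
    then obtain k where m: "m = 2 * k + 1" using oddE by blast
    have "[:0,1:] * [:0,1:] ^ n = ([:0,1:] ^ (2 * (k + 1) + 1) :: real poly)"
      by (simp add: Suc m)
    then have "gauss_poly ([:0,1:] * [:0,1:] ^ n) = 0"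
      by (simp only: gauss_poly_power_odd)
    moreover have "gauss_poly ([:0,1:] ^ m) = 0"
      unfolding m by (rule gauss_poly_power_odd)
    ultimately show ?thesis
      by (simp only: Suc d gauss_poly_smult)
  qed
qed

lemma gauss_poly_stein: "gauss_poly ([:0,1:] * q) = gauss_poly (pderiv q)"
proof -
  \<comment> \<open>The induction on coefficients moves one factor \<open>[:0,1:]\<close> at a time
    from \<open>q\<close> into the monomial, so the monomial has to be arbitrary.\<close>
  have "gauss_poly ([:0,1:] * ([:0,1:] ^ n * q)) = gauss_poly (pderiv ([:0,1:] ^ n * q))" for n
  proof (induction q arbitrary: n)
    case 0
    then show ?case by simp
  next
    case (pCons a q)
    have e: "[:0,1:] ^ n * pCons a q = smult a ([:0,1:] ^ n) + [:0,1:] ^ Suc n * q"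
      by (simp add: pCons_one mult.assoc [symmetric])
    show ?case
      unfolding e by (simp only: distrib_left pderiv_add gauss_poly_add pCons.IH pderiv_smult
          mult_smult_right gauss_poly_smult gauss_poly_power_Suc)
  qed
  from this[of 0] show ?thesis by simp
qed

text \<open>The probabilists' Hermite polynomials, generated by the creation operator x - d/dx. This
  operator is the adjoint of d/dx under the Gaussian law, which drives the orthogonality
  proof.\<close>

primrec hermite :: "nat \<Rightarrow> real poly" where
  "hermite 0 = 1"
| "hermite (Suc n) = [:0,1:] * hermite n - pderiv (hermite n)"

lemma pderiv_hermite: "pderiv (hermite n) = smult (real n) (hermite (n - 1))"
proof (induction n)
  case (Suc n)
  have "pderiv (hermite (Suc n)) =
      hermite n + [:0,1:] * smult (real n) (hermite (n - 1)) - pderiv (smult (real n) (hermite (n - 1)))"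
    by (simp only: hermite.simps pderiv_diff pderiv_mult Suc.IH) (simp add: pderiv_pCons algebra_simps)
  also have "\<dots> = hermite n + smult (real n) ([:0,1:] * hermite (n - 1) - pderiv (hermite (n - 1)))"
    by (simp add: smult_diff_right pderiv_smult algebra_simps)
  also have "\<dots> = smult (real (Suc n)) (hermite n)"
  proof (cases n)
    case (Suc l)
    then have "[:0,1:] * hermite (n - 1) - pderiv (hermite (n - 1)) = hermite n" by simp
    then show ?thesis by (simp only:) (simp add: smult_add_left)
  qed simp
  finally show ?case by simp
qed simp

lemma hermite_rec: "x * poly (hermite n) x = poly (hermite (Suc n)) x + real n * poly (hermite (n - 1)) x"
  by (simp add: pderiv_hermite)

lemma gauss_hermite_Suc: "gauss_poly (hermite (Suc n) * q) = gauss_poly (hermite n * pderiv q)"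
proof -
  have "hermite (Suc n) * q = [:0,1:] * (hermite n * q) - pderiv (hermite n) * q"
    by (simp add: algebra_simps)
  then have "gauss_poly (hermite (Suc n) * q) =
      gauss_poly (pderiv (hermite n * q)) - gauss_poly (pderiv (hermite n) * q)"
    by (simp only: gauss_poly_diff gauss_poly_stein)
  then show ?thesis
    by (simp add: pderiv_mult gauss_poly_add mult.commute)
qed

lemma gauss_hermite_orthogonal:
  "gauss_poly (hermite m * hermite n) = (if m = n then fact m else 0)"
proof (induction m arbitrary: n)
  case 0
  show ?case
  proof (cases n)
    case 0 then show ?thesis by (simp add: gauss_poly_1)
  next
    case (Suc k)
    have "gauss_poly (hermite (Suc k) * 1) = gauss_poly (hermite k * pderiv 1)"
      by (rule gauss_hermite_Suc)
    then show ?thesis using gauss_poly_const[of 0] Suc by simp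
  qed
next
  case (Suc m)
  show ?case
    by (cases n) (use gauss_poly_const[of 0] gauss_hermite_Suc[of m 1] in
        \<open>auto simp: gauss_hermite_Suc pderiv_hermite gauss_poly_smult Suc.IH simp del: hermite.simps(2)\<close>)
qed

text \<open>Hermite polynomials form an Appell sequence, so a shift acts by the binomial formula.
  The three-term recurrence has two predecessors, hence the strong induction.\<close>

lemma hermite_add:
  "poly (hermite n) (x + a) = (\<Sum>i\<le>n. real (n choose i) * poly (hermite i) x * a ^ (n - i))"
proof (induction n rule: less_induct)
  case (less n)
  show ?case
  proof (cases n)
    case 0 then show ?thesis by simp
  next
    case (Suc m)
    let ?h = "\<lambda>i. poly (hermite i) x"
    have m: "poly (hermite m) (x + a) = (\<Sum>i\<le>m. real (m choose i) * ?h i * a ^ (m - i))"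
      using less[of m] Suc by simp
    \<comment> \<open>Absorbing i into the binomial coefficient resums the lowering terms to m times
      the expansion of degree m - 1, which cancels in the recurrence.\<close>
    have m1: "real m * poly (hermite (m - 1)) (x + a) =
        (\<Sum>i\<le>m. real i * real (m choose i) * ?h (i - 1) * a ^ (m - i))"
    proof (cases m)
      case 0 then show ?thesis by simp
    next
      case (Suc l)
      have "(\<Sum>i\<le>m. real i * real (m choose i) * ?h (i - 1) * a ^ (m - i)) =
          (\<Sum>i\<le>l. (real (Suc i) * real (Suc l choose Suc i)) * ?h i * a ^ (l - i))"
        unfolding Suc by (subst sum.atMost_Suc_shift) simp
      also have "\<dots> = (\<Sum>i\<le>l. (real (Suc l) * real (l choose i)) * ?h i * a ^ (l - i))"
        by (intro sum.cong refl, simp only: of_nat_mult [symmetric] Suc_times_binomial_eq mult.commute)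
      also have "\<dots> = real m * (\<Sum>i\<le>l. real (l choose i) * ?h i * a ^ (l - i))"
        by (simp add: Suc sum_distrib_left mult.assoc)
      finally show ?thesis using less[of l] \<open>n = Suc m\<close> Suc by simp
    qed
    have "(\<Sum>i\<le>Suc m. real (Suc m choose i) * ?h i * a ^ (Suc m - i)) =
        (\<Sum>i\<le>m. real (m choose i) * ?h (Suc i) * a ^ (m - i))
        + (a ^ Suc m + (\<Sum>i\<le>m. real (m choose Suc i) * ?h (Suc i) * a ^ (m - i)))"
      by (subst sum.atMost_Suc_shift) (simp add: algebra_simps sum.distrib del: hermite.simps(2))
    also have "a ^ Suc m + (\<Sum>i\<le>m. real (m choose Suc i) * ?h (Suc i) * a ^ (m - i)) =
        (\<Sum>i\<le>Suc m. real (m choose i) * ?h i * a ^ (Suc m - i))"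
      by (simp add: sum.atMost_Suc_shift [of _ m] del: hermite.simps(2) sum.atMost_Suc)
    also have "\<dots> = a * (\<Sum>i\<le>m. real (m choose i) * ?h i * a ^ (m - i))"
      by (simp add: sum_distrib_left Suc_diff_le mult_ac del: hermite.simps(2))
    finally have *: "(\<Sum>i\<le>Suc m. real (Suc m choose i) * ?h i * a ^ (Suc m - i)) =
        a * (\<Sum>i\<le>m. real (m choose i) * ?h i * a ^ (m - i)) +
        (\<Sum>i\<le>m. real (m choose i) * ?h (Suc i) * a ^ (m - i))" by simp
    have "x * (\<Sum>i\<le>m. real (m choose i) * ?h i * a ^ (m - i)) =
        (\<Sum>i\<le>m. real (m choose i) * (x * ?h i) * a ^ (m - i))"
      by (simp add: sum_distrib_left mult_ac)
    also have "\<dots> = (\<Sum>i\<le>m. real (m choose i) * ?h (Suc i) * a ^ (m - i)) +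
        (\<Sum>i\<le>m. real i * real (m choose i) * ?h (i - 1) * a ^ (m - i))"
      by (simp add: hermite_rec algebra_simps sum.distrib del: hermite.simps(2))
    finally have **: "x * poly (hermite m) (x + a) =
        (\<Sum>i\<le>m. real (m choose i) * ?h (Suc i) * a ^ (m - i)) + real m * poly (hermite (m - 1)) (x + a)"
      by (simp only: m m1)
    have "poly (hermite (Suc m)) (x + a) = (x + a) * poly (hermite m) (x + a) - real m * poly (hermite (m - 1)) (x + a)"
      using hermite_rec[of "x + a" m] by simp
    also have "\<dots> = (\<Sum>i\<le>Suc m. real (Suc m choose i) * ?h i * a ^ (Suc m - i))"
      unfolding * using ** m by (simp add: algebra_simps)
    finally show ?thesis unfolding Suc .
  qed
qed

lemma power_hermite_expansion:
  "\<exists>c. \<forall>x. x ^ n = (\<Sum>i\<le>n. c i * poly (hermite i) x)"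
proof (induction n)
  case 0
  show ?case by (rule exI[of _ "\<lambda>_. 1"]) simp
next
  case (Suc n)
  then obtain c where c: "x ^ n = (\<Sum>i\<le>n. c i * poly (hermite i) x)" for x by blast
  \<comment> \<open>Multiplication by x sends index i to i + 1 and, with factor i, to i - 1; the two
    summands collect what arrives at a given index.\<close>
  let ?c = "\<lambda>i. (if i = 0 then 0 else c (i - 1)) + (if Suc i \<le> n then real (Suc i) * c (Suc i) else 0)"
  have "x ^ Suc n = (\<Sum>i\<le>Suc n. ?c i * poly (hermite i) x)" for x
  proof -
    let ?h = "\<lambda>i. poly (hermite i) x"
    have "x ^ Suc n = (\<Sum>i\<le>n. c i * (x * ?h i))"
      by (simp add: c sum_distrib_left mult_ac)
    also have "\<dots> = (\<Sum>i\<le>n. c i * ?h (Suc i)) + (\<Sum>i\<le>n. real i * c i * ?h (i - 1))"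
      by (simp only: hermite_rec) (simp add: algebra_simps sum.distrib del: hermite.simps(2))
    also have "(\<Sum>i\<le>n. c i * ?h (Suc i)) = (\<Sum>i\<le>Suc n. (if i = 0 then 0 else c (i - 1)) * ?h i)"
      by (subst sum.atMost_Suc_shift) (simp del: hermite.simps(2))
    also have "(\<Sum>i\<le>n. real i * c i * ?h (i - 1)) =
        (\<Sum>i\<le>Suc n. (if Suc i \<le> n then real (Suc i) * c (Suc i) else 0) * ?h i)"
    proof (cases n)
      case 0 then show ?thesis by simp
    next
      case (Suc l)
      have "(\<Sum>i\<le>n. real i * c i * ?h (i - 1)) = (\<Sum>i\<le>l. real (Suc i) * c (Suc i) * ?h i)"
        unfolding Suc by (subst sum.atMost_Suc_shift) simp
      also have "\<dots> = (\<Sum>i\<le>Suc n. (if Suc i \<le> n then real (Suc i) * c (Suc i) else 0) * ?h i)"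
        unfolding Suc by simp
      finally show ?thesis .
    qed
    finally show ?thesis by (simp add: sum.distrib [symmetric] algebra_simps)
  qed
  then show ?case by (intro exI[of _ ?c]) blast
qed

section \<open>Products of Hermite polynomials\<close>

text \<open>Multi-indices are total functions vanishing off \<open>I\<close>, so
  \<open>{..u}\<close> is a finite box; restriction to \<open>I\<close> identifies it with the
  extensional product to which distributivity applies.\<close>

lemma prod_sum_atMost:
  fixes f :: "'i \<Rightarrow> nat \<Rightarrow> real"
  assumes "finite I" and u: "\<And>i. i \<notin> I \<Longrightarrow> u i = 0"
  shows "(\<Prod>i\<in>I. \<Sum>j\<le>u i. f i j) = (\<Sum>\<alpha>\<in>{..u}. \<Prod>i\<in>I. f i (\<alpha> i))"
proof -
  have "(\<Prod>i\<in>I. \<Sum>j\<le>u i. f i j) = (\<Sum>g\<in>PiE I (\<lambda>i. {..u i}). \<Prod>i\<in>I. f i (g i))"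
    using assms by (intro prod_sum_PiE) auto
  also have "\<dots> = (\<Sum>\<alpha>\<in>{..u}. \<Prod>i\<in>I. f i (\<alpha> i))"
  proof (rule sum.reindex_bij_witness[of _ "\<lambda>\<alpha>. restrict \<alpha> I" "\<lambda>g i. if i \<in> I then g i else 0"])
    fix \<alpha> :: "'i \<Rightarrow> nat" assume \<alpha>: "\<alpha> \<in> {..u}"
    then have "\<alpha> i = 0" if "i \<notin> I" for i
      using u[OF that] by (metis atMost_iff le_fun_def le_zero_eq)
    then show "(\<lambda>i. if i \<in> I then restrict \<alpha> I i else 0) = \<alpha>" by auto
    from \<alpha> show "restrict \<alpha> I \<in> PiE I (\<lambda>i. {..u i})" by (auto simp: le_fun_def)
  next
    fix g assume g: "g \<in> PiE I (\<lambda>i. {..u i})"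
    then show "restrict (\<lambda>i. if i \<in> I then g i else 0) I = g"
      by (auto simp: fun_eq_iff PiE_def extensional_def)
    from g show "(\<lambda>i. if i \<in> I then g i else 0) \<in> {..u}"
      by (auto simp: le_fun_def PiE_def)
  qed auto
  finally show ?thesis .
qed

definition mfact :: "'i set \<Rightarrow> ('i \<Rightarrow> nat) \<Rightarrow> real" where
  "mfact I u = (\<Prod>i\<in>I. fact (u i))"

definition mbinom :: "'i set \<Rightarrow> ('i \<Rightarrow> nat) \<Rightarrow> ('i \<Rightarrow> nat) \<Rightarrow> real" where
  "mbinom I u \<alpha> = (\<Prod>i\<in>I. real (u i choose \<alpha> i))"

definition mpow :: "'i set \<Rightarrow> ('i \<Rightarrow> real) \<Rightarrow> ('i \<Rightarrow> nat) \<Rightarrow> real" where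
  "mpow I x u = (\<Prod>i\<in>I. x i ^ u i)"

definition mhermite :: "'i set \<Rightarrow> ('i \<Rightarrow> nat) \<Rightarrow> ('i \<Rightarrow> real) \<Rightarrow> real" where
  "mhermite I u z = (\<Prod>i\<in>I. poly (hermite (u i)) (z i))"

lemma mfact_pos: "mfact I u > 0"
  by (simp add: mfact_def prod_pos)

lemma exponents_upto_outside: "u \<in> exponents_upto I D \<Longrightarrow> i \<notin> I \<Longrightarrow> u i = 0"
  by (simp add: exponents_upto_def)

lemma exponents_upto_downward:
  assumes "u \<in> exponents_upto I D" "\<alpha> \<le> u"
  shows "\<alpha> \<in> exponents_upto I D"
proof -
  have le: "\<alpha> i \<le> u i" for i using assms(2) by (simp add: le_fun_def)
  then have "\<alpha> i = 0" if "i \<notin> I" for i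
    using assms(1) that le[of i] by (simp add: exponents_upto_def)
  moreover have "sum \<alpha> I \<le> D"
    using sum_mono[of I \<alpha> u] le assms(1) by (simp add: exponents_upto_def)
  ultimately show ?thesis by (simp add: exponents_upto_def)
qed

lemma exponents_upto_diff:
  assumes "u \<in> exponents_upto I D"
  shows "(\<lambda>i. u i - \<alpha> i) \<in> exponents_upto I D"
  using assms by (rule exponents_upto_downward) (simp add: le_fun_def)

lemma finite_atMost_exponent:
  assumes "finite I" "u \<in> exponents_upto I D"
  shows "finite {..u}"
  by (rule finite_subset[OF _ finite_exponents_upto[OF assms(1), of D]])
     (simp add: subset_iff exponents_upto_downward[OF assms(2)])

lemma zero_exponent: "(\<lambda>_. 0) \<in> exponents_upto I D"
  by (simp add: exponents_upto_def)

lemma mhermite_zero: "mhermite I (\<lambda>_. 0) = (\<lambda>_. 1)"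
  by (simp add: mhermite_def fun_eq_iff)

lemma mhermite_add:
  assumes "finite I" "u \<in> exponents_upto I D"
  shows "mhermite I u (\<lambda>i. z i + a i) =
    (\<Sum>\<alpha>\<le>u. mbinom I u \<alpha> * mhermite I \<alpha> z * mpow I a (\<lambda>i. u i - \<alpha> i))"
proof -
  have "mhermite I u (\<lambda>i. z i + a i) = (\<Prod>i\<in>I. \<Sum>j\<le>u i.
      real (u i choose j) * poly (hermite j) (z i) * a i ^ (u i - j))"
    by (simp only: mhermite_def hermite_add)
  also have "\<dots> = (\<Sum>\<alpha>\<le>u. \<Prod>i\<in>I. real (u i choose \<alpha> i) * poly (hermite (\<alpha> i)) (z i) * a i ^ (u i - \<alpha> i))"
    by (rule prod_sum_atMost[OF assms(1)]) (rule exponents_upto_outside[OF assms(2)])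
  finally show ?thesis by (simp only: mhermite_def mbinom_def mpow_def prod.distrib)
qed

lemma mpow_hermite_expansion:
  assumes "finite I" "u \<in> exponents_upto I D"
  obtains c where "\<And>y. mpow I y u = (\<Sum>\<alpha>\<le>u. c \<alpha> * mhermite I \<alpha> y)"
proof -
  obtain c where c: "x ^ n = (\<Sum>i\<le>n. c n i * poly (hermite i) x)" for x n
    using power_hermite_expansion by metis
  have "mpow I y u = (\<Sum>\<alpha>\<le>u. (\<Prod>i\<in>I. c (u i) (\<alpha> i)) * mhermite I \<alpha> y)" for y
  proof -
    have "mpow I y u = (\<Prod>i\<in>I. \<Sum>j\<le>u i. c (u i) j * poly (hermite j) (y i))"
      by (simp only: mpow_def c)
    also have "\<dots> = (\<Sum>\<alpha>\<le>u. \<Prod>i\<in>I. c (u i) (\<alpha> i) * poly (hermite (\<alpha> i)) (y i))"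
      by (rule prod_sum_atMost[OF assms(1)]) (rule exponents_upto_outside[OF assms(2)])
    finally show ?thesis by (simp only: mhermite_def prod.distrib)
  qed
  then show ?thesis by (rule that)
qed

section \<open>Polynomials of bounded degree in the Hermite basis\<close>

definition hermite_span :: "'i set \<Rightarrow> nat \<Rightarrow> (('i \<Rightarrow> real) \<Rightarrow> real) set" where
  "hermite_span I D = {p. \<exists>c. p = (\<lambda>y. \<Sum>u\<in>exponents_upto I D. c u * mhermite I u y)}"

lemma hermite_span_atMost:
  assumes "finite I" "u \<in> exponents_upto I D"
  shows "(\<lambda>y. \<Sum>\<alpha>\<le>u. c \<alpha> * mhermite I \<alpha> y) \<in> hermite_span I D"
proof -
  have "(\<Sum>\<alpha>\<le>u. c \<alpha> * mhermite I \<alpha> y) =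
      (\<Sum>\<alpha>\<in>exponents_upto I D. (if \<alpha> \<le> u then c \<alpha> else 0) * mhermite I \<alpha> y)" for y
    using exponents_upto_downward[OF assms(2)] finite_exponents_upto[OF assms(1)]
    by (intro sum.mono_neutral_cong_left) auto
  then show ?thesis
    unfolding hermite_span_def
    by (intro CollectI exI[of _ "\<lambda>\<alpha>. if \<alpha> \<le> u then c \<alpha> else 0"] ext)
qed

lemma hermite_span_add:
  assumes "p \<in> hermite_span I D" "q \<in> hermite_span I D"
  shows "(\<lambda>y. p y + q y) \<in> hermite_span I D"
proof -
  from assms obtain c d where "p = (\<lambda>y. \<Sum>u\<in>exponents_upto I D. c u * mhermite I u y)"
    "q = (\<lambda>y. \<Sum>u\<in>exponents_upto I D. d u * mhermite I u y)"
    unfolding hermite_span_def by blast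
  then have "(\<lambda>y. p y + q y) = (\<lambda>y. \<Sum>u\<in>exponents_upto I D. (c u + d u) * mhermite I u y)"
    by (simp add: algebra_simps sum.distrib)
  then show ?thesis unfolding hermite_span_def by (intro CollectI exI)
qed

lemma hermite_span_cmult:
  assumes "p \<in> hermite_span I D"
  shows "(\<lambda>y. a * p y) \<in> hermite_span I D"
proof -
  from assms obtain c where "p = (\<lambda>y. \<Sum>u\<in>exponents_upto I D. c u * mhermite I u y)"
    unfolding hermite_span_def by blast
  then have "(\<lambda>y. a * p y) = (\<lambda>y. \<Sum>u\<in>exponents_upto I D. (a * c u) * mhermite I u y)"
    by (simp add: sum_distrib_left mult.assoc)
  then show ?thesis unfolding hermite_span_def by (intro CollectI exI)
qed

lemma hermite_span_const:
  fixes I :: "'i set"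
  assumes "finite I"
  shows "(\<lambda>_. a) \<in> hermite_span I D"
proof -
  from assms have "(\<lambda>y. \<Sum>\<alpha>\<le>(\<lambda>_. 0). a * mhermite I \<alpha> y) \<in> hermite_span I D"
    by (rule hermite_span_atMost[OF _ zero_exponent])
  moreover have "{..(\<lambda>_. 0 :: nat)} = {\<lambda>_ :: 'i. 0}"
    by (auto simp: le_fun_def)
  ultimately show ?thesis by (simp add: mhermite_zero)
qed

lemma hermite_span_sum:
  assumes "finite I" "finite A" "\<And>a. a \<in> A \<Longrightarrow> f a \<in> hermite_span I D"
  shows "(\<lambda>y. \<Sum>a\<in>A. f a y) \<in> hermite_span I D"
  using assms(2,3)
  by (induction A rule: finite_induct) (auto intro: hermite_span_const hermite_span_add assms(1))

lemma polys_upto_subset_hermite_span: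
  assumes "finite I" "p \<in> polys_upto I D"
  shows "p \<in> hermite_span I D"
proof -
  from assms obtain c where p: "p = (\<lambda>y. \<Sum>a\<in>exponents_upto I D. c a * mpow I y a)"
    unfolding polys_upto_def mpow_def by blast
  have "(\<lambda>y. mpow I y a) \<in> hermite_span I D" if a: "a \<in> exponents_upto I D" for a
  proof -
    obtain d where "\<And>y. mpow I y a = (\<Sum>\<alpha>\<le>a. d \<alpha> * mhermite I \<alpha> y)"
      using mpow_hermite_expansion[OF assms(1) a] by blast
    then show ?thesis using hermite_span_atMost[OF assms(1) a, of d] by simp
  qed
  then show ?thesis unfolding p
    using assms(1) by (intro hermite_span_sum hermite_span_cmult finite_exponents_upto)
qed

text \<open>Only multi-indices below \<open>u\<close> occur after a shift, so the degree bound
  survives. For a fixed signal this puts f(Y), as a function of the noise, into the span.\<close>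

lemma hermite_span_shift:
  assumes "finite I" "p \<in> hermite_span I D"
  shows "(\<lambda>z. p (\<lambda>i. z i + a i)) \<in> hermite_span I D"
proof -
  from assms obtain c where p: "p = (\<lambda>y. \<Sum>u\<in>exponents_upto I D. c u * mhermite I u y)"
    unfolding hermite_span_def by blast
  have "(\<lambda>z. mhermite I u (\<lambda>i. z i + a i)) \<in> hermite_span I D" if u: "u \<in> exponents_upto I D" for u
    unfolding mhermite_add[OF assms(1) u]
    using hermite_span_atMost[OF assms(1) u, of "\<lambda>\<alpha>. mbinom I u \<alpha> * mpow I a (\<lambda>i. u i - \<alpha> i)"]
    by (simp add: mult_ac)
  then show ?thesis unfolding p
    using assms(1) by (intro hermite_span_sum hermite_span_cmult finite_exponents_upto)
qed

section \<open>Orthogonality and integrability under the Gaussian measure\<close>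

lemma
  assumes "finite I"
  shows integrable_mhermite_mult: "integrable (std_gaussian I) (\<lambda>z. mhermite I \<alpha> z * mhermite I \<beta> z)"
    and integral_mhermite_mult: "(\<integral>z. mhermite I \<alpha> z * mhermite I \<beta> z \<partial>std_gaussian I) =
      (\<Prod>i\<in>I. gauss_poly (hermite (\<alpha> i) * hermite (\<beta> i)))"
proof -
  interpret product_sigma_finite "\<lambda>_::'a. std_normal"
    by (simp add: product_sigma_finite_def std_normal.sigma_finite_measure)
  have e: "mhermite I \<alpha> z * mhermite I \<beta> z = (\<Prod>i\<in>I. poly (hermite (\<alpha> i) * hermite (\<beta> i)) (z i))" for z
    by (simp add: mhermite_def prod.distrib)
  show "integrable (std_gaussian I) (\<lambda>z. mhermite I \<alpha> z * mhermite I \<beta> z)"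
    unfolding e std_gaussian_eq
    by (rule product_integrable_prod[OF assms]) (rule integrable_std_normal_poly)
  show "(\<integral>z. mhermite I \<alpha> z * mhermite I \<beta> z \<partial>std_gaussian I) =
      (\<Prod>i\<in>I. gauss_poly (hermite (\<alpha> i) * hermite (\<beta> i)))"
    unfolding e std_gaussian_eq gauss_poly_def
    by (rule product_integral_prod[OF assms]) (rule integrable_std_normal_poly)
qed

lemma mhermite_orthogonal:
  assumes "finite I" "\<alpha> \<in> exponents_upto I D" "\<beta> \<in> exponents_upto I D"
  shows "(\<integral>z. mhermite I \<alpha> z * mhermite I \<beta> z \<partial>std_gaussian I) = (if \<alpha> = \<beta> then mfact I \<alpha> else 0)"
proof (cases "\<alpha> = \<beta>")
  case True
  then show ?thesis
    using assms by (simp add: integral_mhermite_mult gauss_hermite_orthogonal mfact_def)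
next
  case False
  then obtain i where i: "\<alpha> i \<noteq> \<beta> i" by blast
  have "i \<in> I"
    using i exponents_upto_outside[OF assms(2), of i] exponents_upto_outside[OF assms(3), of i]
    by (cases "i \<in> I") simp_all
  then have "(\<Prod>i\<in>I. gauss_poly (hermite (\<alpha> i) * hermite (\<beta> i))) = 0"
    using i assms(1) by (intro prod_zero) (auto simp: gauss_hermite_orthogonal)
  then show ?thesis using False assms(1) by (simp add: integral_mhermite_mult)
qed

lemma integrable_hermite_span_mult:
  assumes "finite I" "p \<in> hermite_span I D" "q \<in> hermite_span I D"
  shows "integrable (std_gaussian I) (\<lambda>z. p z * q z)"
proof -
  from assms obtain c d where "p = (\<lambda>y. \<Sum>u\<in>exponents_upto I D. c u * mhermite I u y)"
    "q = (\<lambda>y. \<Sum>u\<in>exponents_upto I D. d u * mhermite I u y)"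
    unfolding hermite_span_def by blast
  then have "(\<lambda>z. p z * q z) = (\<lambda>z. \<Sum>u\<in>exponents_upto I D. \<Sum>v\<in>exponents_upto I D.
      (c u * d v) * (mhermite I u z * mhermite I v z))"
    by (simp add: sum_product mult_ac)
  then show ?thesis
    using assms(1) by (simp add: integrable_mhermite_mult Bochner_Integration.integrable_sum)
qed

lemma integrable_hermite_span:
  assumes "finite I" "p \<in> hermite_span I D"
  shows "integrable (std_gaussian I) p"
  using integrable_hermite_span_mult[OF assms(1) assms(2) hermite_span_const[OF assms(1), of 1]] by simp

text \<open>The shape of the dual certificate.\<close>

definition hermite_series :: "'i set \<Rightarrow> nat \<Rightarrow> (('i \<Rightarrow> nat) \<Rightarrow> real) \<Rightarrow> ('i \<Rightarrow> real) \<Rightarrow> real" where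
  "hermite_series I D K z = (\<Sum>\<alpha>\<in>exponents_upto I D. K \<alpha> / mfact I \<alpha> * mhermite I \<alpha> z)"

lemma hermite_series_in_span: "hermite_series I D K \<in> hermite_span I D"
  unfolding hermite_span_def
  by (intro CollectI exI[of _ "\<lambda>\<alpha>. K \<alpha> / mfact I \<alpha>"] ext hermite_series_def)

lemma integrable_hermite_series_mhermite:
  "finite I \<Longrightarrow> integrable (std_gaussian I) (\<lambda>z. hermite_series I D K z * mhermite I \<beta> z)"
  unfolding hermite_series_def sum_distrib_right mult.assoc
  by (intro Bochner_Integration.integrable_sum integrable_mult_right integrable_mhermite_mult)

text \<open>Dividing by \<open>mfact\<close> in the series cancels the squared norm of the basis
  element, so \<open>K\<close> is exactly the vector of pairings with the basis.\<close>

lemma integral_hermite_series_mhermite: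
  assumes "finite I" "\<beta> \<in> exponents_upto I D"
  shows "(\<integral>z. hermite_series I D K z * mhermite I \<beta> z \<partial>std_gaussian I) = K \<beta>"
proof -
  have "(\<integral>z. hermite_series I D K z * mhermite I \<beta> z \<partial>std_gaussian I) =
      (\<Sum>\<alpha>\<in>exponents_upto I D. K \<alpha> / mfact I \<alpha> *
        (\<integral>z. mhermite I \<alpha> z * mhermite I \<beta> z \<partial>std_gaussian I))"
    unfolding hermite_series_def sum_distrib_right mult.assoc
    using assms(1) by (subst Bochner_Integration.integral_sum) (auto simp: integrable_mhermite_mult)
  also have "\<dots> = (\<Sum>\<alpha>\<in>exponents_upto I D. if \<alpha> = \<beta> then K \<beta> else 0)"
    using assms mfact_pos[of I \<beta>] by (intro sum.cong refl) (auto simp: mhermite_orthogonal)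
  finally show ?thesis using assms by (simp add: finite_exponents_upto)
qed

lemma integral_hermite_series_square:
  assumes "finite I"
  shows "(\<integral>z. (hermite_series I D K z)\<^sup>2 \<partial>std_gaussian I) =
    (\<Sum>\<alpha>\<in>exponents_upto I D. (K \<alpha>)\<^sup>2 / mfact I \<alpha>)"
proof -
  have "(hermite_series I D K z)\<^sup>2 = (\<Sum>\<beta>\<in>exponents_upto I D. K \<beta> / mfact I \<beta> *
      (hermite_series I D K z * mhermite I \<beta> z))" for z
  proof -
    have "(hermite_series I D K z)\<^sup>2 =
        hermite_series I D K z * (\<Sum>\<beta>\<in>exponents_upto I D. K \<beta> / mfact I \<beta> * mhermite I \<beta> z)"
      by (simp only: power2_eq_square) (simp only: hermite_series_def)
    then show ?thesis by (simp only: sum_distrib_left mult_ac)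
  qed
  then have "(\<integral>z. (hermite_series I D K z)\<^sup>2 \<partial>std_gaussian I) =
      (\<Sum>\<beta>\<in>exponents_upto I D. K \<beta> / mfact I \<beta> *
        (\<integral>z. hermite_series I D K z * mhermite I \<beta> z \<partial>std_gaussian I))"
    using integrable_hermite_series_mhermite[OF assms]
    by (simp add: Bochner_Integration.integral_sum)
  then show ?thesis
    using assms by (simp add: integral_hermite_series_mhermite power2_eq_square)
qed

text \<open>Pairing with a shifted basis element is triangular in \<open>K\<close>. Averaging over
  the signal later turns the powers of the shift into moments, which yields the left side of the
  certificate system.\<close>

lemma integral_hermite_series_shift:
  assumes "finite I" "u \<in> exponents_upto I D"
  shows "(\<integral>z. hermite_series I D K z * mhermite I u (\<lambda>i. z i + a i) \<partial>std_gaussian I) =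
    (\<Sum>\<alpha>\<le>u. mbinom I u \<alpha> * K \<alpha> * mpow I a (\<lambda>i. u i - \<alpha> i))"
proof -
  have le: "\<alpha> \<in> exponents_upto I D" if "\<alpha> \<in> {..u}" for \<alpha>
    using that exponents_upto_downward[OF assms(2)] by simp
  have "hermite_series I D K z * mhermite I u (\<lambda>i. z i + a i) =
      (\<Sum>\<alpha>\<le>u. (mbinom I u \<alpha> * mpow I a (\<lambda>i. u i - \<alpha> i)) * (hermite_series I D K z * mhermite I \<alpha> z))" for z
    unfolding mhermite_add[OF assms] by (simp add: sum_distrib_left mult_ac)
  then have "(\<integral>z. hermite_series I D K z * mhermite I u (\<lambda>i. z i + a i) \<partial>std_gaussian I) =
      (\<Sum>\<alpha>\<le>u. (mbinom I u \<alpha> * mpow I a (\<lambda>i. u i - \<alpha> i)) *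
        (\<integral>z. hermite_series I D K z * mhermite I \<alpha> z \<partial>std_gaussian I))"
    using integrable_hermite_series_mhermite[OF assms(1)] by (simp add: Bochner_Integration.integral_sum)
  also have "\<dots> = (\<Sum>\<alpha>\<le>u. mbinom I u \<alpha> * K \<alpha> * mpow I a (\<lambda>i. u i - \<alpha> i))"
    using le assms(1) by (intro sum.cong refl) (simp add: integral_hermite_series_mhermite)
  finally show ?thesis .
qed

section \<open>The triangular system of the dual certificate\<close>

text \<open>The coefficient of \<open>K u\<close> is \<open>m\<close> at zero, that is 1, and all
  other terms involve strictly smaller multi-indices; the degrees are solved one after the
  other.\<close>

lemma triangular_system_solvable:
  fixes b m :: "('i \<Rightarrow> nat) \<Rightarrow> real"
  assumes "finite I" "m (\<lambda>_. 0) = 1"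
  shows "\<exists>K. \<forall>u\<in>exponents_upto I D. (\<Sum>\<alpha>\<le>u. mbinom I u \<alpha> * K \<alpha> * m (\<lambda>i. u i - \<alpha> i)) = b u"
proof (induction D)
  case 0
  have "u = (\<lambda>_. 0)" if "u \<in> exponents_upto I 0" for u
    using that assms(1) by (auto simp: exponents_upto_def fun_eq_iff)
  moreover have "{..(\<lambda>_. 0 :: nat)} = {\<lambda>_ :: 'i. 0}"
    by (auto simp: le_fun_def)
  ultimately show ?case
    using assms(2) by (intro exI[of _ b]) (auto simp: mbinom_def)
next
  case (Suc D)
  then obtain K where K: "\<And>u. u \<in> exponents_upto I D \<Longrightarrow>
      (\<Sum>\<alpha>\<le>u. mbinom I u \<alpha> * K \<alpha> * m (\<lambda>i. u i - \<alpha> i)) = b u" by blast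
  \<comment> \<open>Only the layer of total degree \<open>Suc D\<close> is redefined. Its right side
    refers to the old \<open>K\<close>, since an \<alpha> strictly below \<open>u\<close> has
    smaller degree.\<close>
  define K' where "K' u = (if sum u I = Suc D
      then b u - (\<Sum>\<alpha>\<in>{..u} - {u}. mbinom I u \<alpha> * K \<alpha> * m (\<lambda>i. u i - \<alpha> i)) else K u)" for u
  have "(\<Sum>\<alpha>\<le>u. mbinom I u \<alpha> * K' \<alpha> * m (\<lambda>i. u i - \<alpha> i)) = b u"
    if u: "u \<in> exponents_upto I (Suc D)" for u
  proof (cases "sum u I = Suc D")
    case False
    then have u': "u \<in> exponents_upto I D" using u by (auto simp: exponents_upto_def)
    have "K' \<alpha> = K \<alpha>" if "\<alpha> \<in> {..u}" for \<alpha>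
    proof -
      have "sum \<alpha> I \<le> D"
        using that exponents_upto_downward[OF u', of \<alpha>] by (simp add: exponents_upto_def)
      then show ?thesis by (simp add: K'_def)
    qed
    then show ?thesis using K[OF u'] by simp
  next
    case True
    have fin: "finite {..u}" by (rule finite_atMost_exponent[OF assms(1) u])
    have "K' \<alpha> = K \<alpha>" if "\<alpha> \<in> {..u} - {u}" for \<alpha>
    proof -
      from that have le: "\<alpha> i \<le> u i" for i by (auto simp: le_fun_def)
      from that obtain i where i: "\<alpha> i \<noteq> u i" by fastforce
      have "i \<in> I"
        using i le[of i] exponents_upto_outside[OF u, of i] by (cases "i \<in> I") simp_all
      then have "sum \<alpha> I < sum u I"
        using le i assms(1) by (intro sum_strict_mono_ex1 bexI[of _ i]) (auto simp: le_neq_implies_less)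
      then show ?thesis using True by (simp add: K'_def)
    qed
    then have "(\<Sum>\<alpha>\<in>{..u} - {u}. mbinom I u \<alpha> * K' \<alpha> * m (\<lambda>i. u i - \<alpha> i)) =
        (\<Sum>\<alpha>\<in>{..u} - {u}. mbinom I u \<alpha> * K \<alpha> * m (\<lambda>i. u i - \<alpha> i))" by simp
    moreover have "(\<Sum>\<alpha>\<le>u. mbinom I u \<alpha> * K' \<alpha> * m (\<lambda>i. u i - \<alpha> i)) =
        mbinom I u u * K' u * m (\<lambda>i. u i - u i) +
        (\<Sum>\<alpha>\<in>{..u} - {u}. mbinom I u \<alpha> * K' \<alpha> * m (\<lambda>i. u i - \<alpha> i))"
      using fin by (intro sum.remove) auto
    moreover have "mbinom I u u * K' u * m (\<lambda>i. u i - u i) = K' u"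
      using assms(2) by (simp add: mbinom_def)
    moreover have "K' u = b u - (\<Sum>\<alpha>\<in>{..u} - {u}. mbinom I u \<alpha> * K \<alpha> * m (\<lambda>i. u i - \<alpha> i))"
      using True by (simp add: K'_def)
    ultimately show ?thesis by linarith
  qed
  then show ?case by blast
qed

text \<open>Separates the weight into a factor in \<alpha> and a factor in u - \<alpha>, which turns
  the off-diagonal sum into a convolution.\<close>

lemma mbinom_div_mfact:
  assumes "\<alpha> \<le> u"
  shows "mbinom I u \<alpha> / mfact I u = 1 / (mfact I \<alpha> * mfact I (\<lambda>i. u i - \<alpha> i))"
proof -
  have "real (u i choose \<alpha> i) / fact (u i) = 1 / (fact (\<alpha> i) * fact (u i - \<alpha> i))" for i
    using assms by (simp add: binomial_fact le_fun_def)
  then have "(\<Prod>i\<in>I. real (u i choose \<alpha> i) / fact (u i)) = (\<Prod>i\<in>I. 1 / (fact (\<alpha> i) * fact (u i - \<alpha> i)))"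
    by simp
  then show ?thesis
    by (simp only: mbinom_def mfact_def prod_dividef prod.distrib prod.neutral_const)
qed

lemma sum_mbinom:
  assumes "finite I" "u \<in> exponents_upto I D"
  shows "(\<Sum>\<alpha>\<le>u. mbinom I u \<alpha> * t ^ (\<Sum>i\<in>I. u i - \<alpha> i)) = (1 + t) ^ sum u I"
proof -
  have "(1 + t) ^ sum u I = (\<Prod>i\<in>I. (1 + t) ^ u i)"
    by (rule power_sum)
  also have "\<dots> = (\<Prod>i\<in>I. \<Sum>j\<le>u i. real (u i choose j) * t ^ (u i - j))"
    by (simp add: binomial_ring)
  also have "\<dots> = (\<Sum>\<alpha>\<le>u. \<Prod>i\<in>I. real (u i choose \<alpha> i) * t ^ (u i - \<alpha> i))"
    by (rule prod_sum_atMost[OF assms(1)]) (rule exponents_upto_outside[OF assms(2)])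
  finally show ?thesis by (simp add: mbinom_def prod.distrib power_sum)
qed

text \<open>Cauchy--Schwarz with weights \<open>D ^ degree\<close>: since \<open>(1 + 1 / D) ^ D \<le> 3\<close>, the off-diagonal
  part of the triangular system is a contraction.\<close>

lemma triangular_system_norm:
  fixes b m K :: "('i \<Rightarrow> nat) \<Rightarrow> real"
  assumes I: "finite I" and m0: "m (\<lambda>_. 0) = 1" and D: "D \<ge> 1"
    and K: "\<And>u. u \<in> exponents_upto I D \<Longrightarrow>
      (\<Sum>\<alpha>\<le>u. mbinom I u \<alpha> * K \<alpha> * m (\<lambda>i. u i - \<alpha> i)) = b u"
    and small: "(\<Sum>\<gamma>\<in>exponents_upto I D - {\<lambda>_. 0}. real D ^ sum \<gamma> I * (m \<gamma>)\<^sup>2 / mfact I \<gamma>) \<le> 1 / 8"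
  shows "(\<Sum>u\<in>exponents_upto I D. (K u)\<^sup>2 / mfact I u) \<le> 4 * (\<Sum>u\<in>exponents_upto I D. (b u)\<^sup>2 / mfact I u)"
proof -
  let ?E = "exponents_upto I D"
  define R where "R u = (\<Sum>\<alpha>\<in>{..u} - {u}. mbinom I u \<alpha> * K \<alpha> * m (\<lambda>i. u i - \<alpha> i))" for u
  define F where "F \<alpha> = (K \<alpha>)\<^sup>2 / mfact I \<alpha>" for \<alpha>
  define G where "G \<gamma> = real D ^ sum \<gamma> I * (m \<gamma>)\<^sup>2 / mfact I \<gamma>" for \<gamma>
  have fE: "finite ?E" by (rule finite_exponents_upto[OF I])
  have F0: "F \<alpha> \<ge> 0" and G0: "G \<alpha> \<ge> 0" for \<alpha>
    using mfact_pos[of I \<alpha>] by (simp_all add: F_def G_def)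
  have KR: "K u = b u - R u" if u: "u \<in> ?E" for u
  proof -
    have "finite {..u}" by (rule finite_atMost_exponent[OF I u])
    then show ?thesis
      using K[OF u] m0 by (simp add: sum.remove[of _ u] R_def mbinom_def)
  qed
  have R: "(R u)\<^sup>2 / mfact I u \<le> 2 * (\<Sum>\<alpha>\<in>{..u} - {u}. F \<alpha> * G (\<lambda>i. u i - \<alpha> i))" if u: "u \<in> ?E" for u
  proof -
    have fin: "finite {..u}" by (rule finite_atMost_exponent[OF I u])
    let ?t = "1 / real D"
    define d where "d \<alpha> = (\<Sum>i\<in>I. u i - \<alpha> i)" for \<alpha>
    have "(\<Sum>\<alpha>\<le>u. mbinom I u \<alpha> * ?t ^ d \<alpha>) = (1 + ?t) ^ sum u I"
      unfolding d_def by (rule sum_mbinom[OF I u])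
    also have "\<dots> \<le> (1 + ?t) ^ D"
      using u by (intro power_increasing) (auto simp: exponents_upto_def)
    also have "\<dots> \<le> exp ?t ^ D"
      by (intro power_mono exp_ge_add_one_self) simp
    also have "\<dots> = exp 1" using D by (simp flip: exp_of_nat_mult)
    also have "\<dots> \<le> 3" by (rule exp_le)
    \<comment> \<open>Removing the diagonal term, which equals 1, lowers the bound 3 to 2.\<close>
    finally have w: "(\<Sum>\<alpha>\<in>{..u} - {u}. mbinom I u \<alpha> * ?t ^ d \<alpha>) \<le> 2"
      using fin by (simp add: sum.remove[of _ u] mbinom_def d_def)
    have pos: "mbinom I u \<alpha> \<ge> 0" for \<alpha> by (simp add: mbinom_def prod_nonneg)
    \<comment> \<open>The weights \<open>?t ^ d \<alpha>\<close> and
      \<open>real D ^ d \<alpha>\<close> multiply to 1. The first keeps the binomial sum bounded,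
      the second is charged to the moments \<open>m\<close>.\<close>
    have e: "mbinom I u \<alpha> * K \<alpha> * m (\<lambda>i. u i - \<alpha> i) =
        sqrt (mbinom I u \<alpha> * ?t ^ d \<alpha>) * (sqrt (mbinom I u \<alpha> * real D ^ d \<alpha>) * K \<alpha> * m (\<lambda>i. u i - \<alpha> i))" for \<alpha>
    proof -
      have "sqrt (mbinom I u \<alpha> * ?t ^ d \<alpha>) * sqrt (mbinom I u \<alpha> * real D ^ d \<alpha>) = 
          sqrt ((mbinom I u \<alpha>)\<^sup>2 * (?t ^ d \<alpha> * real D ^ d \<alpha>))"
        by (simp add: power2_eq_square mult_ac flip: real_sqrt_mult)
      also have "?t ^ d \<alpha> * real D ^ d \<alpha> = 1"
        using D by (simp flip: power_mult_distrib)
      finally show ?thesis using pos[of \<alpha>] by (simp add: mult.assoc [symmetric])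
    qed
    have "(R u)\<^sup>2 \<le> (\<Sum>\<alpha>\<in>{..u} - {u}. (sqrt (mbinom I u \<alpha> * ?t ^ d \<alpha>))\<^sup>2) *
        (\<Sum>\<alpha>\<in>{..u} - {u}. (sqrt (mbinom I u \<alpha> * real D ^ d \<alpha>) * K \<alpha> * m (\<lambda>i. u i - \<alpha> i))\<^sup>2)"
      unfolding R_def e by (rule Cauchy_Schwarz_ineq_sum)
    also have "\<dots> = (\<Sum>\<alpha>\<in>{..u} - {u}. mbinom I u \<alpha> * ?t ^ d \<alpha>) *
        (\<Sum>\<alpha>\<in>{..u} - {u}. mbinom I u \<alpha> * (real D ^ d \<alpha> * (K \<alpha>)\<^sup>2 * (m (\<lambda>i. u i - \<alpha> i))\<^sup>2))"
      using pos by (simp add: power_mult_distrib mult.assoc)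
    also have "\<dots> \<le> 2 * (\<Sum>\<alpha>\<in>{..u} - {u}. mbinom I u \<alpha> * (real D ^ d \<alpha> * (K \<alpha>)\<^sup>2 * (m (\<lambda>i. u i - \<alpha> i))\<^sup>2))"
      using w by (intro mult_right_mono sum_nonneg) (auto simp: pos)
    finally have "(R u)\<^sup>2 / mfact I u \<le>
        2 * (\<Sum>\<alpha>\<in>{..u} - {u}. mbinom I u \<alpha> * (real D ^ d \<alpha> * (K \<alpha>)\<^sup>2 * (m (\<lambda>i. u i - \<alpha> i))\<^sup>2)) / mfact I u"
      using mfact_pos[of I u] by (simp add: divide_right_mono)
    also have "\<dots> = 2 * (\<Sum>\<alpha>\<in>{..u} - {u}. mbinom I u \<alpha> / mfact I u * (real D ^ d \<alpha> * (K \<alpha>)\<^sup>2 * (m (\<lambda>i. u i - \<alpha> i))\<^sup>2))"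
      by (simp add: sum_divide_distrib [symmetric])
    also have "\<dots> = 2 * (\<Sum>\<alpha>\<in>{..u} - {u}. F \<alpha> * G (\<lambda>i. u i - \<alpha> i))"
      by (intro arg_cong[of _ _ "\<lambda>x. 2 * x"] sum.cong refl)
         (simp add: mbinom_div_mfact F_def G_def d_def)
    finally show ?thesis .
  qed
  \<comment> \<open>From \<alpha> and u - \<alpha> one recovers u, so the double sum is part of the
    full product of the sums of \<open>F\<close> and \<open>G\<close>.\<close>
  have inj: "inj_on (\<lambda>(u, \<alpha>). (\<alpha>, \<lambda>i. u i - \<alpha> i)) (SIGMA u:?E. {..u} - {u})"
  proof (rule inj_onI)
    fix p q assume p: "p \<in> (SIGMA u:?E. {..u} - {u})" and q: "q \<in> (SIGMA u:?E. {..u} - {u})"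
      and eq: "(\<lambda>(u, \<alpha>). (\<alpha>, \<lambda>i. u i - \<alpha> i)) p = (\<lambda>(u, \<alpha>). (\<alpha>, \<lambda>i. u i - \<alpha> i)) q"
    obtain u v \<alpha> where uv: "p = (u, \<alpha>)" "q = (v, \<alpha>)"
      using eq by (cases p; cases q) auto
    have "u i = v i" for i
    proof -
      from p q uv have "\<alpha> i \<le> u i" "\<alpha> i \<le> v i" by (auto simp: le_fun_def)
      moreover from eq uv have "u i - \<alpha> i = v i - \<alpha> i" by (auto dest: fun_cong[of _ _ i])
      ultimately show ?thesis by linarith
    qed
    then show "p = q" using uv by auto
  qed
  have "(\<Sum>u\<in>?E. (R u)\<^sup>2 / mfact I u) \<le> (\<Sum>u\<in>?E. 2 * (\<Sum>\<alpha>\<in>{..u} - {u}. F \<alpha> * G (\<lambda>i. u i - \<alpha> i)))"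
    by (intro sum_mono R)
  also have "\<dots> = 2 * (\<Sum>(u, \<alpha>)\<in>(SIGMA u:?E. {..u} - {u}). F \<alpha> * G (\<lambda>i. u i - \<alpha> i))"
    unfolding sum_distrib_left [symmetric]
    using fE finite_atMost_exponent[OF I] by (subst sum.Sigma) auto
  also have "(\<Sum>(u, \<alpha>)\<in>(SIGMA u:?E. {..u} - {u}). F \<alpha> * G (\<lambda>i. u i - \<alpha> i)) =
      (\<Sum>(\<alpha>, \<gamma>)\<in>(\<lambda>(u, \<alpha>). (\<alpha>, \<lambda>i. u i - \<alpha> i)) ` (SIGMA u:?E. {..u} - {u}). F \<alpha> * G \<gamma>)"
    by (simp add: sum.reindex[OF inj[unfolded case_prod_unfold]] case_prod_unfold)
  also have "\<dots> \<le> (\<Sum>(\<alpha>, \<gamma>)\<in>?E \<times> (?E - {\<lambda>_. 0}). F \<alpha> * G \<gamma>)"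
  proof (rule sum_mono2)
    show "(\<lambda>(u, \<alpha>). (\<alpha>, \<lambda>i. u i - \<alpha> i)) ` (SIGMA u:?E. {..u} - {u}) \<subseteq> ?E \<times> (?E - {\<lambda>_. 0})"
    proof
      fix p assume "p \<in> (\<lambda>(u, \<alpha>). (\<alpha>, \<lambda>i. u i - \<alpha> i)) ` (SIGMA u:?E. {..u} - {u})"
      then obtain u \<alpha> where p: "p = (\<alpha>, \<lambda>i. u i - \<alpha> i)" and *: "u \<in> ?E" "\<alpha> \<le> u" "\<alpha> \<noteq> u"
        by auto
      have "(\<lambda>i. u i - \<alpha> i) \<noteq> (\<lambda>_. 0)"
        using *(2,3) by (auto simp: fun_eq_iff le_fun_def) (metis le_antisym)
      then show "p \<in> ?E \<times> (?E - {\<lambda>_. 0})"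
        using exponents_upto_downward[OF *(1,2)] exponents_upto_diff[OF *(1), of \<alpha>] by (simp add: p)
    qed
  qed (use fE F0 G0 in auto)
  also have "\<dots> = (\<Sum>\<alpha>\<in>?E. F \<alpha>) * (\<Sum>\<gamma>\<in>?E - {\<lambda>_. 0}. G \<gamma>)"
    by (simp add: sum_product sum.cartesian_product)
  also have "\<dots> \<le> (\<Sum>\<alpha>\<in>?E. F \<alpha>) * (1 / 8)"
    using small by (intro mult_left_mono sum_nonneg F0) (simp add: G_def)
  finally have RF: "(\<Sum>u\<in>?E. (R u)\<^sup>2 / mfact I u) \<le> (\<Sum>\<alpha>\<in>?E. F \<alpha>) / 4" by simp
  \<comment> \<open>The off-diagonal part has norm at most 2 * 1/8 = 1/4 of the sum of
    \<open>F\<close>. After (b - R)^2 \<le> 2 b^2 + 2 R^2, half of that sum moves to the left,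
    whence the factor 4.\<close>
  have "(\<Sum>u\<in>?E. F u) \<le> (\<Sum>u\<in>?E. 2 * ((b u)\<^sup>2 / mfact I u) + 2 * ((R u)\<^sup>2 / mfact I u))"
  proof (rule sum_mono)
    fix u assume u: "u \<in> ?E"
    have "(b u - R u)\<^sup>2 \<le> 2 * (b u)\<^sup>2 + 2 * (R u)\<^sup>2"
      using zero_le_power2[of "b u + R u"] by (simp add: power2_eq_square algebra_simps)
    then show "F u \<le> 2 * ((b u)\<^sup>2 / mfact I u) + 2 * ((R u)\<^sup>2 / mfact I u)"
      using mfact_pos[of I u] by (simp add: F_def KR[OF u] field_simps)
  qed
  also have "\<dots> = 2 * (\<Sum>u\<in>?E. (b u)\<^sup>2 / mfact I u) + 2 * (\<Sum>u\<in>?E. (R u)\<^sup>2 / mfact I u)"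
    by (simp add: sum.distrib sum_distrib_left)
  finally have "(\<Sum>u\<in>?E. F u) \<le> 4 * (\<Sum>u\<in>?E. (b u)\<^sup>2 / mfact I u)" using RF by simp
  then show ?thesis by (simp add: F_def)
qed

text \<open>Peeling off the exponent of one coordinate reduces the multinomial theorem to the
  binomial one. Finiteness is carried along because the same bijection delivers both parts of the
  induction step.\<close>

lemma multinomial_exponents:
  fixes x :: "'i \<Rightarrow> real"
  assumes "finite I"
  shows "finite {a. (\<forall>i. i \<notin> I \<longrightarrow> a i = 0) \<and> sum a I = d} \<and>
    (\<Sum>a | (\<forall>i. i \<notin> I \<longrightarrow> a i = 0) \<and> sum a I = d. mpow I x a / mfact I a) = (\<Sum>i\<in>I. x i) ^ d / fact d"
  using assms
proof (induction I arbitrary: d rule: finite_induct)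
  case empty
  have "{a :: 'i \<Rightarrow> nat. (\<forall>i. i \<notin> {} \<longrightarrow> a i = 0) \<and> sum a {} = d} = (if d = 0 then {\<lambda>_. 0} else {})"
    by auto
  then show ?case by (simp add: mpow_def mfact_def power_0_left)
next
  case (insert j I)
  define S where "S d = {a :: 'i \<Rightarrow> nat. (\<forall>i. i \<notin> I \<longrightarrow> a i = 0) \<and> sum a I = d}" for d
  let ?S = "{a :: 'i \<Rightarrow> nat. (\<forall>i. i \<notin> insert j I \<longrightarrow> a i = 0) \<and> sum a (insert j I) = d}"
  have fin: "finite (S d)" and IH: "(\<Sum>a\<in>S d. mpow I x a / mfact I a) = (\<Sum>i\<in>I. x i) ^ d / fact d" for d
    using insert.IH[of d] by (simp_all add: S_def)
  have bij: "bij_betw (\<lambda>(e, a). a(j := e)) (SIGMA e:{..d}. S (d - e)) ?S"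
  proof (rule bij_betw_byWitness[where f' = "\<lambda>a. (a j, a(j := 0))"])
    have s: "sum (a(j := e)) I = sum a I" for a :: "'i \<Rightarrow> nat" and e
      using insert.hyps by (intro sum.cong) auto
    show "\<forall>a\<in>(SIGMA e:{..d}. S (d - e)).
       ((case a of (e, a) \<Rightarrow> a(j := e)) j, (case a of (e, a) \<Rightarrow> a(j := e))(j := 0)) = a"
      using insert.hyps by (auto simp: S_def fun_eq_iff)
    show "\<forall>a\<in>?S. (case (a j, a(j := 0)) of (e, a) \<Rightarrow> a(j := e)) = a" by simp
    show "(\<lambda>(e, a). a(j := e)) ` (SIGMA e:{..d}. S (d - e)) \<subseteq> ?S"
      using insert.hyps s by (auto simp: S_def)
    show "(\<lambda>a. (a j, a(j := 0))) ` ?S \<subseteq> (SIGMA e:{..d}. S (d - e))"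
      using insert.hyps s by (auto simp: S_def)
  qed
  have "finite ?S"
    using bij_betw_finite[OF bij] fin by (simp add: finite_SigmaI)
  moreover have "(\<Sum>a\<in>?S. mpow (insert j I) x a / mfact (insert j I) a) = (\<Sum>i\<in>insert j I. x i) ^ d / fact d"
  proof -
    have "(\<Sum>a\<in>?S. mpow (insert j I) x a / mfact (insert j I) a) =
        (\<Sum>(e, a)\<in>(SIGMA e:{..d}. S (d - e)). mpow (insert j I) x (a(j := e)) / mfact (insert j I) (a(j := e)))"
      by (subst sum.reindex_bij_betw[OF bij, symmetric]) (simp add: case_prod_unfold)
    also have "\<dots> = (\<Sum>(e, a)\<in>(SIGMA e:{..d}. S (d - e)). x j ^ e / fact e * (mpow I x a / mfact I a))"
    proof -
      have "(\<Prod>i\<in>I. x i ^ (a(j := e)) i) = (\<Prod>i\<in>I. x i ^ a i)" 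
        "(\<Prod>i\<in>I. fact ((a(j := e)) i) :: real) = (\<Prod>i\<in>I. fact (a i))" for a :: "'i \<Rightarrow> nat" and e
        using insert.hyps by (auto intro!: prod.cong)
      then show ?thesis
        using insert.hyps by (simp add: mpow_def mfact_def)
    qed
    also have "\<dots> = (\<Sum>e\<le>d. \<Sum>a\<in>S (d - e). x j ^ e / fact e * (mpow I x a / mfact I a))"
      using fin by (subst sum.Sigma) auto
    also have "\<dots> = (\<Sum>e\<le>d. x j ^ e / fact e * ((\<Sum>i\<in>I. x i) ^ (d - e) / fact (d - e)))"
      by (simp only: sum_distrib_left [symmetric] IH)
    also have "\<dots> = (\<Sum>e\<le>d. real (d choose e) * x j ^ e * (\<Sum>i\<in>I. x i) ^ (d - e) / fact d)"
      by (intro sum.cong refl) (simp add: binomial_fact)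
    also have "\<dots> = (x j + (\<Sum>i\<in>I. x i)) ^ d / fact d"
      by (simp add: binomial_ring sum_divide_distrib)
    finally show ?thesis using insert.hyps by simp
  qed
  ultimately show ?case by blast
qed

text \<open>Weights that depend only on the total degree let the sum collapse to one over degrees;
  this is where coordinatewise moments become powers of the overlap.\<close>

lemma sum_exponents_upto:
  fixes x :: "'i \<Rightarrow> real"
  assumes "finite I"
  shows "(\<Sum>a\<in>exponents_upto I D. c (sum a I) * (mpow I x a / mfact I a)) =
    (\<Sum>d\<le>D. c d * ((\<Sum>i\<in>I. x i) ^ d / fact d))"
proof -
  define S where "S d = {a :: 'i \<Rightarrow> nat. (\<forall>i. i \<notin> I \<longrightarrow> a i = 0) \<and> sum a I = d}" for d
  have "exponents_upto I D = (\<Union>d\<in>{..D}. S d)"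
    by (auto simp: exponents_upto_def S_def)
  then have "(\<Sum>a\<in>exponents_upto I D. c (sum a I) * (mpow I x a / mfact I a)) =
      (\<Sum>d\<le>D. \<Sum>a\<in>S d. c (sum a I) * (mpow I x a / mfact I a))"
    using multinomial_exponents[OF assms]
    by (simp only:) (rule sum.UNION_disjoint, auto simp: S_def)
  also have "\<dots> = (\<Sum>d\<le>D. c d * (\<Sum>a\<in>S d. mpow I x a / mfact I a))"
    by (simp add: S_def sum_distrib_left)
  finally show ?thesis
    using multinomial_exponents[OF assms] by (simp add: S_def)
qed

section \<open>A lower bound on the low-degree MMSE\<close>

lemma prob_space_std_gaussian: "prob_space (std_gaussian I)"
  unfolding std_gaussian_eq by (rule prob_space_PiM) (rule prob_space_std_normal)

text \<open>The first factor takes finitely many values, so joint integrability follows from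
  integrability of each slice, and Fubini applies.\<close>

lemma integral_finite_pmf_pair:
  fixes g :: "'a \<times> 'b \<Rightarrow> real"
  assumes P: "finite (set_pmf P)" and N: "prob_space N"
    and meas: "g \<in> borel_measurable (measure_pmf P \<Otimes>\<^sub>M N)"
    and int: "\<And>x. x \<in> set_pmf P \<Longrightarrow> integrable N (\<lambda>z. g (x, z))"
  shows "integral\<^sup>L (measure_pmf P \<Otimes>\<^sub>M N) g = measure_pmf.expectation P (\<lambda>x. \<integral>z. g (x, z) \<partial>N)"
proof -
  interpret N: prob_space N by (rule N)
  interpret pair_sigma_finite "measure_pmf P" N
    by (simp add: pair_sigma_finite_def N.sigma_finite_measure_axioms
        measure_pmf.sigma_finite_measure_axioms)
  have "integrable (measure_pmf P \<Otimes>\<^sub>M N) g"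
    using meas by (rule Fubini_integrable)
      (auto simp: integrable_measure_pmf_finite[OF P] AE_measure_pmf_iff int)
  then show ?thesis by (simp add: integral_fst')
qed

lemma polys_upto_const: "finite I \<Longrightarrow> (\<lambda>_. c) \<in> polys_upto I D"
proof -
  assume I: "finite I"
  have "(\<Sum>a\<in>exponents_upto I D. (if a = (\<lambda>_. 0) then c else 0) * (\<Prod>i\<in>I. y i ^ a i)) =
      (\<Sum>a\<in>exponents_upto I D. if a = (\<lambda>_. 0) then c else 0)" for y
    by (intro sum.cong) auto
  also have "\<dots> = c"
    using finite_exponents_upto[OF I] by (simp add: zero_exponent)
  finally show ?thesis unfolding polys_upto_def
    by (intro CollectI exI[of _ "\<lambda>a. if a = (\<lambda>_. 0) then c else 0"]) (simp add: fun_eq_iff)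
qed

lemma loss_measurable:
  assumes I: "finite I" and f: "\<forall>j\<in>I. f j \<in> polys_upto I D"
  shows "(\<lambda>(x, z). \<Sum>j\<in>I. (f j (\<lambda>i. sqrt lam * x i + z i) - x j)\<^sup>2)
    \<in> borel_measurable (measure_pmf P \<Otimes>\<^sub>M std_gaussian I)"
proof -
  let ?M = "measure_pmf P \<Otimes>\<^sub>M std_gaussian I"
  have x: "(\<lambda>w. fst w i) \<in> borel_measurable ?M" for i
    by (rule measurable_compose[OF measurable_fst]) simp
  have z: "(\<lambda>w. snd w i) \<in> borel_measurable ?M" if "i \<in> I" for i
  proof -
    have "(\<lambda>z. z i) \<in> std_gaussian I \<rightarrow>\<^sub>M std_normal"
      using that unfolding std_gaussian_eq by (rule measurable_component_singleton)
    then have "(\<lambda>z. z i) \<in> borel_measurable (std_gaussian I)"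
      by (simp cong: measurable_cong_sets)
    then show ?thesis by (rule measurable_compose[OF measurable_snd])
  qed
  have f': "(\<lambda>w. f j (\<lambda>i. sqrt lam * fst w i + snd w i)) \<in> borel_measurable ?M" if j: "j \<in> I" for j
  proof -
    obtain c where "f j = (\<lambda>y. \<Sum>a\<in>exponents_upto I D. c a * (\<Prod>i\<in>I. y i ^ a i))"
      using f j unfolding polys_upto_def by blast
    then show ?thesis
      using x z by (simp add: borel_measurable_sum borel_measurable_prod
          borel_measurable_times borel_measurable_power borel_measurable_add)
  qed
  show ?thesis
    unfolding case_prod_unfold using f' x
    by (intro borel_measurable_sum borel_measurable_power borel_measurable_diff) auto
qed

context
  fixes I :: "'i set" and P :: "('i \<Rightarrow> real) pmf" and D :: nat and lam :: real
  assumes I: "finite I" and P: "finite (set_pmf P)"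
begin

lemma integrable_finite_support: "integrable (measure_pmf P) (f :: _ \<Rightarrow> real)"
  by (rule integrable_measure_pmf_finite[OF P])

lemma shifted_in_span:
  assumes "p \<in> polys_upto I D"
  shows "(\<lambda>z. p (\<lambda>i. sqrt lam * x i + z i)) \<in> hermite_span I D"
  using hermite_span_shift[OF I polys_upto_subset_hermite_span[OF I assms], of "\<lambda>i. sqrt lam * x i"]
  by (simp add: add.commute)

lemma
  assumes f: "\<forall>j\<in>I. f j \<in> polys_upto I D"
  shows loss_integral: "(\<integral>(x, z). (\<Sum>j\<in>I. (f j (\<lambda>i. sqrt lam * x i + z i) - x j)\<^sup>2) \<partial>(measure_pmf P \<Otimes>\<^sub>M std_gaussian I)) =
    measure_pmf.expectation P (\<lambda>x. \<Sum>j\<in>I. \<integral>z. (f j (\<lambda>i. sqrt lam * x i + z i) - x j)\<^sup>2 \<partial>std_gaussian I)"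
    (is "?l = ?r")
    and loss_integrable: "j \<in> I \<Longrightarrow>
      integrable (std_gaussian I) (\<lambda>z. (f j (\<lambda>i. sqrt lam * x i + z i) - x j)\<^sup>2)"
proof -
  have int: "integrable (std_gaussian I) (\<lambda>z. (f j (\<lambda>i. sqrt lam * x i + z i) - x j)\<^sup>2)"
    if j: "j \<in> I" for x j
  proof -
    have "(\<lambda>z. f j (\<lambda>i. sqrt lam * x i + z i) + - x j) \<in> hermite_span I D"
      using f j by (intro hermite_span_add shifted_in_span hermite_span_const I) auto
    from integrable_hermite_span_mult[OF I this this] show ?thesis
      by (simp add: power2_eq_square)
  qed
  then show "j \<in> I \<Longrightarrow>
      integrable (std_gaussian I) (\<lambda>z. (f j (\<lambda>i. sqrt lam * x i + z i) - x j)\<^sup>2)" .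
  have "?l = measure_pmf.expectation P (\<lambda>x. \<integral>z. (\<Sum>j\<in>I. (f j (\<lambda>i. sqrt lam * x i + z i) - x j)\<^sup>2) \<partial>std_gaussian I)"
    by (subst integral_finite_pmf_pair[OF P prob_space_std_gaussian loss_measurable[OF I f]])
       (auto intro!: Bochner_Integration.integrable_sum int)
  also have "\<dots> = ?r"
    by (simp add: Bochner_Integration.integral_sum int)
  finally show "?l = ?r" .
qed

text \<open>The constants E X_j are admissible polynomials of degree 0, and their total loss is the
  sum of the variances.\<close>

lemma lowdeg_MMSE_le_trivial: "lowdeg_MMSE I P D lam \<le> trivial_MMSE I P"
proof -
  let ?c = "\<lambda>j. measure_pmf.expectation P (\<lambda>x. x j)"
  interpret G: prob_space "std_gaussian I" by (rule prob_space_std_gaussian)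
  have f: "\<forall>j\<in>I. (\<lambda>_. ?c j) \<in> polys_upto I D" using polys_upto_const[OF I] by blast
  have "lowdeg_MMSE I P D lam \<le>
      (\<integral>(x, z). (\<Sum>j\<in>I. (?c j - x j)\<^sup>2) \<partial>(measure_pmf P \<Otimes>\<^sub>M std_gaussian I))"
    unfolding lowdeg_MMSE_def
  proof (rule cINF_lower2[where x = "\<lambda>j _. ?c j"])
    show "bdd_below ((\<lambda>f. \<integral>(x, z). (\<Sum>j\<in>I. (f j (\<lambda>i. sqrt lam * x i + z i) - x j)\<^sup>2)
        \<partial>(measure_pmf P \<Otimes>\<^sub>M std_gaussian I)) ` {f. \<forall>j\<in>I. f j \<in> polys_upto I D})"
      \<comment> \<open>The infimum is taken in the reals, so comparing it with one member of the
        family requires the lower bound 0.\<close>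
      by (intro bdd_belowI2[where m = 0]) (auto intro!: integral_nonneg_AE sum_nonneg)
  qed (use f in auto)
  also have "\<dots> = measure_pmf.expectation P (\<lambda>x. \<Sum>j\<in>I. (?c j - x j)\<^sup>2)"
    using loss_integral[OF f] G.prob_space by simp
  also have "\<dots> = measure_pmf.expectation P (\<lambda>x. \<Sum>j\<in>I. (x j)\<^sup>2 - 2 * ?c j * x j + (?c j)\<^sup>2)"
    by (simp add: power2_diff algebra_simps)
  also have "\<dots> = (\<Sum>j\<in>I. measure_pmf.expectation P (\<lambda>x. (x j)\<^sup>2) - 2 * ?c j * ?c j + (?c j)\<^sup>2)"
    using integrable_finite_support by (simp add: Bochner_Integration.integral_sum)
  also have "\<dots> = trivial_MMSE I P"
    using integrable_finite_support
    by (simp add: trivial_MMSE_def second_moment_def Bochner_Integration.integral_sum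
        sum_subtractf sum.distrib power2_eq_square)
  finally show ?thesis .
qed

text \<open>The condition \<open>cert\<close> speaks of the Hermite basis only; by linearity it
  extends to every estimator of degree at most \<open>D\<close>.\<close>

lemma lowdeg_MMSE_ge_certificate:
  assumes w: "\<And>j. j \<in> I \<Longrightarrow> w j \<in> hermite_span I D"
    and cert: "\<And>j u. j \<in> I \<Longrightarrow> u \<in> exponents_upto I D \<Longrightarrow>
      measure_pmf.expectation P (\<lambda>x. \<integral>z. w j z * mhermite I u (\<lambda>i. z i + sqrt lam * x i) \<partial>std_gaussian I) =
      measure_pmf.expectation P (\<lambda>x. x j * (\<integral>z. mhermite I u (\<lambda>i. z i + sqrt lam * x i) \<partial>std_gaussian I))"
  shows "second_moment I P - (\<Sum>j\<in>I. \<integral>z. (w j z)\<^sup>2 \<partial>std_gaussian I) \<le> lowdeg_MMSE I P D lam"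
  unfolding lowdeg_MMSE_def
proof (rule cINF_greatest)
  show "{f. \<forall>j\<in>I. f j \<in> polys_upto I D} \<noteq> {}"
    using polys_upto_const[OF I, of 0 D] by auto
next
  fix f assume "f \<in> {f. \<forall>j\<in>I. f j \<in> polys_upto I D}"
  then have f: "\<forall>j\<in>I. f j \<in> polys_upto I D" by simp
  let ?E = "measure_pmf.expectation P" and ?G = "std_gaussian I"
  interpret G: prob_space ?G by (rule prob_space_std_gaussian)
  let ?Y = "\<lambda>x z i. sqrt lam * x i + z i"
  have eq: "?E (\<lambda>x. \<integral>z. w j z * f j (?Y x z) \<partial>?G) = ?E (\<lambda>x. x j * (\<integral>z. f j (?Y x z) \<partial>?G))"
    if j: "j \<in> I" for j
  proof -
    let ?U = "exponents_upto I D"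
    obtain c where c: "f j = (\<lambda>y. \<Sum>u\<in>?U. c u * mhermite I u y)"
      using polys_upto_subset_hermite_span[OF I] f j unfolding hermite_span_def by blast
    have sp: "(\<lambda>z. mhermite I u (\<lambda>i. z i + sqrt lam * x i)) \<in> hermite_span I D" if u: "u \<in> ?U" for u x
      by (rule hermite_span_shift[OF I])
         (use hermite_span_atMost[OF I u, of "\<lambda>\<alpha>. if \<alpha> = u then 1 else 0"]
              finite_atMost_exponent[OF I u] in \<open>simp add: if_distrib[of "\<lambda>c. c * _"] cong: if_cong\<close>)
    have i1: "integrable ?G (\<lambda>z. w j z * mhermite I u (\<lambda>i. z i + sqrt lam * x i))"
      and i2: "integrable ?G (\<lambda>z. mhermite I u (\<lambda>i. z i + sqrt lam * x i))" if u: "u \<in> ?U" for u x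
      using integrable_hermite_span_mult[OF I w[OF j] sp[OF u]] integrable_hermite_span[OF I sp[OF u]]
      by auto
    have fY: "f j (?Y x z) = (\<Sum>u\<in>?U. c u * mhermite I u (\<lambda>i. z i + sqrt lam * x i))" for x z
      by (simp only: c add.commute)
    have "(\<integral>z. w j z * f j (?Y x z) \<partial>?G) =
        (\<Sum>u\<in>?U. c u * (\<integral>z. w j z * mhermite I u (\<lambda>i. z i + sqrt lam * x i) \<partial>?G))" for x
    proof -
      have "(\<lambda>z. w j z * f j (?Y x z)) =
          (\<lambda>z. \<Sum>u\<in>?U. c u * (w j z * mhermite I u (\<lambda>i. z i + sqrt lam * x i)))"
        by (simp only: fY sum_distrib_left mult.left_commute)
      then show ?thesis using i1 by (simp add: Bochner_Integration.integral_sum)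
    qed
    moreover have "x j * (\<integral>z. f j (?Y x z) \<partial>?G) =
        (\<Sum>u\<in>?U. c u * (x j * (\<integral>z. mhermite I u (\<lambda>i. z i + sqrt lam * x i) \<partial>?G)))" for x
      using i2 by (simp add: fY Bochner_Integration.integral_sum sum_distrib_left mult.left_commute)
    ultimately show ?thesis
      using integrable_finite_support by (simp add: Bochner_Integration.integral_sum cert[OF j])
  qed
  \<comment> \<open>An inequality for each fixed signal. The two middle terms need not cancel
    pointwise, but by \<open>eq\<close> they do so in expectation, leaving E X_j^2 - E w^2.\<close>
  have le: "(x j)\<^sup>2 - 2 * (x j * (\<integral>z. f j (?Y x z) \<partial>?G)) + 2 * (\<integral>z. w j z * f j (?Y x z) \<partial>?G)
      - (\<integral>z. (w j z)\<^sup>2 \<partial>?G) \<le> (\<integral>z. (f j (?Y x z) - x j)\<^sup>2 \<partial>?G)" if j: "j \<in> I" for x j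
  proof -
    have sp: "(\<lambda>z. f j (?Y x z)) \<in> hermite_span I D" using f j shifted_in_span by blast
    note int = integrable_hermite_span[OF I sp] integrable_hermite_span_mult[OF I w[OF j] sp]
      integrable_hermite_span_mult[OF I w[OF j] w[OF j]] loss_integrable[OF f j]
    have "(\<integral>z. (x j)\<^sup>2 - 2 * (x j * f j (?Y x z)) + 2 * (w j z * f j (?Y x z)) - w j z * w j z \<partial>?G)
        \<le> (\<integral>z. (f j (?Y x z) - x j)\<^sup>2 \<partial>?G)"
    proof (rule integral_mono)
      fix z
      have "0 \<le> (f j (?Y x z) - w j z)\<^sup>2" by simp
      then show "(x j)\<^sup>2 - 2 * (x j * f j (?Y x z)) + 2 * (w j z * f j (?Y x z)) - w j z * w j z
          \<le> (f j (?Y x z) - x j)\<^sup>2"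
        by (simp add: power2_eq_square algebra_simps)
    qed (use int in auto)
    then show ?thesis using int G.prob_space by (simp add: power2_eq_square)
  qed
  have "second_moment I P - (\<Sum>j\<in>I. \<integral>z. (w j z)\<^sup>2 \<partial>?G) =
      ?E (\<lambda>x. \<Sum>j\<in>I. (x j)\<^sup>2 - 2 * (x j * (\<integral>z. f j (?Y x z) \<partial>?G)) + 2 * (\<integral>z. w j z * f j (?Y x z) \<partial>?G)
        - (\<integral>z. (w j z)\<^sup>2 \<partial>?G))"
    using integrable_finite_support
    by (simp add: second_moment_def Bochner_Integration.integral_sum eq sum_subtractf sum.distrib)
  also have "\<dots> \<le> ?E (\<lambda>x. \<Sum>j\<in>I. \<integral>z. (f j (?Y x z) - x j)\<^sup>2 \<partial>?G)"
    using integrable_finite_support by (intro integral_mono sum_mono le) auto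
  also have "\<dots> = (\<integral>(x, z). (\<Sum>j\<in>I. (f j (\<lambda>i. sqrt lam * x i + z i) - x j)\<^sup>2) \<partial>(measure_pmf P \<Otimes>\<^sub>M ?G))"
    by (rule loss_integral[OF f, symmetric])
  finally show "second_moment I P - (\<Sum>j\<in>I. \<integral>z. (w j z)\<^sup>2 \<partial>?G) \<le>
      (\<integral>(x, z). (\<Sum>j\<in>I. (f j (\<lambda>i. sqrt lam * x i + z i) - x j)\<^sup>2) \<partial>(measure_pmf P \<Otimes>\<^sub>M ?G))" .
qed

lemma expectation_pair_mult:
  fixes f g :: "('i \<Rightarrow> real) \<Rightarrow> real"
  shows "measure_pmf.expectation (pair_pmf P P) (\<lambda>(x, x'). f x * g x') =
    measure_pmf.expectation P f * measure_pmf.expectation P g"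
proof -
  have "measure_pmf.expectation (pair_pmf P P) (\<lambda>(x, x'). f x * g x') =
      (\<Sum>w\<in>set_pmf P \<times> set_pmf P. (case w of (x, x') \<Rightarrow> f x * g x') * pmf (pair_pmf P P) w)"
    using P by (intro integral_measure_pmf_real) auto
  also have "\<dots> = (\<Sum>x\<in>set_pmf P. f x * pmf P x) * (\<Sum>x\<in>set_pmf P. g x * pmf P x)"
    by (simp add: sum_product sum.cartesian_product) (auto simp: pmf_pair intro!: sum.cong)
  finally show ?thesis
    using P by (simp add: integral_measure_pmf_real[where A = "set_pmf P"])
qed

lemma integrable_finite_support_pair: "integrable (measure_pmf (pair_pmf P P)) (f :: _ \<Rightarrow> real)"
  using P by (intro integrable_measure_pmf_finite) simp

lemma expectation_pair_lincomb:
  "(\<Sum>u\<in>U. a u * measure_pmf.expectation (pair_pmf P P) (f u) / b u) =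
    measure_pmf.expectation (pair_pmf P P) (\<lambda>w. \<Sum>u\<in>U. a u * f u w / (b u :: real))"
  by (simp add: Bochner_Integration.integral_sum integrable_finite_support_pair)

text \<open>The square of an expectation is an expectation over two independent copies; the products
  of their coordinates then combine, by the multinomial theorem, into powers of the overlap.\<close>

lemma sum_squared_moments:
  assumes lam: "lam \<ge> 0"
  shows "(\<Sum>u\<in>exponents_upto I D. c (sum u I) *
      (measure_pmf.expectation P (\<lambda>x. y x * mpow I (\<lambda>i. sqrt lam * x i) u))\<^sup>2 / mfact I u) =
    measure_pmf.expectation (pair_pmf P P) (\<lambda>(x, x').
      y x * y x' * (\<Sum>d\<le>D. c d * (lam * overlap I x x') ^ d / fact d))"
proof -
  let ?E2 = "measure_pmf.expectation (pair_pmf P P)"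
  have "(measure_pmf.expectation P (\<lambda>x. y x * mpow I (\<lambda>i. sqrt lam * x i) u))\<^sup>2 =
      ?E2 (\<lambda>(x, x'). y x * y x' * mpow I (\<lambda>i. lam * (x i * x' i)) u)" for u
  proof -
    have "mpow I (\<lambda>i. sqrt lam * x i) u * mpow I (\<lambda>i. sqrt lam * x' i) u = mpow I (\<lambda>i. lam * (x i * x' i)) u"
      for x x' :: "'i \<Rightarrow> real"
    proof -
      have "sqrt lam * x i * (sqrt lam * x' i) = lam * (x i * x' i)" for i
      proof -
        have "sqrt lam * x i * (sqrt lam * x' i) = (sqrt lam * sqrt lam) * (x i * x' i)"
          by (simp only: mult_ac)
        then show ?thesis using lam by simp
      qed
      then show ?thesis by (simp only: mpow_def prod.distrib [symmetric] power_mult_distrib [symmetric])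
    qed
    then have e: "(y x * mpow I (\<lambda>i. sqrt lam * x i) u) * (y x' * mpow I (\<lambda>i. sqrt lam * x' i) u) =
        y x * y x' * mpow I (\<lambda>i. lam * (x i * x' i)) u" for x x'
      by (metis mult.assoc mult.left_commute)
    show ?thesis
      unfolding power2_eq_square expectation_pair_mult [symmetric] by (simp only: e)
  qed
  then have "(\<Sum>u\<in>exponents_upto I D. c (sum u I) *
      (measure_pmf.expectation P (\<lambda>x. y x * mpow I (\<lambda>i. sqrt lam * x i) u))\<^sup>2 / mfact I u) =
    ?E2 (\<lambda>w. \<Sum>u\<in>exponents_upto I D. c (sum u I) *
      (case w of (x, x') \<Rightarrow> y x * y x' * mpow I (\<lambda>i. lam * (x i * x' i)) u) / mfact I u)"
    by (simp only: expectation_pair_lincomb)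
  also have "\<dots> = ?E2 (\<lambda>(x, x'). y x * y x' * (\<Sum>d\<le>D. c d * (lam * overlap I x x') ^ d / fact d))"
  proof (intro arg_cong[of _ _ ?E2] ext, clarify)
    fix x x' :: "'i \<Rightarrow> real"
    have *: "(\<Sum>u\<in>exponents_upto I D. c (sum u I) * (mpow I (\<lambda>i. lam * (x i * x' i)) u / mfact I u)) =
        (\<Sum>d\<le>D. c d * ((\<Sum>i\<in>I. lam * (x i * x' i)) ^ d / fact d))"
      by (rule sum_exponents_upto[OF I])
    have "(\<Sum>u\<in>exponents_upto I D. c (sum u I) * (y x * y x' * mpow I (\<lambda>i. lam * (x i * x' i)) u) / mfact I u) =
        y x * y x' * (\<Sum>u\<in>exponents_upto I D. c (sum u I) * (mpow I (\<lambda>i. lam * (x i * x' i)) u / mfact I u))"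
      by (simp add: sum_distrib_left mult_ac)
    then show "(\<Sum>u\<in>exponents_upto I D. c (sum u I) * (y x * y x' * mpow I (\<lambda>i. lam * (x i * x' i)) u) / mfact I u) =
        y x * y x' * (\<Sum>d\<le>D. c d * (lam * overlap I x x') ^ d / fact d)"
      unfolding * by (simp add: overlap_def sum_distrib_left)
  qed
  finally show ?thesis .
qed

text \<open>The hypothesis \<open>small\<close> is the contraction condition, with its weight
  D^degree, in terms of the overlap. The error is four times the squared norm of the right-hand
  sides of the systems, where summing over the coordinates j contributes one more factor
  overlap.\<close>

theorem lowdeg_MMSE_lower_bound:
  assumes lam: "lam \<ge> 0" and D: "D \<ge> 1"
    and small: "(\<Sum>d=1..D. (real D * lam) ^ d *
      measure_pmf.expectation (pair_pmf P P) (\<lambda>(x, x'). overlap I x x' ^ d) / fact d) \<le> 1 / 8"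
  shows "second_moment I P - 4 * (\<Sum>d\<le>D. lam ^ d *
      measure_pmf.expectation (pair_pmf P P) (\<lambda>(x, x'). overlap I x x' ^ Suc d) / fact d)
    \<le> lowdeg_MMSE I P D lam"
proof -
  let ?E = "measure_pmf.expectation P" and ?E2 = "measure_pmf.expectation (pair_pmf P P)"
  let ?U = "exponents_upto I D" and ?G = "std_gaussian I"
  define m where "m u = ?E (\<lambda>x. mpow I (\<lambda>i. sqrt lam * x i) u)" for u
  define b where "b j u = ?E (\<lambda>x. x j * mpow I (\<lambda>i. sqrt lam * x i) u)" for j u
  have m0: "m (\<lambda>_. 0) = 1" by (simp add: m_def mpow_def)
  have "\<exists>K. \<forall>u\<in>?U. (\<Sum>\<alpha>\<le>u. mbinom I u \<alpha> * K \<alpha> * m (\<lambda>i. u i - \<alpha> i)) = b j u" for j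
    by (rule triangular_system_solvable[where m = m, OF I m0])
  then obtain K where K: "\<And>j u. u \<in> ?U \<Longrightarrow>
      (\<Sum>\<alpha>\<le>u. mbinom I u \<alpha> * K j \<alpha> * m (\<lambda>i. u i - \<alpha> i)) = b j u" by metis
  \<comment> \<open>The zero multi-index contributes 1, as does the term d = 0 of the overlap sum,
    so the two remainders agree.\<close>
  have split0: "(\<Sum>u\<in>?U. real D ^ sum u I * (m u)\<^sup>2 / mfact I u) =
      1 + (\<Sum>\<gamma>\<in>?U - {\<lambda>_. 0}. real D ^ sum \<gamma> I * (m \<gamma>)\<^sup>2 / mfact I \<gamma>)"
    using finite_exponents_upto[OF I] zero_exponent[of I D]
    by (subst sum.remove[of _ "\<lambda>_. 0"]) (auto simp: m0 mfact_def)
  have "(\<Sum>u\<in>?U. real D ^ sum u I * (m u)\<^sup>2 / mfact I u) =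
      ?E2 (\<lambda>(x, x'). \<Sum>d\<le>D. real D ^ d * (lam * overlap I x x') ^ d / fact d)"
    using sum_squared_moments[OF lam, of "\<lambda>d. real D ^ d" "\<lambda>_. 1"] by (simp add: m_def)
  also have "\<dots> = (\<Sum>d\<le>D. (real D * lam) ^ d * ?E2 (\<lambda>(x, x'). overlap I x x' ^ d) / fact d)"
    unfolding expectation_pair_lincomb
    by (intro arg_cong[of _ _ ?E2] ext) (auto simp: power_mult_distrib mult_ac)
  also have "\<dots> = 1 + (\<Sum>d=1..D. (real D * lam) ^ d * ?E2 (\<lambda>(x, x'). overlap I x x' ^ d) / fact d)"
  proof -
    have "?E2 (\<lambda>(x, x'). overlap I x x' ^ 0) = 1" by (simp add: case_prod_unfold)
    then show ?thesis
      by (subst atMost_atLeast0, subst sum.atLeast_Suc_atMost) simp_all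
  qed
  finally have small': "(\<Sum>\<gamma>\<in>?U - {\<lambda>_. 0}. real D ^ sum \<gamma> I * (m \<gamma>)\<^sup>2 / mfact I \<gamma>) \<le> 1 / 8"
    using small split0 by simp
  have sh: "(\<integral>z. mhermite I u (\<lambda>i. z i + a i) \<partial>?G) = mpow I a u" if u: "u \<in> ?U" for u a
  proof -
    \<comment> \<open>The constant 1 is itself a Hermite series, so the mean of a shifted Hermite
      product is a case of the shift formula.\<close>
    have one: "hermite_series I D (\<lambda>\<alpha>. if \<alpha> = (\<lambda>_. 0) then 1 else 0) z = 1" for z
    proof -
      have "hermite_series I D (\<lambda>\<alpha>. if \<alpha> = (\<lambda>_. 0) then 1 else 0) z =
          (\<Sum>\<alpha>\<in>?U. if \<alpha> = (\<lambda>_. 0) then 1 else 0)"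
        unfolding hermite_series_def by (intro sum.cong) (auto simp: mfact_def mhermite_zero)
      then show ?thesis using finite_exponents_upto[OF I] by (simp add: zero_exponent)
    qed
    have "(\<integral>z. mhermite I u (\<lambda>i. z i + a i) \<partial>?G) =
        (\<Sum>\<alpha>\<le>u. mbinom I u \<alpha> * (if \<alpha> = (\<lambda>_. 0) then 1 else 0) * mpow I a (\<lambda>i. u i - \<alpha> i))"
      using integral_hermite_series_shift[OF I u, of "\<lambda>\<alpha>. if \<alpha> = (\<lambda>_. 0) then 1 else 0" a]
      by (simp add: one)
    also have "\<dots> = (\<Sum>\<alpha>\<le>u. if \<alpha> = (\<lambda>_. 0) then mpow I a u else 0)"
      by (intro sum.cong) (auto simp: mbinom_def)
    also have "\<dots> = mpow I a u"
      using finite_atMost_exponent[OF I u] by (simp add: le_fun_def)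
    finally show ?thesis .
  qed
  have "second_moment I P - (\<Sum>j\<in>I. \<integral>z. (hermite_series I D (K j) z)\<^sup>2 \<partial>?G) \<le> lowdeg_MMSE I P D lam"
  proof (rule lowdeg_MMSE_ge_certificate)
    fix j u assume u: "u \<in> ?U"
    \<comment> \<open>Averaging the shift formula over the signal replaces the powers of the shift
      by the moments \<open>m\<close>, and the system solved by \<open>K j\<close> applies.\<close>
    have "?E (\<lambda>x. \<integral>z. hermite_series I D (K j) z * mhermite I u (\<lambda>i. z i + sqrt lam * x i) \<partial>?G) =
        ?E (\<lambda>x. \<Sum>\<alpha>\<le>u. mbinom I u \<alpha> * K j \<alpha> * mpow I (\<lambda>i. sqrt lam * x i) (\<lambda>i. u i - \<alpha> i))"
      by (simp add: integral_hermite_series_shift[OF I u])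
    also have "\<dots> = b j u"
      using integrable_finite_support
      by (simp add: Bochner_Integration.integral_sum K[OF u, symmetric] m_def)
    finally show "?E (\<lambda>x. \<integral>z. hermite_series I D (K j) z * mhermite I u (\<lambda>i. z i + sqrt lam * x i) \<partial>?G) =
        ?E (\<lambda>x. x j * (\<integral>z. mhermite I u (\<lambda>i. z i + sqrt lam * x i) \<partial>?G))"
      by (simp add: sh[OF u] b_def)
  qed (rule hermite_series_in_span)
  moreover have "(\<Sum>j\<in>I. \<integral>z. (hermite_series I D (K j) z)\<^sup>2 \<partial>?G) \<le>
      4 * (\<Sum>d\<le>D. lam ^ d * ?E2 (\<lambda>(x, x'). overlap I x x' ^ Suc d) / fact d)"
  proof -
    have "(\<Sum>j\<in>I. \<integral>z. (hermite_series I D (K j) z)\<^sup>2 \<partial>?G) \<le>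
        (\<Sum>j\<in>I. 4 * (\<Sum>u\<in>?U. (b j u)\<^sup>2 / mfact I u))"
      unfolding integral_hermite_series_square[OF I]
      by (intro sum_mono triangular_system_norm[OF I m0 D K small'])
    also have "\<dots> = 4 * (\<Sum>j\<in>I. ?E2 (\<lambda>(x, x'). x j * x' j * (\<Sum>d\<le>D. (lam * overlap I x x') ^ d / fact d)))"
    proof -
      have "(\<Sum>u\<in>?U. (b j u)\<^sup>2 / mfact I u) =
          ?E2 (\<lambda>(x, x'). x j * x' j * (\<Sum>d\<le>D. (lam * overlap I x x') ^ d / fact d))" for j
        using sum_squared_moments[OF lam, of "\<lambda>d. 1" "\<lambda>x. x j"] by (simp add: b_def)
      then show ?thesis by (simp only: sum_distrib_left)
    qed
    also have "(\<Sum>j\<in>I. ?E2 (\<lambda>(x, x'). x j * x' j * (\<Sum>d\<le>D. (lam * overlap I x x') ^ d / fact d))) =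
        ?E2 (\<lambda>(x, x'). \<Sum>d\<le>D. lam ^ d * overlap I x x' ^ Suc d / fact d)"
    proof -
      have "(\<Sum>j\<in>I. x j * x' j * (\<Sum>d\<le>D. (lam * overlap I x x') ^ d / fact d)) =
          (\<Sum>d\<le>D. lam ^ d * overlap I x x' ^ Suc d / fact d)" for x x'
        by (simp add: sum_distrib_right [symmetric] overlap_def [symmetric])
           (simp add: sum_distrib_left power_mult_distrib mult_ac)
      then show ?thesis
        using integrable_finite_support_pair
        by (subst Bochner_Integration.integral_sum [symmetric]) (simp_all add: case_prod_unfold)
    qed
    also have "\<dots> = (\<Sum>d\<le>D. lam ^ d * ?E2 (\<lambda>(x, x'). overlap I x x' ^ Suc d) / fact d)"
      unfolding expectation_pair_lincomb
      by (intro arg_cong[of _ _ ?E2] ext) auto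
    finally show ?thesis .
  qed
  ultimately show ?thesis by linarith
qed

end

section \<open>The lazy random walk\<close>

text \<open>The expectation of \<phi> at the position after n steps, p being the probability to
  move. Encoding the law as a functional lets inductions on n run with \<phi> arbitrary.\<close>

primrec walk :: "real \<Rightarrow> nat \<Rightarrow> (real \<Rightarrow> real) \<Rightarrow> real" where
  "walk p 0 \<phi> = \<phi> 0"
| "walk p (Suc n) \<phi> =
    (1 - p) * walk p n \<phi> + p / 2 * (walk p n (\<lambda>t. \<phi> (t + 1)) + walk p n (\<lambda>t. \<phi> (t - 1)))"

lemma walk_const: "walk p n (\<lambda>_. c) = c"
  by (induction n) (auto simp: algebra_simps)

lemma walk_add: "walk p n (\<lambda>t. \<phi> t + \<psi> t) = walk p n \<phi> + walk p n \<psi>"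
  by (induction n arbitrary: \<phi> \<psi>) (auto simp: algebra_simps)

lemma walk_cmult: "walk p n (\<lambda>t. c * \<phi> t) = c * walk p n \<phi>"
  by (induction n arbitrary: \<phi>) (auto simp: algebra_simps)

lemma walk_reflect: "walk p n (\<lambda>t. \<phi> (- t)) = walk p n \<phi>"
proof (induction n arbitrary: \<phi>)
  case (Suc n)
  show ?case
    using Suc[of \<phi>] Suc[of "\<lambda>t. \<phi> (t + 1)"] Suc[of "\<lambda>t. \<phi> (t - 1)"] by (simp add: algebra_simps)
qed simp

text \<open>The walk only visits integers of modulus at most n, so comparison there suffices; this
  also gives tails beyond n the value 0.\<close>

lemma walk_mono:
  assumes "0 \<le> p" "p \<le> 1" "\<And>i::int. \<bar>i\<bar> \<le> int n \<Longrightarrow> \<phi> (of_int i) \<le> \<psi> (of_int i)"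
  shows "walk p n \<phi> \<le> walk p n \<psi>"
  using assms(3)
proof (induction n arbitrary: \<phi> \<psi>)
  case (Suc n)
  have "walk p n \<phi> \<le> walk p n \<psi>"
    by (rule Suc.IH) (use Suc.prems in auto)
  moreover have "walk p n (\<lambda>t. \<phi> (t + 1)) \<le> walk p n (\<lambda>t. \<psi> (t + 1))"
    by (rule Suc.IH) (use Suc.prems[of "_ + 1"] in auto)
  moreover have "walk p n (\<lambda>t. \<phi> (t - 1)) \<le> walk p n (\<lambda>t. \<psi> (t - 1))"
    by (rule Suc.IH) (use Suc.prems[of "_ - 1"] in auto)
  ultimately show ?case using assms(1,2)
    by (auto intro!: add_mono mult_left_mono)
qed (use assms in \<open>auto dest: spec[of _ 0]\<close>)

lemma walk_nonneg:
  assumes "0 \<le> p" "p \<le> 1" "\<And>i::int. \<phi> (of_int i) \<ge> 0"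
  shows "walk p n \<phi> \<ge> 0"
  using walk_mono[of p n "\<lambda>_. 0" \<phi>] assms by (simp add: walk_const)

lemma walk_exp: "walk p n (\<lambda>t. exp (\<theta> * t)) = (1 - p + p * cosh \<theta>) ^ n"
proof (induction n)
  case (Suc n)
  have "walk p n (\<lambda>t. exp (\<theta> * (t + 1))) = exp \<theta> * walk p n (\<lambda>t. exp (\<theta> * t))"
    "walk p n (\<lambda>t. exp (\<theta> * (t - 1))) = exp (- \<theta>) * walk p n (\<lambda>t. exp (\<theta> * t))"
    unfolding walk_cmult [symmetric] by (simp_all add: algebra_simps exp_add [symmetric])
  then show ?case using Suc by (simp add: cosh_def algebra_simps)
qed simp

text \<open>By 1 + x \<le> exp x the generating function is at most exp (n p (cosh \<theta> - 1)).
  The admissible \<theta> is about the inverse standard deviation when n p is large and about - ln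
  (n p) when it is small.\<close>

lemma walk_cosh_bound:
  assumes "0 \<le> p" "p \<le> 1" "real n * p * (cosh \<theta> - 1) \<le> 1"
  shows "walk p n (\<lambda>t. exp (\<theta> * t) + exp (- \<theta> * t)) \<le> 2 * exp 1"
proof -
  have "(1 - p + p * cosh \<theta>) ^ n \<le> exp (p * (cosh \<theta> - 1)) ^ n"
    using assms(1,2) exp_ge_add_one_self[of "p * (cosh \<theta> - 1)"]
      mult_left_mono[OF cosh_real_ge_1[of \<theta>] assms(1)]
    by (intro power_mono) (auto simp: algebra_simps)
  also have "\<dots> = exp (real n * p * (cosh \<theta> - 1))"
    by (simp add: exp_of_nat_mult [symmetric] mult.assoc)
  also have "\<dots> \<le> exp 1" using assms(3) by simp
  finally show ?thesis
    using walk_exp[of p n \<theta>] walk_exp[of p n "- \<theta>"] by (simp add: walk_add)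
qed

lemma power_div_fact_le_exp:
  assumes "(x::real) \<ge> 0"
  shows "x ^ m / fact m \<le> exp x"
proof -
  have "x ^ m / fact m = (\<Sum>i\<in>{m}. x ^ i /\<^sub>R fact i)" by (simp add: field_simps)
  also have "\<dots> \<le> exp x"
    unfolding exp_def
    by (rule sum_le_suminf[OF summable_exp_generic]) (use assms in auto)
  finally show ?thesis .
qed

lemma exp_abs_le: "exp (\<theta> * \<bar>t\<bar>) \<le> exp (\<theta> * t) + exp (- \<theta> * (t::real))"
  by (cases "t \<ge> 0") auto

text \<open>One term of the exponential series bounds |t|^m by m! / \<theta>^m times exp (\<theta>
  |t|), so all moments come from a single exponential moment.\<close>

lemma walk_moment_bound:
  assumes "0 \<le> p" "p \<le> 1" "0 < \<theta>" "real n * p * (cosh \<theta> - 1) \<le> 1"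
  shows "walk p n (\<lambda>t. \<bar>t\<bar> ^ m) \<le> 2 * exp 1 * fact m / \<theta> ^ m"
proof -
  have "\<bar>t\<bar> ^ m \<le> fact m / \<theta> ^ m * (exp (\<theta> * t) + exp (- \<theta> * t))" for t :: real
  proof -
    have "\<bar>t\<bar> ^ m = fact m / \<theta> ^ m * ((\<theta> * \<bar>t\<bar>) ^ m / fact m)"
      using assms(3) by (simp add: power_mult_distrib)
    also have "\<dots> \<le> fact m / \<theta> ^ m * (exp (\<theta> * t) + exp (- \<theta> * t))"
      using assms(3) exp_abs_le[of \<theta> t] power_div_fact_le_exp[of "\<theta> * \<bar>t\<bar>" m]
      by (intro mult_left_mono) auto
    finally show ?thesis .
  qed
  then have "walk p n (\<lambda>t. \<bar>t\<bar> ^ m) \<le> walk p n (\<lambda>t. fact m / \<theta> ^ m * (exp (\<theta> * t) + exp (- \<theta> * t)))"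
    using assms by (intro walk_mono)
  also have "\<dots> \<le> fact m / \<theta> ^ m * (2 * exp 1)"
    unfolding walk_cmult using assms by (intro mult_left_mono walk_cosh_bound) auto
  finally show ?thesis by (simp add: mult_ac)
qed

lemma walk_tail_bound:
  assumes "0 \<le> p" "p \<le> 1" "0 < \<theta>" "real n * p * (cosh \<theta> - 1) \<le> 1"
  shows "walk p n (\<lambda>t. of_bool (\<bar>t\<bar> > y)) \<le> 2 * exp 1 * exp (- \<theta> * y)"
proof -
  have "of_bool (\<bar>t\<bar> > y) \<le> exp (- \<theta> * y) * (exp (\<theta> * t) + exp (- \<theta> * t))" for t :: real
  proof (cases "\<bar>t\<bar> > y")
    case True
    then have "1 \<le> exp (- \<theta> * y) * exp (\<theta> * \<bar>t\<bar>)"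
      using assms(3) by (simp flip: exp_add)
    also have "\<dots> \<le> exp (- \<theta> * y) * (exp (\<theta> * t) + exp (- \<theta> * t))"
      by (intro mult_left_mono exp_abs_le) simp
    finally show ?thesis using True by simp
  qed (simp add: add_nonneg_nonneg)
  then have "walk p n (\<lambda>t. of_bool (\<bar>t\<bar> > y)) \<le>
      walk p n (\<lambda>t. exp (- \<theta> * y) * (exp (\<theta> * t) + exp (- \<theta> * t)))"
    using assms by (intro walk_mono)
  also have "\<dots> \<le> exp (- \<theta> * y) * (2 * exp 1)"
    unfolding walk_cmult using assms by (intro mult_left_mono walk_cosh_bound) auto
  finally show ?thesis by (simp add: mult_ac)
qed

lemma walk_second_moment: "walk p n (\<lambda>t. t\<^sup>2) = real n * p"
proof (induction n)
  case (Suc n)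
  have "walk p n (\<lambda>t. (t + 1)\<^sup>2) + walk p n (\<lambda>t. (t - 1)\<^sup>2) = walk p n (\<lambda>t. 2 * t\<^sup>2 + 2)"
    unfolding walk_add [symmetric] by (simp add: power2_eq_square algebra_simps)
  also have "\<dots> = 2 * (real n * p) + 2"
    by (simp only: walk_add walk_cmult walk_const Suc)
  finally show ?case using Suc by (simp add: algebra_simps)
qed simp

text \<open>A step raises the fourth moment by 6 n p^2 + p; the closed form on the right grows by 3
  p^2 more.\<close>

lemma walk_fourth_moment:
  assumes "p \<ge> 0"
  shows "walk p n (\<lambda>t. t ^ 4) \<le> 3 * (real n * p)\<^sup>2 + real n * p"
proof (induction n)
  case (Suc n)
  have "walk p n (\<lambda>t. (t + 1) ^ 4) + walk p n (\<lambda>t. (t - 1) ^ 4) =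
      walk p n (\<lambda>t. 2 * t ^ 4 + (12 * t\<^sup>2 + 2))"
    unfolding walk_add [symmetric] by (simp add: power2_eq_square power4_eq_xxxx algebra_simps)
  also have "\<dots> = 2 * walk p n (\<lambda>t. t ^ 4) + (12 * (real n * p) + 2)"
    by (simp only: walk_add walk_cmult walk_const walk_second_moment)
  finally have "walk p (Suc n) (\<lambda>t. t ^ 4) = walk p n (\<lambda>t. t ^ 4) + 6 * real n * p\<^sup>2 + p"
    by (simp add: algebra_simps power2_eq_square)
  also have "\<dots> \<le> 3 * (real (Suc n) * p)\<^sup>2 + real (Suc n) * p"
  proof -
    have "3 * (real (Suc n) * p)\<^sup>2 + real (Suc n) * p =
        3 * (real n * p)\<^sup>2 + real n * p + 6 * real n * p\<^sup>2 + p + 3 * p\<^sup>2"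
      by (simp add: algebra_simps power2_eq_square)
    moreover have "0 \<le> 3 * p\<^sup>2" by simp
    ultimately show ?thesis using Suc by linarith
  qed
  finally show ?case .
qed simp

text \<open>A linear form of Paley--Zygmund with a free parameter: in place of Cauchy--Schwarz, the
  square is bounded pointwise by a t^4 + 1/(4 a) on the event and by y^2 off it.\<close>

lemma walk_paley_zygmund:
  assumes "0 \<le> p" "p \<le> 1" "a > 0"
  shows "real n * p \<le> y\<^sup>2 + a * (3 * (real n * p)\<^sup>2 + real n * p) + walk p n (\<lambda>t. of_bool (\<bar>t\<bar> > y)) / (4 * a)"
proof (cases "y \<ge> 0")
  case True
  have "t\<^sup>2 \<le> y\<^sup>2 + (a * t ^ 4 + 1 / (4 * a) * of_bool (\<bar>t\<bar> > y))" for t :: real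
  proof (cases "\<bar>t\<bar> > y")
    case True
    have "0 \<le> (2 * a * t\<^sup>2 - 1)\<^sup>2 / (4 * a)" using assms by simp
    also have "\<dots> = a * t ^ 4 + 1 / (4 * a) - t\<^sup>2"
      using assms by (simp add: power2_eq_square power4_eq_xxxx field_simps)
    finally have "t\<^sup>2 \<le> a * t ^ 4 + 1 / (4 * a)" by simp
    then show ?thesis using True by (simp add: add_increasing)
  next
    case False
    then have "t\<^sup>2 \<le> y\<^sup>2" using \<open>y \<ge> 0\<close> by (metis abs_le_square_iff abs_of_nonneg not_less)
    then show ?thesis using False assms by (simp add: add_increasing2)
  qed
  then have "walk p n (\<lambda>t. t\<^sup>2) \<le> walk p n (\<lambda>t. y\<^sup>2 + (a * t ^ 4 + 1 / (4 * a) * of_bool (\<bar>t\<bar> > y)))"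
    using assms by (intro walk_mono)
  also have "\<dots> = y\<^sup>2 + (a * walk p n (\<lambda>t. t ^ 4) + 1 / (4 * a) * walk p n (\<lambda>t. of_bool (\<bar>t\<bar> > y)))"
    by (simp only: walk_add walk_cmult walk_const)
  finally have "real n * p \<le> y\<^sup>2 + (a * walk p n (\<lambda>t. t ^ 4) + walk p n (\<lambda>t. of_bool (\<bar>t\<bar> > y)) / (4 * a))"
    by (simp add: walk_second_moment)
  moreover have "a * walk p n (\<lambda>t. t ^ 4) \<le> a * (3 * (real n * p)\<^sup>2 + real n * p)"
    using assms by (intro mult_left_mono walk_fourth_moment) auto
  ultimately show ?thesis by linarith
next
  case False
  \<comment> \<open>For negative y the event is sure, and the square (2 a n p - 1)^2 gives the
    claim.\<close>
  then have "walk p n (\<lambda>t. of_bool (\<bar>t\<bar> > y)) = walk p n (\<lambda>_. 1)"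
    by (intro arg_cong[of _ _ "walk p n"] ext) auto
  then have "walk p n (\<lambda>t. of_bool (\<bar>t\<bar> > y)) / (4 * a) = 1 / (4 * a)"
    by (simp add: walk_const)
  moreover have "0 \<le> (2 * a * (real n * p) - 1)\<^sup>2 / (4 * a)" using assms by simp
  moreover have "(2 * a * (real n * p) - 1)\<^sup>2 / (4 * a) = a * (real n * p)\<^sup>2 + 1 / (4 * a) - real n * p"
    using assms by (simp add: power2_eq_square field_simps)
  moreover have "a * (real n * p)\<^sup>2 \<le> a * (3 * (real n * p)\<^sup>2 + real n * p)"
    using assms by (intro mult_left_mono) auto
  ultimately show ?thesis using zero_le_power2[of y] by linarith
qed

section \<open>Point probabilities of the walk\<close>

definition walk_prob :: "real \<Rightarrow> nat \<Rightarrow> int \<Rightarrow> real" where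
  "walk_prob p n t = walk p n (\<lambda>x. of_bool (x = of_int t))"

lemma walk_prob_0: "walk_prob p 0 t = of_bool (t = 0)"
  by (auto simp: walk_prob_def)

lemma walk_prob_Suc:
  "walk_prob p (Suc n) t = (1 - p) * walk_prob p n t + p / 2 * (walk_prob p n (t - 1) + walk_prob p n (t + 1))"
  by (simp add: walk_prob_def algebra_simps eq_diff_eq diff_eq_eq)

lemma walk_prob_nonneg:
  assumes "0 \<le> p" "p \<le> 1"
  shows "walk_prob p n t \<ge> 0"
  unfolding walk_prob_def by (rule walk_nonneg) (use assms in auto)

lemma walk_prob_reflect: "walk_prob p n (- t) = walk_prob p n t"
proof -
  have "(\<lambda>x. of_bool (x = of_int (- t)) :: real) = (\<lambda>x. of_bool (- x = real_of_int t))"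
    by (auto simp: fun_eq_iff)
  then show ?thesis
    using walk_reflect[of p n "\<lambda>x. of_bool (x = of_int t)"] by (simp add: walk_prob_def)
qed

text \<open>Laziness, p < 1, removes the parity obstruction.\<close>

lemma walk_prob_pos:
  assumes "0 < p" "p < 1" "s \<le> n"
  shows "walk_prob p n (int s) > 0"
  using assms(3)
proof (induction n arbitrary: s)
  case (Suc n)
  have nn: "walk_prob p n t \<ge> 0" for t using assms by (intro walk_prob_nonneg) auto
  show ?case
  proof (cases "s \<le> n")
    case True
    then show ?thesis using Suc.IH[OF True] assms nn
      by (simp add: walk_prob_Suc add_pos_nonneg)
  next
    case False
    then have "s = Suc n" using Suc.prems by simp
    then show ?thesis using Suc.IH[of n] assms nn
      by (simp add: walk_prob_Suc add_nonneg_pos add_pos_nonneg)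
  qed
qed (simp add: walk_prob_0)

text \<open>By exchangeability, t P(T = t) is the number of steps times the mean of one step on the
  event T = t, and that step is +1 or -1 with probability p/2 each. The proof checks this by
  induction.\<close>

lemma walk_prob_size_bias:
  "of_int t * walk_prob p (Suc n) t =
    real (Suc n) * (p / 2) * (walk_prob p n (t - 1) - walk_prob p n (t + 1))"
proof (induction n arbitrary: t)
  case 0
  show ?case
    by (cases "t = 1"; cases "t = - 1") (auto simp: walk_prob_Suc walk_prob_0)
next
  case (Suc n)
  have "of_int t * walk_prob p (Suc (Suc n)) t =
      (1 - p) * (of_int t * walk_prob p (Suc n) t)
      + p / 2 * (of_int (t - 1) * walk_prob p (Suc n) (t - 1) + of_int (t + 1) * walk_prob p (Suc n) (t + 1))
      + p / 2 * (walk_prob p (Suc n) (t - 1) - walk_prob p (Suc n) (t + 1))"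
    by (subst walk_prob_Suc) (simp add: algebra_simps)
  also have "\<dots> = real (Suc n) * (p / 2) * (walk_prob p (Suc n) (t - 1) - walk_prob p (Suc n) (t + 1))
      + p / 2 * (walk_prob p (Suc n) (t - 1) - walk_prob p (Suc n) (t + 1))"
    unfolding Suc.IH by (simp add: walk_prob_Suc[of p n] field_simps)
  finally show ?case by (simp add: field_simps)
qed

text \<open>Applying the one-step recursion to the size-bias identity relates neighbouring sites at
  the same time n.\<close>

lemma walk_prob_three_term:
  "walk_prob p n (t - 1) * (real n - of_int t + 1) * (p / 2) =
    (1 - p) * of_int t * walk_prob p n t + p / 2 * (real n + of_int t + 1) * walk_prob p n (t + 1)"
proof -
  have "(1 - p) * (of_int t * walk_prob p n t) +
      p / 2 * (of_int (t - 1) * walk_prob p n (t - 1) + of_int (t + 1) * walk_prob p n (t + 1)) =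
      real n * (p / 2) * (walk_prob p n (t - 1) - walk_prob p n (t + 1))"
  proof (cases n)
    case 0
    then show ?thesis by (auto simp: walk_prob_0)
  next
    case (Suc m)
    show ?thesis unfolding Suc walk_prob_size_bias
      by (simp add: walk_prob_Suc[of p m] field_simps)
  qed
  then show ?thesis by (simp add: field_simps)
qed

text \<open>The bound p \<le> 2/3 says p/2 \<le> 1 - p, so the law of one step is already unimodal.
  It enters at the origin, where reflection makes 1 - 3p/2 the coefficient of the first
  difference.\<close>

lemma walk_prob_decreasing:
  assumes "0 \<le> p" "p \<le> 2 / 3" "t \<ge> 0"
  shows "walk_prob p n (t + 1) \<le> walk_prob p n t"
  using assms(3)
proof (induction n arbitrary: t)
  case (Suc n)
  let ?w = "walk_prob p n"
  have "walk_prob p (Suc n) t - walk_prob p (Suc n) (t + 1) =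
      (1 - p) * (?w t - ?w (t + 1)) + p / 2 * (?w (t - 1) - ?w t) + p / 2 * (?w (t + 1) - ?w (t + 2))"
    by (simp add: walk_prob_Suc algebra_simps)
  also have "\<dots> \<ge> 0"
  proof (cases "t = 0")
    case True
    have "?w (- 1) = ?w 1" using walk_prob_reflect[of p n 1] by simp
    then have "(1 - p) * (?w t - ?w (t + 1)) + p / 2 * (?w (t - 1) - ?w t) + p / 2 * (?w (t + 1) - ?w (t + 2)) =
        (1 - 3 / 2 * p) * (?w 0 - ?w 1) + p / 2 * (?w 1 - ?w 2)"
      using True by (simp add: field_simps)
    also have "\<dots> \<ge> 0"
      using Suc.IH[of 0] Suc.IH[of 1] assms by (intro add_nonneg_nonneg mult_nonneg_nonneg) auto
    finally show ?thesis .
  next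
    case False
    then show ?thesis
      using Suc.IH[of t] Suc.IH[of "t - 1"] Suc.IH[of "t + 1"] Suc.prems assms
      by (intro add_nonneg_nonneg mult_nonneg_nonneg) (auto simp: add.assoc)
  qed
  finally show ?case by simp
qed (auto simp: walk_prob_0)

text \<open>In the three-term relation at s + 1 the middle probability is replaced by the smaller
  one at s + 2; afterwards n - s is enlarged to n.\<close>

lemma walk_prob_ratio_ge:
  assumes "0 < p" "p \<le> 2 / 3" "s + 2 \<le> n"
  shows "(1 + 2 * (real s + 1) / (real n * p)) * walk_prob p n (int s + 2) \<le> walk_prob p n (int s)"
proof -
  let ?w = "walk_prob p n"
  let ?x = "real s + 1"
  have nn: "?w t \<ge> 0" for t using assms by (intro walk_prob_nonneg) auto
  have d: "?w (int s + 2) \<le> ?w (int s + 1)"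
    using walk_prob_decreasing[of p "int s + 1" n] assms by (simp add: add.assoc)
  have pos: "(real n - real s) * p > 0" using assms by simp
  have cancel: "c * ((1 + 2 * x / c) * w) = (c + 2 * x) * w" if "c > 0" for c x w :: real
    using that by (simp add: field_simps)
  have "(real n - real s) * p * ((1 + 2 * ?x / ((real n - real s) * p)) * ?w (int s + 2)) =
     ((real n - real s) * p + 2 * ?x) * ?w (int s + 2)"
    using pos by (simp only: cancel)
  also have "\<dots> = 2 * (1 - p) * ?x * ?w (int s + 2) + p * (real n + real s + 2) * ?w (int s + 2)"
    by (simp add: algebra_simps)
  also have "\<dots> \<le> 2 * (1 - p) * ?x * ?w (int s + 1) + p * (real n + real s + 2) * ?w (int s + 2)"
    using assms d by (intro add_mono mult_left_mono) auto
  also have "\<dots> = (real n - real s) * p * ?w (int s)"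
    using walk_prob_three_term[of p n "int s + 1"] by (simp add: algebra_simps)
  finally have "(1 + 2 * ?x / ((real n - real s) * p)) * ?w (int s + 2) \<le> ?w (int s)"
    using pos by (rule mult_left_le_imp_le)
  moreover have "2 * ?x / (real n * p) \<le> 2 * ?x / ((real n - real s) * p)"
    using assms by (intro divide_left_mono) (auto intro!: mult_right_mono)
  then have "(1 + 2 * ?x / (real n * p)) * ?w (int s + 2) \<le> (1 + 2 * ?x / ((real n - real s) * p)) * ?w (int s + 2)"
    by (intro mult_right_mono nn) simp
  ultimately show ?thesis by linarith
qed

text \<open>The same relation, now with the probability at s + 2 replaced by the larger one at s +
  1, controls a single step; the potential moves by two.\<close>

lemma walk_prob_step_le:
  assumes "0 < p" "p \<le> 2 / 3" "s < n"
  shows "walk_prob p n (int s) \<le> (1 + 2 * (real s + 1) / ((real n - real s) * p)) * walk_prob p n (int s + 1)"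
proof -
  let ?w = "walk_prob p n"
  let ?x = "real s + 1"
  have nn: "?w t \<ge> 0" for t using assms by (intro walk_prob_nonneg) auto
  have d: "?w (int s + 2) \<le> ?w (int s + 1)"
    using walk_prob_decreasing[of p "int s + 1" n] assms by (simp add: add.assoc)
  have pos: "(real n - real s) * p > 0" using assms by simp
  have cancel: "c * ((1 + 2 * x / c) * w) = (c + 2 * x) * w" if "c > 0" for c x w :: real
    using that by (simp add: field_simps)
  have "(real n - real s) * p * ?w (int s) =
     2 * (1 - p) * ?x * ?w (int s + 1) + p * (real n + real s + 2) * ?w (int s + 2)"
    using walk_prob_three_term[of p n "int s + 1"] by (simp add: algebra_simps)
  also have "\<dots> \<le> 2 * (1 - p) * ?x * ?w (int s + 1) + p * (real n + real s + 2) * ?w (int s + 1)"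
    using assms d by (intro add_mono mult_left_mono) auto
  also have "\<dots> = ((real n - real s) * p + 2 * ?x) * ?w (int s + 1)"
    by (simp add: algebra_simps)
  also have "\<dots> = (real n - real s) * p * ((1 + 2 * ?x / ((real n - real s) * p)) * ?w (int s + 1))"
    using pos by (simp only: cancel)
  finally show ?thesis using pos by (rule mult_left_le_imp_le)
qed

text \<open>Two single steps. The condition on s keeps n - i \<ge> n/2 in both, which doubles the
  constant.\<close>

lemma walk_prob_ratio_le:
  assumes "0 < p" "p \<le> 2 / 3" "2 * (s + 1) \<le> n"
  shows "walk_prob p n (int s) \<le> (1 + 4 * (real s + 2) / (real n * p))\<^sup>2 * walk_prob p n (int s + 2)"
proof -
  let ?w = "walk_prob p n" and ?y = "1 + 4 * (real s + 2) / (real n * p)"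
  have nn: "?w t \<ge> 0" for t using assms by (intro walk_prob_nonneg) auto
  have step: "2 * (real i + 1) / ((real n - real i) * p) \<le> 4 * (real s + 2) / (real n * p)"
    if "i \<le> s + 1" for i
  proof -
    have "2 * (real i + 1) / ((real n - real i) * p) \<le> 2 * (real s + 2) / (real n / 2 * p)"
      using assms that by (intro frac_le mult_right_mono mult_pos_pos) auto
    then show ?thesis by simp
  qed
  have "?w (int s) \<le> (1 + 2 * (real s + 1) / ((real n - real s) * p)) * ?w (int s + 1)"
    using assms by (intro walk_prob_step_le) auto
  also have "\<dots> \<le> ?y * ?w (int s + 1)"
    using step[of s] by (intro mult_right_mono nn) auto
  also have "?w (int s + 1) \<le> (1 + 2 * (real (s + 1) + 1) / ((real n - real (s + 1)) * p)) * ?w (int s + 2)"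
    using walk_prob_step_le[of p "s + 1" n] assms by (simp add: algebra_simps)
  also have "\<dots> \<le> ?y * ?w (int s + 2)"
    using step[of "s + 1"] by (intro mult_right_mono nn) auto
  finally show ?thesis
    using assms by (simp add: power2_eq_square mult.assoc mult_left_mono)
qed

section \<open>Overlaps of sparse Rademacher tensors\<close>

lemma expectation_pair_iterated:
  fixes f :: "'a \<times> 'b \<Rightarrow> real"
  assumes "finite (set_pmf A)" "finite (set_pmf B)"
  shows "measure_pmf.expectation (pair_pmf A B) f =
    measure_pmf.expectation A (\<lambda>x. measure_pmf.expectation B (\<lambda>y. f (x, y)))"
proof -
  have "measure_pmf.expectation (pair_pmf A B) f =
      (\<Sum>w\<in>set_pmf A \<times> set_pmf B. f w * pmf (pair_pmf A B) w)"
    using assms by (intro integral_measure_pmf_real) auto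
  also have "\<dots> = (\<Sum>(x, y)\<in>set_pmf A \<times> set_pmf B. f (x, y) * pmf B y * pmf A x)"
    by (auto simp: pmf_pair intro!: sum.cong)
  also have "\<dots> = (\<Sum>x\<in>set_pmf A. (\<Sum>y\<in>set_pmf B. f (x, y) * pmf B y) * pmf A x)"
    by (simp only: sum.cartesian_product [symmetric] sum_distrib_right)
  finally show ?thesis
    using assms by (simp add: integral_measure_pmf_real[where A = "set_pmf A"]
        integral_measure_pmf_real[where A = "set_pmf B"])
qed

lemma expectation_swap:
  fixes f :: "'a \<Rightarrow> 'b \<Rightarrow> real"
  assumes "finite (set_pmf A)" "finite (set_pmf B)"
  shows "measure_pmf.expectation A (\<lambda>x. measure_pmf.expectation B (f x)) =
    measure_pmf.expectation B (\<lambda>y. measure_pmf.expectation A (\<lambda>x. f x y))"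
  using assms
  by (simp add: integral_measure_pmf_real[where A = "set_pmf A"]
      integral_measure_pmf_real[where A = "set_pmf B"] sum_distrib_left sum_distrib_right mult_ac)
     (rule sum.swap)

lemma set_sparse_rademacher: "set_pmf (sparse_rademacher n k) \<subseteq> {- 1, 0, 1}"
  by (auto simp: sparse_rademacher_def split: if_splits)

lemma finite_set_sparse_rademacher: "finite (set_pmf (sparse_rademacher n k))"
  using set_sparse_rademacher by (rule finite_subset) simp

lemma expectation_sparse_rademacher:
  assumes "0 \<le> k" "k \<le> real n"
  shows "measure_pmf.expectation (sparse_rademacher n k) h =
    (1 - k / real n) * h 0 + k / real n / 2 * (h 1 + h (- 1) :: real)"
proof -
  have q: "0 \<le> k / real n" "k / real n \<le> 1"
    using assms by (auto simp: divide_le_eq_1)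
  have "measure_pmf.expectation (map_pmf (\<lambda>pos. if pos then 1 else - 1) (bernoulli_pmf (1 / 2))) h =
      h 1 / 2 + h (- 1) / 2"
    by (simp add: integral_bernoulli_pmf)
  then have "measure_pmf.expectation (sparse_rademacher n k) h =
      (\<Sum>b\<in>UNIV. pmf (bernoulli_pmf (k / real n)) b *\<^sub>R
        (if b then h 1 / 2 + h (- 1) / 2 else h 0))"
    unfolding sparse_rademacher_def
    by (subst pmf_expectation_bind[where A = UNIV]) (auto intro!: sum.cong)
  then show ?thesis using q by (simp add: UNIV_bool algebra_simps add_divide_distrib)
qed

lemma finite_set_Pi_pmf:
  assumes "finite A" "\<And>x. finite (set_pmf (p x))"
  shows "finite (set_pmf (Pi_pmf A d p))"
  using assms(1) by (induction A rule: finite_induct) (auto simp: Pi_pmf_insert assms(2))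

lemma finite_set_tensor_prior: "finite (set_pmf (tensor_prior n k))"
  unfolding tensor_prior_def
  by (simp add: finite_set_Pi_pmf finite_set_sparse_rademacher)

text \<open>Each product of entries is nonzero with probability (k/n)^2 and then has a fair sign, so
  it is one step of the walk. The number \<open>m\<close> of coordinates varies in the induction
  while the step law stays tied to \<open>n\<close>.\<close>

lemma expectation_sparse_overlap:
  assumes k: "0 \<le> k" "k \<le> real n"
  defines "V \<equiv> \<lambda>m. Pi_pmf {..<m} 0 (\<lambda>_. sparse_rademacher n k)"
  shows "measure_pmf.expectation (V m) (\<lambda>v. measure_pmf.expectation (V m) (\<lambda>v'. \<phi> (\<Sum>j<m. v j * v' j))) =
    walk ((k / real n)\<^sup>2) m \<phi>"
proof (induction m arbitrary: \<phi>)
  case 0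
  show ?case by (simp add: V_def)
next
  case (Suc m)
  let ?\<rho> = "sparse_rademacher n k" and ?q = "k / real n"
  have fin: "finite (set_pmf (V m))" for m
    unfolding V_def by (simp add: finite_set_Pi_pmf finite_set_sparse_rademacher)
  have ins: "measure_pmf.expectation (V (Suc m)) g =
      measure_pmf.expectation ?\<rho> (\<lambda>a. measure_pmf.expectation (V m) (\<lambda>v. g (v(m := a))))" for g :: "_ \<Rightarrow> real"
  proof -
    have "V (Suc m) = map_pmf (\<lambda>(y, f). f(m := y)) (pair_pmf ?\<rho> (V m))"
      unfolding V_def lessThan_Suc by (rule Pi_pmf_insert) auto
    then show ?thesis
      by (simp add: expectation_pair_iterated finite_set_sparse_rademacher fin case_prod_unfold)
  qed
  have upd: "(\<Sum>j<Suc m. (v(m := a)) j * (v'(m := a')) j) = (\<Sum>j<m. v j * v' j) + a * a'"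
    for v v' :: "nat \<Rightarrow> real" and a a'
    by (auto intro!: sum.cong)
  have "measure_pmf.expectation (V (Suc m)) (\<lambda>v. measure_pmf.expectation (V (Suc m)) (\<lambda>v'. \<phi> (\<Sum>j<Suc m. v j * v' j))) =
      measure_pmf.expectation ?\<rho> (\<lambda>a. measure_pmf.expectation (V m) (\<lambda>v.
        measure_pmf.expectation ?\<rho> (\<lambda>a'. measure_pmf.expectation (V m) (\<lambda>v'.
          \<phi> ((\<Sum>j<m. v j * v' j) + a * a')))))"
    unfolding ins upd ..
  also have "\<dots> = measure_pmf.expectation ?\<rho> (\<lambda>a. measure_pmf.expectation ?\<rho> (\<lambda>a'.
      walk (?q\<^sup>2) m (\<lambda>t. \<phi> (t + a * a'))))"
    by (subst expectation_swap[OF fin finite_set_sparse_rademacher])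
       (simp add: Suc.IH[of "\<lambda>t. \<phi> (t + _)"])
  also have "\<dots> = walk (?q\<^sup>2) (Suc m) \<phi>"
  proof -
    define q where "q = ?q"
    show ?thesis
      unfolding expectation_sparse_rademacher[OF k] q_def [symmetric]
      by (simp add: power2_eq_square field_simps)
  qed
  finally show ?case .
qed

lemma expectation_overlap:
  fixes \<phi> :: "real \<Rightarrow> real"
  assumes k: "0 \<le> k" "k \<le> real n"
  shows "measure_pmf.expectation (pair_pmf (tensor_prior n k) (tensor_prior n k))
      (\<lambda>(x, x'). \<phi> (overlap (tensor_index r n) x x')) =
    walk ((k / real n)\<^sup>2) n (\<lambda>t. \<phi> (t ^ r))"
  using expectation_sparse_overlap[OF k, where m = n and \<phi> = "\<lambda>t. \<phi> (t ^ r)"]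
  by (simp add: expectation_pair_iterated finite_set_tensor_prior)
     (simp add: tensor_prior_def overlap_tensor_power)

lemma prob_eq_expectation: "measure_pmf.prob M A = measure_pmf.expectation M (\<lambda>x. of_bool (x \<in> A))"
proof -
  have "(\<lambda>x. of_bool (x \<in> A) :: real) = indicator A" by (auto simp: indicator_def)
  then show ?thesis by simp
qed

lemma prob_overlap:
  assumes k: "0 \<le> k" "k \<le> real n"
  shows "measure_pmf.prob (pair_pmf (tensor_prior n k) (tensor_prior n k))
      {(x, x'). \<bar>overlap (tensor_index r n) x x'\<bar> \<le> y} =
    1 - walk ((k / real n)\<^sup>2) n (\<lambda>t. of_bool (\<bar>t\<bar> ^ r > y))"
proof -
  have "measure_pmf.prob (pair_pmf (tensor_prior n k) (tensor_prior n k))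
      {(x, x'). \<bar>overlap (tensor_index r n) x x'\<bar> \<le> y} = walk ((k / real n)\<^sup>2) n (\<lambda>t. of_bool (\<bar>t ^ r\<bar> \<le> y))"
    unfolding prob_eq_expectation
    using expectation_overlap[OF k, of "\<lambda>w. of_bool (\<bar>w\<bar> \<le> y)" r] by (simp add: case_prod_unfold)
  moreover have "walk ((k / real n)\<^sup>2) n (\<lambda>t. of_bool (\<bar>t ^ r\<bar> \<le> y)) + walk ((k / real n)\<^sup>2) n (\<lambda>t. of_bool (\<bar>t\<bar> ^ r > y)) = 1"
  proof -
    have "(\<lambda>t. of_bool (\<bar>t ^ r\<bar> \<le> y) + of_bool (\<bar>t\<bar> ^ r > y)) = (\<lambda>_::real. 1 :: real)"
      by (auto simp: fun_eq_iff power_abs)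
    then show ?thesis unfolding walk_add [symmetric] by (simp add: walk_const)
  qed
  ultimately show ?thesis by linarith
qed

text \<open>The overlap is the r-th power of an integer-valued walk, so the least natural s with
  small tail gives the quantile. The tail at s serves to bound s from below, the tails at real y < s
  to bound it from above.\<close>

lemma overlap_quantile_tensor:
  assumes k: "0 \<le> k" "k \<le> real n" and r: "r > 0" and d: "d > 0"
  defines "p \<equiv> (k / real n)\<^sup>2"
  obtains s :: nat where "overlap_quantile (tensor_index r n) (tensor_prior n k) d = real s ^ r"
    "walk p n (\<lambda>t. of_bool (\<bar>t\<bar> > real s)) \<le> exp (- d)"
    "\<And>y. y < real s \<Longrightarrow> 0 \<le> y \<Longrightarrow> walk p n (\<lambda>t. of_bool (\<bar>t\<bar> > y)) > exp (- d)"
proof -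
  have p: "0 \<le> p" "p \<le> 1"
    using k power_le_one[of "k / real n" 2] by (auto simp: p_def divide_le_eq_1)
  define Q where "Q = (\<lambda>s::nat. walk p n (\<lambda>t. of_bool (\<bar>t\<bar> > real s)) \<le> exp (- d))"
  have "walk p n (\<lambda>t. of_bool (\<bar>t\<bar> > real n)) \<le> walk p n (\<lambda>_. 0)"
    by (rule walk_mono[OF p]) auto
  then have "Q n"
    using exp_ge_zero[of "- d"] unfolding Q_def walk_const by linarith
  define s where "s = (LEAST s. Q s)"
  have s: "Q s" unfolding s_def using \<open>Q n\<close> by (rule LeastI)
  have less: "walk p n (\<lambda>t. of_bool (\<bar>t\<bar> > y)) > exp (- d)" if "y < real s" "0 \<le> y" for y
  proof -
    \<comment> \<open>An integer exceeding the floor of y exceeds y, so minimality among naturals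
      carries over to real levels.\<close>
    have "nat \<lfloor>y\<rfloor> < s" using that by linarith
    then have "\<not> Q (nat \<lfloor>y\<rfloor>)" unfolding s_def by (rule not_less_Least)
    moreover have "walk p n (\<lambda>t. of_bool (\<bar>t\<bar> > real (nat \<lfloor>y\<rfloor>))) \<le> walk p n (\<lambda>t. of_bool (\<bar>t\<bar> > y))"
    proof (rule walk_mono[OF p])
      fix i :: int
      show "of_bool (\<bar>real_of_int i\<bar> > real (nat \<lfloor>y\<rfloor>)) \<le> (of_bool (\<bar>real_of_int i\<bar> > y) :: real)"
      proof (cases "\<bar>real_of_int i\<bar> > real (nat \<lfloor>y\<rfloor>)")
        case True
        then have "\<bar>i\<bar> > \<lfloor>y\<rfloor>" using that by linarith
        then have "\<bar>real_of_int i\<bar> > y" by linarith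
        then show ?thesis by simp
      qed simp
    qed
    ultimately show ?thesis by (simp add: Q_def)
  qed
  have "{y. measure_pmf.prob (pair_pmf (tensor_prior n k) (tensor_prior n k))
      {(x, x'). \<bar>overlap (tensor_index r n) x x'\<bar> \<le> y} \<ge> 1 - exp (- d)} = {real s ^ r..}"
    (is "?S = _")
  proof (intro set_eqI iffI)
    fix y assume y: "y \<in> {real s ^ r..}"
    have "walk p n (\<lambda>t. of_bool (\<bar>t\<bar> ^ r > y)) \<le> walk p n (\<lambda>t. of_bool (\<bar>t\<bar> > real s))"
    proof (rule walk_mono[OF p])
      fix i :: int
      have "\<bar>real_of_int i\<bar> > real s" if "\<bar>real_of_int i\<bar> ^ r > y"
      proof (rule ccontr)
        assume "\<not> \<bar>real_of_int i\<bar> > real s"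
        then have "\<bar>real_of_int i\<bar> ^ r \<le> real s ^ r" by (intro power_mono) auto
        then show False using that y by simp
      qed
      then show "of_bool (\<bar>real_of_int i\<bar> ^ r > y) \<le> (of_bool (\<bar>real_of_int i\<bar> > real s) :: real)"
        by auto
    qed
    then show "y \<in> ?S" using s by (simp add: prob_overlap[OF k] Q_def p_def)
  next
    fix y assume y: "y \<in> ?S"
    show "y \<in> {real s ^ r..}"
    proof (rule ccontr)
      assume "y \<notin> {real s ^ r..}"
      then have lt: "y < real s ^ r" by simp
      have "exp (- d) < walk p n (\<lambda>t. of_bool (\<bar>t\<bar> ^ r > y))"
      proof (cases "y \<ge> 0")
        case False
        then have "y < \<bar>t\<bar> ^ r" for t :: real
          using zero_le_power[of "\<bar>t\<bar>" r] by linarith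
        then have "(\<lambda>t. of_bool (\<bar>t\<bar> ^ r > y)) = (\<lambda>_::real. 1 :: real)" by simp
        then show ?thesis using d by (simp add: walk_const)
      next
        case True
        let ?y = "root r y"
        have "?y < real s"
          using lt True r real_root_less_mono[OF r lt] by (simp add: real_root_power_cancel)
        then have "exp (- d) < walk p n (\<lambda>t. of_bool (\<bar>t\<bar> > ?y))"
          using less True r by simp
        also have "\<dots> \<le> walk p n (\<lambda>t. of_bool (\<bar>t\<bar> ^ r > y))"
        proof (rule walk_mono[OF p])
          fix i :: int
          have "\<bar>real_of_int i\<bar> ^ r > y" if "\<bar>real_of_int i\<bar> > ?y"
            using power_strict_mono[OF that, of r] True r by simp
          then show "of_bool (\<bar>real_of_int i\<bar> > ?y) \<le> (of_bool (\<bar>real_of_int i\<bar> ^ r > y) :: real)" by auto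
        qed
        finally show ?thesis .
      qed
      then show False using y by (simp add: prob_overlap[OF k] p_def)
    qed
  qed
  then have "overlap_quantile (tensor_index r n) (tensor_prior n k) d = real s ^ r"
    by (simp add: overlap_quantile_def)
  with s less show ?thesis by (intro that[of s]) (auto simp: Q_def)
qed

section \<open>The annealed potential in terms of the walk\<close>

lemma walk_power_eq:
  assumes "r > 0" "s > 0"
  shows "walk p n (\<lambda>t. of_bool (t ^ r = real s ^ r)) = (if even r then 2 else 1) * walk_prob p n (int s)"
proof (cases "even r")
  case True
  have "(\<lambda>t. of_bool (t ^ r = real s ^ r) :: real) =
      (\<lambda>t. of_bool (t = of_int (int s)) + of_bool (t = of_int (- int s)))"
  proof (rule ext)
    fix t :: real
    have "t ^ r = real s ^ r \<longleftrightarrow> \<bar>t\<bar> = real s"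
      using assms True power_eq_iff_eq_base[of r "\<bar>t\<bar>" "real s"] by (simp add: power_even_abs)
    then show "of_bool (t ^ r = real s ^ r) =
        of_bool (t = of_int (int s)) + (of_bool (t = of_int (- int s)) :: real)"
      using assms by (auto simp: abs_if)
  qed
  then show ?thesis
    using True walk_prob_reflect[of p n "int s"] by (simp add: walk_add walk_prob_def)
next
  case False
  have "t ^ r = real s ^ r \<longleftrightarrow> t = real s" for t
    using False odd_real_root_unique by (metis)
  then show ?thesis using False by (simp add: walk_prob_def)
qed

lemma annealed_FP_tensor:
  assumes k: "0 \<le> k" "k \<le> real n"
  shows "annealed_FP (tensor_index r n) (tensor_prior n k) lam q =
    - ln (exp (lam * q) * walk ((k / real n)\<^sup>2) n (\<lambda>t. of_bool (t ^ r = q)))"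
proof -
  have "(\<lambda>t. of_bool (t ^ r = q) * exp (lam * t ^ r)) = (\<lambda>t. exp (lam * q) * of_bool (t ^ r = q))"
    by (auto simp: fun_eq_iff)
  then show ?thesis
    using expectation_overlap[OF k, of "\<lambda>w. of_bool (w = q) * exp (lam * w)" r]
    by (simp add: annealed_FP_def walk_cmult)
qed

text \<open>The energy - lam q contributes exactly - lam to the difference quotient, so adding lam
  removes it. For even r both signs of the walk produce the overlap s^r; the resulting factor 2
  occurs at s and at s + 2 and cancels.\<close>

lemma FP_derivative_tensor:
  assumes k: "0 < k" "k < real n" and r: "r > 0" and s: "0 < s" "s + 2 \<le> n"
  defines "w \<equiv> walk_prob ((k / real n)\<^sup>2) n"
  shows "lam + discrete_deriv r (annealed_FP (tensor_index r n) (tensor_prior n k) lam) (real s ^ r) =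
    ln (w (int s) / w (int s + 2)) / (real (s + 2) ^ r - real s ^ r)"
proof -
  let ?F = "annealed_FP (tensor_index r n) (tensor_prior n k) lam"
  define c :: real where "c = (if even r then 2 else 1)"
  have p: "0 < (k / real n)\<^sup>2" "(k / real n)\<^sup>2 < 1"
    using k by (auto simp: power_less_one_iff abs_square_less_1)
  have c: "c > 0" by (simp add: c_def)
  have F: "?F (real u ^ r) = - lam * real u ^ r - ln c - ln (w (int u))" if u: "0 < u" "u \<le> n" for u
  proof -
    have "w (int u) > 0" unfolding w_def using p u by (intro walk_prob_pos) auto
    then show ?thesis
      using k walk_power_eq[OF r u(1), of "(k / real n)\<^sup>2" n] c
      by (simp add: annealed_FP_tensor c_def [symmetric] w_def [symmetric] ln_mult)
  qed
  have the: "(THE u::nat. real u ^ r = real s ^ r) = s"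
    using r by (intro the_equality) (auto simp: power_eq_iff_eq_base)
  have pos: "w (int s) > 0" "w (int s + 2) > 0"
    using p s walk_prob_pos[of "(k / real n)\<^sup>2" s n] walk_prob_pos[of "(k / real n)\<^sup>2" "s + 2" n]
    by (auto simp: w_def add.commute)
  have a: "real (s + 2) ^ r - real s ^ r > 0"
    using r by (simp add: power_strict_mono)
  have "lam + discrete_deriv r ?F (real s ^ r) =
      lam + (?F (real (s + 2) ^ r) - ?F (real s ^ r)) / (real (s + 2) ^ r - real s ^ r)"
    unfolding discrete_deriv_def the Let_def ..
  also have "?F (real (s + 2) ^ r) - ?F (real s ^ r) =
      (ln (w (int s)) - ln (w (int s + 2))) - lam * (real (s + 2) ^ r - real s ^ r)"
    using F[of "s + 2"] F[of s] s by (simp add: algebra_simps)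
  also have "lam + \<dots> / (real (s + 2) ^ r - real s ^ r) =
      (ln (w (int s)) - ln (w (int s + 2))) / (real (s + 2) ^ r - real s ^ r)"
    using a by (simp add: diff_divide_distrib)
  also have "ln (w (int s)) - ln (w (int s + 2)) = ln (w (int s) / w (int s + 2))"
    using pos by (simp add: ln_div)
  finally show ?thesis .
qed

section \<open>Second moment of the signal\<close>

lemma finite_tensor_index: "finite (tensor_index r n)"
  by (induction r) (simp_all add: tensor_index_Suc, simp add: tensor_index_def)

text \<open>Squared entries of v are idempotent, so a squared tensor entry depends only on the set
  of its distinct indices, each costing a factor k/n.\<close>

lemma tensor_second_moment_sum:
  assumes k: "0 \<le> k" "k \<le> real n"
  shows "second_moment (tensor_index r n) (tensor_prior n k) =
    (\<Sum>js\<in>tensor_index r n. (k / real n) ^ card (set js))"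
proof -
  let ?V = "Pi_pmf {..<n} 0 (\<lambda>_. sparse_rademacher n k)"
  have fin: "finite (set_pmf ?V)" by (simp add: finite_set_Pi_pmf finite_set_sparse_rademacher)
  have sq: "(tensor_power v js)\<^sup>2 = (\<Prod>j\<in>{..<n}. if j \<in> set js then (v j)\<^sup>2 else 1)"
    if js: "set js \<subseteq> {..<n}" and v: "v \<in> set_pmf ?V" for js v
  proof -
    have "v j = - 1 \<or> v j = 0 \<or> v j = 1" for j
      using v set_sparse_rademacher[of n k]
      by (cases "j < n") (auto simp: set_Pi_pmf PiE_dflt_def)
    then have "(v j)\<^sup>2 * (v j)\<^sup>2 = (v j)\<^sup>2" for j
    proof -
      assume *: "\<And>j. v j = - 1 \<or> v j = 0 \<or> v j = 1"
      from *[of j] show ?thesis by (elim disjE) simp_all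
    qed
    then have "(\<Prod>j\<leftarrow>js. v j)\<^sup>2 = (\<Prod>j\<in>set js. (v j)\<^sup>2)"
    proof (induction js)
      case (Cons j js)
      show ?case
      proof (cases "j \<in> set js")
        case True
        then have "(\<Prod>i\<in>set js. (v i)\<^sup>2) = (v j)\<^sup>2 * (\<Prod>i\<in>set js - {j}. (v i)\<^sup>2)"
          by (simp add: prod.remove)
        then show ?thesis using Cons True
          by (simp add: power_mult_distrib insert_absorb mult.assoc [symmetric])
      qed (use Cons in \<open>simp add: power_mult_distrib\<close>)
    qed simp
    also have "\<dots> = (\<Prod>j\<in>{..<n}. if j \<in> set js then (v j)\<^sup>2 else 1)"
      using js by (simp add: prod.If_cases Int_absorb1)
    finally show ?thesis by (simp add: tensor_power_def)
  qed
  have E: "measure_pmf.expectation ?V (\<lambda>v. (tensor_power v js)\<^sup>2) = (k / real n) ^ card (set js)"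
    if js: "set js \<subseteq> {..<n}" for js
  proof -
    have "measure_pmf.expectation ?V (\<lambda>v. (tensor_power v js)\<^sup>2) =
        measure_pmf.expectation ?V (\<lambda>v. \<Prod>j\<in>{..<n}. if j \<in> set js then (v j)\<^sup>2 else 1)"
      using sq[OF js] by (intro integral_cong_AE) (auto simp: AE_measure_pmf_iff)
    also have "\<dots> = (\<Prod>j\<in>{..<n}. measure_pmf.expectation (sparse_rademacher n k) (\<lambda>y. if j \<in> set js then y\<^sup>2 else 1))"
      by (rule expectation_prod_Pi_pmf)
         (auto intro: integrable_measure_pmf_finite finite_set_sparse_rademacher)
    also have "\<dots> = (\<Prod>j\<in>{..<n}. if j \<in> set js then k / real n else 1)"
      by (intro prod.cong refl) (simp add: expectation_sparse_rademacher[OF k])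
    also have "\<dots> = (k / real n) ^ card (set js)"
      using js by (simp add: prod.If_cases Int_absorb1)
    finally show ?thesis .
  qed
  have "second_moment (tensor_index r n) (tensor_prior n k) =
      (\<Sum>js\<in>tensor_index r n. measure_pmf.expectation ?V (\<lambda>v. (tensor_power v js)\<^sup>2))"
    unfolding second_moment_def tensor_prior_def
    by (simp add: Bochner_Integration.integral_sum integrable_measure_pmf_finite[OF fin])
  also have "\<dots> = (\<Sum>js\<in>tensor_index r n. (k / real n) ^ card (set js))"
    by (intro sum.cong refl E) (simp add: tensor_index_def)
  finally show ?thesis .
qed

text \<open>A further index either repeats a present one, at no cost, or is new and costs k/n.
  Summed over that index, each term gets multiplied by k plus at most the number of its distinct
  indices.\<close>

lemma tensor_second_moment_Suc:
  assumes k: "0 \<le> k" "k \<le> real n" and n: "n > 0"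
  defines "S \<equiv> \<lambda>r. second_moment (tensor_index r n) (tensor_prior n k)"
  shows "k * S r \<le> S (Suc r) \<and> S (Suc r) \<le> (k + real r) * S r"
proof -
  let ?q = "k / real n"
  have q: "0 \<le> ?q" "?q \<le> 1" using k by (auto simp: divide_le_eq_1)
  have inj: "inj_on (\<lambda>(j, js). j # js) ({..<n} \<times> tensor_index r n)" by (auto simp: inj_on_def)
  have "S (Suc r) = (\<Sum>j<n. \<Sum>js\<in>tensor_index r n. ?q ^ card (insert j (set js)))"
    unfolding S_def tensor_second_moment_sum[OF k] tensor_index_Suc
    by (simp add: sum.reindex[OF inj[unfolded case_prod_unfold]] case_prod_unfold sum.cartesian_product)
  also have "\<dots> = (\<Sum>js\<in>tensor_index r n. \<Sum>j<n. ?q ^ card (insert j (set js)))"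
    by (rule sum.swap)
  also have "\<dots> = (\<Sum>js\<in>tensor_index r n. (k + real (card (set js)) * (1 - ?q)) * ?q ^ card (set js))"
  proof (rule sum.cong)
    fix js assume "js \<in> tensor_index r n"
    then have js: "set js \<subseteq> {..<n}" by (simp add: tensor_index_def)
    have "(\<Sum>j<n. ?q ^ card (insert j (set js))) =
        (\<Sum>j<n. if j \<in> set js then ?q ^ card (set js) else ?q * ?q ^ card (set js))"
      by (intro sum.cong) (auto simp: insert_absorb)
    also have "\<dots> = real (card (set js)) * ?q ^ card (set js) + real (card ({..<n} - set js)) * (?q * ?q ^ card (set js))"
      using js by (simp add: sum.If_cases Int_absorb1 Diff_eq)
    also have "real (card ({..<n} - set js)) = real n - real (card (set js))"
      using js card_mono[OF _ js] by (subst card_Diff_subset) auto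
    also have "real (card (set js)) * ?q ^ card (set js) + (real n - real (card (set js))) * (?q * ?q ^ card (set js)) =
        (k + real (card (set js)) * (1 - ?q)) * ?q ^ card (set js)"
      using n by (simp add: field_simps)
    finally show "(\<Sum>j<n. ?q ^ card (insert j (set js))) = (k + real (card (set js)) * (1 - ?q)) * ?q ^ card (set js)" .
  qed simp
  finally have S: "S (Suc r) = (\<Sum>js\<in>tensor_index r n. (k + real (card (set js)) * (1 - ?q)) * ?q ^ card (set js))" .
  have "k * S r \<le> S (Suc r)"
    unfolding S unfolding S_def tensor_second_moment_sum[OF k] sum_distrib_left
    using q by (intro sum_mono mult_right_mono) auto
  moreover have "S (Suc r) \<le> (k + real r) * S r"
    unfolding S unfolding S_def tensor_second_moment_sum[OF k] sum_distrib_left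
  proof (intro sum_mono mult_right_mono add_left_mono)
    fix js assume "js \<in> tensor_index r n"
    then have "card (set js) \<le> r" using card_length[of js] by (simp add: tensor_index_def)
    then have "real (card (set js)) * (1 - ?q) \<le> real r * 1" using q by (intro mult_mono) auto
    then show "real (card (set js)) * (1 - ?q) \<le> real r" by simp
  qed (use q in auto)
  ultimately show ?thesis ..
qed

lemma tensor_second_moment_bounds:
  assumes k: "0 \<le> k" "k \<le> real n" and n: "n > 0"
  shows "k ^ r \<le> second_moment (tensor_index r n) (tensor_prior n k)"
    "second_moment (tensor_index r n) (tensor_prior n k) \<le> (k + real r) ^ r"
proof -
  define S where "S = (\<lambda>r. second_moment (tensor_index r n) (tensor_prior n k))"
  have S0: "S 0 = 1"
    proof -
    have "tensor_index 0 n = {[]}" by (auto simp: tensor_index_def)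
    then show ?thesis by (simp add: S_def tensor_second_moment_sum[OF k])
  qed
  have *: "k * S r \<le> S (Suc r)" "S (Suc r) \<le> (k + real r) * S r" for r
    using tensor_second_moment_Suc[OF k n, of r] by (simp_all add: S_def)
  have "k ^ r \<le> S r"
  proof (induction r)
    case (Suc r)
    then show ?case using *(1)[of r] mult_left_mono[OF Suc k(1)] by simp
  qed (simp add: S0)
  moreover have "S i \<le> (k + real r) ^ i" if "i \<le> r" for i
    using that
  proof (induction i)
    case (Suc i)
    have "S (Suc i) \<le> (k + real i) * S i" by (rule *)
    also have "\<dots> \<le> (k + real r) * (k + real r) ^ i"
      using Suc k order.trans[OF zero_le_power[OF k(1)], of i "S i"]
      by (intro mult_mono) (auto simp: S_def tensor_second_moment_sum[OF k] intro!: sum_nonneg)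
    finally show ?case by simp
  qed (simp add: S0)
  ultimately show "k ^ r \<le> second_moment (tensor_index r n) (tensor_prior n k)"
    "second_moment (tensor_index r n) (tensor_prior n k) \<le> (k + real r) ^ r"
    by (auto simp: S_def)
qed

section \<open>Bounds for fixed n\<close>

lemma cosh_minus_1_le:
  assumes "0 \<le> x" "x \<le> (1::real)"
  shows "cosh x - 1 \<le> x\<^sup>2"
proof -
  have "exp x \<le> 1 + x + x\<^sup>2" using assms by (rule exp_bound)
  moreover have "exp (- x) \<le> 1 - x + x\<^sup>2"
  proof -
    have "1 + x \<le> exp x" by (rule exp_ge_add_one_self)
    then have "exp (- x) \<le> 1 / (1 + x)"
      using assms by (simp add: exp_minus field_simps)
    also have "1 / (1 + x) \<le> 1 - x + x\<^sup>2"
      using assms by (simp add: field_simps power2_eq_square)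
    finally show ?thesis .
  qed
  ultimately have "(exp x + exp (- x)) / 2 - 1 \<le> x\<^sup>2" by argo
  then show ?thesis by (simp add: cosh_def)
qed

lemma fact_le_bound_power:
  assumes "real m \<le> A"
  shows "fact m \<le> A ^ m"
proof -
  have "fact m \<le> real m ^ m" using fact_le_power[of m, where 'a = real] by simp
  also have "\<dots> \<le> A ^ m" using assms by (intro power_mono) auto
  finally show ?thesis .
qed

lemma geometric_sum_le:
  assumes "0 \<le> x" "x \<le> (1 / 2 :: real)"
  shows "(\<Sum>d\<le>n. x ^ d) \<le> 2"
proof -
  have "(\<Sum>d\<le>n. x ^ d) \<le> (\<Sum>d\<le>n. (1 / 2) ^ d)"
    using assms by (intro sum_mono power_mono) auto
  also have "(\<Sum>d\<le>n. (1 / 2) ^ d) = 2 - (1 / 2 :: real) ^ n"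
    by (induction n) (simp_all add: field_simps)
  also have "\<dots> \<le> 2" by simp
  finally show ?thesis .
qed

text \<open>Up to degree D + 1 the overlap moments are at most 6 A^d with A = (r (D + 1) /
  \<theta>)^r, so both sums of the general bound are dominated by geometric ones of ratio D lam
  A.\<close>

lemma tensor_MMSE_lower_bound:
  assumes k: "0 \<le> k" "k \<le> real n" and r: "r \<ge> 1" and D: "D \<ge> 1" and lam: "lam \<ge> 0"
    and \<theta>: "\<theta> > 0" "real n * (k / real n)\<^sup>2 * (cosh \<theta> - 1) \<le> 1"
    and small: "real D * lam * (real r * (real D + 1) / \<theta>) ^ r \<le> 1 / 100"
  shows "tpca_second_moment r n k - 48 * (real r * (real D + 1) / \<theta>) ^ r \<le> tpca_MMSE r n k D lam"
proof -
  let ?P = "tensor_prior n k" and ?I = "tensor_index r n" and ?p = "(k / real n)\<^sup>2"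
  let ?E = "measure_pmf.expectation (pair_pmf ?P ?P)"
  define A where "A = (real r * (real D + 1) / \<theta>) ^ r"
  have A: "A \<ge> 0" using \<theta> by (simp add: A_def)
  have p: "0 \<le> ?p" "?p \<le> 1"
    using k power_le_one[of "k / real n" 2] by (auto simp: divide_le_eq_1)
  have mom: "?E (\<lambda>(x, x'). overlap ?I x x' ^ d) \<le> 6 * A ^ d" if "d \<le> D + 1" for d
  proof -
    have "?E (\<lambda>(x, x'). overlap ?I x x' ^ d) = walk ?p n (\<lambda>t. t ^ (r * d))"
      using expectation_overlap[OF k, of "\<lambda>w. w ^ d" r] by (simp add: power_mult)
    also have "\<dots> \<le> walk ?p n (\<lambda>t. \<bar>t\<bar> ^ (r * d))"
      by (rule walk_mono[OF p]) (simp add: power_abs [symmetric])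
    also have "\<dots> \<le> 2 * exp 1 * fact (r * d) / \<theta> ^ (r * d)"
      using p \<theta> by (intro walk_moment_bound)
    \<comment> \<open>The 6 comes from exp 1 \<le> 3. The base allows d = D + 1 because the error
      term has one overlap more than powers of lam.\<close>
    also have "\<dots> \<le> 6 * (real r * (real D + 1)) ^ (r * d) / \<theta> ^ (r * d)"
    proof (intro divide_right_mono mult_mono)
      have "real (r * d) \<le> real r * (real D + 1)"
        using that by (simp add: mult_left_mono)
      then show "fact (r * d) \<le> (real r * (real D + 1)) ^ (r * d)"
        by (rule fact_le_bound_power)
    qed (use \<theta> exp_le in auto)
    also have "\<dots> = 6 * A ^ d"
      by (simp add: A_def power_mult [symmetric] power_divide)
    finally show ?thesis .
  qed
  define x where "x = real D * lam * A"
  have x: "0 \<le> x" "x \<le> 1 / 100" using small lam A by (auto simp: x_def A_def)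
  have le: "(\<Sum>d\<le>m. x ^ d) \<le> 2" for m using x by (intro geometric_sum_le) auto
  have "(\<Sum>d=1..D. (real D * lam) ^ d * ?E (\<lambda>(x, x'). overlap ?I x x' ^ d) / fact d) \<le>
      (\<Sum>d=1..D. 6 * x ^ d)"
  proof (rule sum_mono)
    fix d assume "d \<in> {1..D}"
    have "(real D * lam) ^ d * ?E (\<lambda>(x, x'). overlap ?I x x' ^ d) / fact d \<le>
        (real D * lam) ^ d * (6 * A ^ d) / fact d"
      using \<open>d \<in> {1..D}\<close> lam by (intro divide_right_mono mult_left_mono mom) auto
    also have "\<dots> \<le> (real D * lam) ^ d * (6 * A ^ d) / 1"
      using lam A by (intro divide_left_mono mult_nonneg_nonneg) auto
    finally show "(real D * lam) ^ d * ?E (\<lambda>(x, x'). overlap ?I x x' ^ d) / fact d \<le> 6 * x ^ d"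
      by (simp add: x_def power_mult_distrib mult_ac)
  qed
  also have "\<dots> = 6 * x * (\<Sum>d\<le>D - 1. x ^ d)"
  proof -
    have "(\<Sum>d=1..D. x ^ d) = (\<Sum>d\<le>D - 1. x ^ Suc d)"
      using D by (intro sum.reindex_bij_witness[of _ Suc "\<lambda>d. d - 1"]) auto
    also have "\<dots> = x * (\<Sum>d\<le>D - 1. x ^ d)" by (simp add: sum_distrib_left)
    finally show ?thesis by (simp only: sum_distrib_left [symmetric] mult.assoc)
  qed
  also have "\<dots> \<le> 6 * x * 2" using x le by (intro mult_left_mono) auto
  \<comment> \<open>The sum is at most 12/100, just below the contraction threshold. The constant 48
    of the conclusion arises as 4 * 6 * 2.\<close>
  also have "\<dots> \<le> 1 / 8" using x by simp
  finally have "tpca_second_moment r n k - 4 * (\<Sum>d\<le>D. lam ^ d * ?E (\<lambda>(x, x'). overlap ?I x x' ^ Suc d) / fact d)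
      \<le> tpca_MMSE r n k D lam"
    by (intro lowdeg_MMSE_lower_bound finite_tensor_index finite_set_tensor_prior lam D)
  moreover have "(\<Sum>d\<le>D. lam ^ d * ?E (\<lambda>(x, x'). overlap ?I x x' ^ Suc d) / fact d) \<le> (\<Sum>d\<le>D. 6 * A * x ^ d)"
  proof (rule sum_mono)
    fix d assume "d \<in> {..D}"
    have "lam ^ d * ?E (\<lambda>(x, x'). overlap ?I x x' ^ Suc d) / fact d \<le> lam ^ d * (6 * A ^ Suc d) / fact d"
      using \<open>d \<in> {..D}\<close> lam by (intro divide_right_mono mult_left_mono mom) auto
    also have "\<dots> \<le> lam ^ d * (6 * A ^ Suc d) / 1"
      using lam A by (intro divide_left_mono mult_nonneg_nonneg) auto
    also have "\<dots> = 6 * A * (lam * A) ^ d" by (simp add: power_mult_distrib mult_ac)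
    also have "\<dots> \<le> 6 * A * x ^ d"
    proof (intro mult_left_mono power_mono)
      have "1 * (lam * A) \<le> real D * (lam * A)"
        using D lam A by (intro mult_right_mono) auto
      then show "lam * A \<le> x" by (simp add: x_def mult_ac)
    qed (use lam A in auto)
    finally show "lam ^ d * ?E (\<lambda>(x, x'). overlap ?I x x' ^ Suc d) / fact d \<le> 6 * A * x ^ d" .
  qed
  moreover have "(\<Sum>d\<le>D. 6 * A * x ^ d) \<le> 6 * A * 2"
    unfolding sum_distrib_left [symmetric] using A le by (intro mult_left_mono) auto
  ultimately show ?thesis by (simp add: A_def)
qed

section \<open>The slope of the potential at the quantile\<close>

lemma power_diff_bounds:
  fixes x :: real
  assumes "x \<ge> 0"
  shows "2 * (x + 2) ^ r \<le> (x + 2) ^ Suc r - x ^ Suc r"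
    "(x + 2) ^ Suc r - x ^ Suc r \<le> 2 * real (Suc r) * (x + 2) ^ r"
proof -
  have "x * x ^ r \<le> x * (x + 2) ^ r" using assms by (intro mult_left_mono power_mono) auto
  then show "2 * (x + 2) ^ r \<le> (x + 2) ^ Suc r - x ^ Suc r" by (simp add: algebra_simps)
  show "(x + 2) ^ Suc r - x ^ Suc r \<le> 2 * real (Suc r) * (x + 2) ^ r"
  proof (induction r)
    case (Suc r)
    have "(x + 2) ^ Suc (Suc r) - x ^ Suc (Suc r) =
        x * ((x + 2) ^ Suc r - x ^ Suc r) + 2 * (x + 2) ^ Suc r"
      by (simp add: algebra_simps)
    also have "\<dots> \<le> (x + 2) * (2 * real (Suc r) * (x + 2) ^ r) + 2 * (x + 2) ^ Suc r"
    proof -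
      have "x * ((x + 2) ^ Suc r - x ^ Suc r) \<le> x * (2 * real (Suc r) * (x + 2) ^ r)"
        using Suc assms by (intro mult_left_mono) auto
      also have "\<dots> \<le> (x + 2) * (2 * real (Suc r) * (x + 2) ^ r)"
        using assms by (intro mult_right_mono) auto
      finally show ?thesis by simp
    qed
    also have "\<dots> = 2 * real (Suc (Suc r)) * (x + 2) ^ Suc r" by (simp add: algebra_simps)
    finally show ?case .
  qed simp
qed

text \<open>Numerator and denominator are bounded separately. The square in the upper ratio bound
  becomes a factor 2 of the logarithm and cancels the 2 in the lower bound for the step length; the
  lower bound for L pays 2 r.\<close>

lemma log_ratio_slope_bounds:
  assumes k: "0 < k" "k < real n" and p: "(k / real n)\<^sup>2 \<le> 2 / 3" and r: "r \<ge> 1"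
    and s: "2 * (s + 1) \<le> n"
  defines "V \<equiv> k\<^sup>2 / real n" and "w \<equiv> walk_prob ((k / real n)\<^sup>2) n"
  defines "L \<equiv> ln (w (int s) / w (int s + 2)) / (real (s + 2) ^ r - real s ^ r)"
  shows "ln (1 + 2 * (real s + 1) / V) / (2 * real r * (real s + 2) ^ (r - 1)) \<le> L"
    "L \<le> ln (1 + 4 * (real s + 2) / V) / (real s + 2) ^ (r - 1)"
proof -
  have V: "real n * (k / real n)\<^sup>2 = V" "V > 0"
    using k by (auto simp: V_def power2_eq_square)
  have p0: "0 < (k / real n)\<^sup>2" using k by simp
  have pos: "w (int s + 2) > 0"
  proof (cases "s + 2 \<le> n")
    case True
    then show ?thesis
      using walk_prob_pos[of "(k / real n)\<^sup>2" "s + 2" n] p p0 by (simp add: w_def add.commute)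
  next
    case False
    then show ?thesis using s by auto
  qed
  have lo: "(1 + 2 * (real s + 1) / V) * w (int s + 2) \<le> w (int s)"
    using walk_prob_ratio_ge[OF p0 p, of s n] s pos unfolding V w_def by (cases "s + 2 \<le> n") auto
  have hi: "w (int s) \<le> (1 + 4 * (real s + 2) / V)\<^sup>2 * w (int s + 2)"
    using walk_prob_ratio_le[OF p0 p s] unfolding V w_def by simp
  have y: "1 + 2 * (real s + 1) / V > 0" "1 + 4 * (real s + 2) / V > 0"
    using V by (auto intro!: add_pos_nonneg)
  have "1 + 2 * (real s + 1) / V \<le> w (int s) / w (int s + 2)"
    using lo pos by (simp add: le_divide_eq)
  then have lo': "ln (1 + 2 * (real s + 1) / V) \<le> ln (w (int s) / w (int s + 2))"
    and rpos: "w (int s) / w (int s + 2) > 0"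
    using y by (auto intro: ln_mono)
  have "w (int s) / w (int s + 2) \<le> (1 + 4 * (real s + 2) / V)\<^sup>2"
    using hi pos by (simp add: divide_le_eq)
  then have "ln (w (int s) / w (int s + 2)) \<le> ln ((1 + 4 * (real s + 2) / V)\<^sup>2)"
    using rpos by (intro ln_mono) auto
  also have "\<dots> = 2 * ln (1 + 4 * (real s + 2) / V)"
    using y by (simp add: ln_realpow)
  finally have hi': "ln (w (int s) / w (int s + 2)) \<le> 2 * ln (1 + 4 * (real s + 2) / V)" .
  obtain r' where r': "r = Suc r'" using r by (cases r) auto
  define a where "a = real (s + 2) ^ r - real s ^ r"
  have a: "2 * (real s + 2) ^ (r - 1) \<le> a" "a \<le> 2 * real r * (real s + 2) ^ (r - 1)"
    using power_diff_bounds[of "real s" r'] by (auto simp: a_def r' add.commute)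
  have a0: "a > 0" using a(1) by (rule less_le_trans[rotated]) simp
  have l0: "0 \<le> ln (1 + 2 * (real s + 1) / V)" "0 \<le> ln (1 + 4 * (real s + 2) / V)"
    using V by auto
  show "ln (1 + 2 * (real s + 1) / V) / (2 * real r * (real s + 2) ^ (r - 1)) \<le> L"
    unfolding L_def a_def [symmetric] using lo' l0 a a0 by (intro frac_le) auto
  have "L \<le> 2 * ln (1 + 4 * (real s + 2) / V) / (2 * (real s + 2) ^ (r - 1))"
    unfolding L_def a_def [symmetric] using hi' l0 a a0 by (intro frac_le) auto
  then show "L \<le> ln (1 + 4 * (real s + 2) / V) / (real s + 2) ^ (r - 1)" by simp
qed

lemma exp_1_ge_2: "exp (1::real) \<ge> 2"
  using exp_ge_add_one_self[of 1] by simp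

text \<open>Chernoff at (D + 2)/\<theta> bounds s from above, and any level \<open>y\<close> whose
  tail exceeds exp (-D) bounds it from below. The level stays open: half a standard deviation in the
  dense regime, 0 in the sparse one.\<close>

lemma FP_slope:
  fixes D :: nat
  assumes k: "0 < k" "k < real n" and p: "(k / real n)\<^sup>2 \<le> 2 / 3" and r: "r \<ge> 1" and D: "D \<ge> 1"
    and \<theta>: "\<theta> > 0" "real n * (k / real n)\<^sup>2 * (cosh \<theta> - 1) \<le> 1"
    and lower: "0 \<le> y" "walk ((k / real n)\<^sup>2) n (\<lambda>t. of_bool (\<bar>t\<bar> > y)) > exp (- real D)"
    and upper: "2 * ((real D + 2) / \<theta> + 1) \<le> real n"
  defines "V \<equiv> k\<^sup>2 / real n"
  obtains s :: nat and L where "y < real s" "real s \<le> (real D + 2) / \<theta>"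
    "\<And>lam. lam + tpca_FP_deriv r n k D lam = L"
    "ln (1 + 2 * (real s + 1) / V) / (2 * real r * (real s + 2) ^ (r - 1)) \<le> L"
    "L \<le> ln (1 + 4 * (real s + 2) / V) / (real s + 2) ^ (r - 1)"
proof -
  let ?p = "(k / real n)\<^sup>2"
  have p1: "0 \<le> ?p" "?p \<le> 1" using p by auto
  have k': "0 \<le> k" "k \<le> real n" using k by auto
  obtain s :: nat where q: "overlap_quantile (tensor_index r n) (tensor_prior n k) (real D) = real s ^ r"
    and s1: "walk ?p n (\<lambda>t. of_bool (\<bar>t\<bar> > real s)) \<le> exp (- real D)"
    and s2: "\<And>y. y < real s \<Longrightarrow> 0 \<le> y \<Longrightarrow> walk ?p n (\<lambda>t. of_bool (\<bar>t\<bar> > y)) > exp (- real D)"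
    using overlap_quantile_tensor[OF k', of r "real D"] r D by (metis of_nat_0_less_iff less_le_trans zero_less_one)
  have ys: "y < real s"
  proof (rule ccontr)
    assume "\<not> y < real s"
    then have "walk ?p n (\<lambda>t. of_bool (\<bar>t\<bar> > y)) \<le> walk ?p n (\<lambda>t. of_bool (\<bar>t\<bar> > real s))"
      by (intro walk_mono[OF p1]) auto
    then show False using s1 lower by simp
  qed
  have sD: "real s \<le> (real D + 2) / \<theta>"
  proof (rule ccontr)
    assume "\<not> real s \<le> (real D + 2) / \<theta>"
    then have "exp (- real D) < walk ?p n (\<lambda>t. of_bool (\<bar>t\<bar> > (real D + 2) / \<theta>))"
      using \<theta> by (intro s2) auto
    also have "\<dots> \<le> 2 * exp 1 * exp (- \<theta> * ((real D + 2) / \<theta>))"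
      by (rule walk_tail_bound[OF p1 \<theta>])
    also have "\<dots> = 2 * exp 1 * exp (- real D - 2)" using \<theta> by simp
    \<comment> \<open>The surplus 2 in D + 2 absorbs the prefactor of the tail bound.\<close>
    also have "\<dots> \<le> exp 1 * exp 1 * exp (- real D - 2)"
      using exp_1_ge_2 by (intro mult_right_mono) auto
    also have "\<dots> = exp (- real D)" by (simp flip: exp_add)
    finally show False by simp
  qed
  have s0: "0 < s" using ys lower by linarith
  have "2 * (real s + 1) \<le> 2 * ((real D + 2) / \<theta> + 1)"
    using sD by (intro mult_left_mono add_right_mono) auto
  then have "2 * (real s + 1) \<le> real n" using upper by (rule order.trans)
  then have "real (2 * (s + 1)) \<le> real n" by simp
  then have sn: "2 * (s + 1) \<le> n" by (simp only: of_nat_le_iff)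
  have sn': "s + 2 \<le> n" using sn s0 by simp
  define L where "L = ln (walk_prob ?p n (int s) / walk_prob ?p n (int s + 2)) / (real (s + 2) ^ r - real s ^ r)"
  have "lam + tpca_FP_deriv r n k D lam = L" for lam
    unfolding q L_def using FP_derivative_tensor[OF k _ s0 sn', of r lam] r by simp
  with ys sD log_ratio_slope_bounds[OF k p r sn] show ?thesis
    by (intro that[of s L]) (auto simp: V_def L_def)
qed

section \<open>Soft asymptotics\<close>

lemma eventually_ln_ge: "\<forall>\<^sub>F n in sequentially. C \<le> ln (real n)"
proof -
  have "filterlim (\<lambda>n. ln (real n)) at_top sequentially" by real_asymp
  then show ?thesis by (simp add: filterlim_at_top)
qed

lemma soft_OI:
  assumes "\<forall>\<^sub>F n in sequentially. \<bar>f n\<bar> \<le> C * ln (real n) ^ c * \<bar>g n\<bar>"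
  shows "f \<in> soft_O g"
proof -
  have "f \<in> O(\<lambda>n. ln (real n) ^ c * g n)"
  proof (rule bigoI[where c = C])
    show "\<forall>\<^sub>F n in sequentially. norm (f n) \<le> C * norm (ln (real n) ^ c * g n)"
      using assms eventually_ln_ge[of 0]
      by eventually_elim (simp add: abs_mult power_abs mult_ac)
  qed
  then show ?thesis by (auto simp: soft_O_def)
qed

lemma soft_O_trans:
  assumes "f \<in> soft_O g" "g \<in> soft_O h"
  shows "f \<in> soft_O h"
proof -
  from assms obtain c d where *: "f \<in> O(\<lambda>n. ln (real n) ^ c * g n)" "g \<in> O(\<lambda>n. ln (real n) ^ d * h n)"
    by (auto simp: soft_O_def)
  have "(\<lambda>n. ln (real n) ^ c * g n) \<in> O(\<lambda>n. ln (real n) ^ c * (ln (real n) ^ d * h n))"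
    by (intro landau_o.big.mult *) simp
  with *(1) have "f \<in> O(\<lambda>n. ln (real n) ^ c * (ln (real n) ^ d * h n))"
    by (rule landau_o.big_trans)
  then have "f \<in> O(\<lambda>n. ln (real n) ^ (c + d) * h n)"
    by (simp add: power_add mult.assoc)
  then show ?thesis by (auto simp: soft_O_def)
qed

lemma soft_Theta_sym: "f \<in> soft_Theta g \<Longrightarrow> g \<in> soft_Theta f"
  by (simp add: soft_Theta_def)

lemma soft_Theta_trans: "f \<in> soft_Theta g \<Longrightarrow> g \<in> soft_Theta h \<Longrightarrow> f \<in> soft_Theta h"
  by (auto simp: soft_Theta_def intro: soft_O_trans)

lemma soft_Theta_cong:
  assumes "\<forall>\<^sub>F n in sequentially. f n = g n"
  shows "f \<in> soft_Theta g"
  unfolding soft_Theta_def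
  using assms by (auto intro!: soft_OI[where C = 1 and c = 0] elim: eventually_mono)

lemma soft_ThetaI:
  assumes "\<forall>\<^sub>F n in sequentially. \<bar>f n\<bar> \<le> C * ln (real n) ^ c * \<bar>g n\<bar>"
    "\<forall>\<^sub>F n in sequentially. \<bar>g n\<bar> \<le> C' * ln (real n) ^ c' * \<bar>f n\<bar>"
  shows "f \<in> soft_Theta g"
  using assms by (auto simp: soft_Theta_def intro: soft_OI)

lemma soft_Theta_mult:
  assumes "f \<in> soft_Theta g" "f' \<in> soft_Theta g'"
  shows "(\<lambda>n. f n * f' n) \<in> soft_Theta (\<lambda>n. g n * g' n)"
proof -
  have *: "(\<lambda>n. f n * f' n) \<in> soft_O (\<lambda>n. g n * g' n)"
    if "f \<in> soft_O g" "f' \<in> soft_O g'" for f f' g g' :: "nat \<Rightarrow> real"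
  proof -
    from that obtain c d where "f \<in> O(\<lambda>n. ln (real n) ^ c * g n)" "f' \<in> O(\<lambda>n. ln (real n) ^ d * g' n)"
      by (auto simp: soft_O_def)
    then have "(\<lambda>n. f n * f' n) \<in> O(\<lambda>n. (ln (real n) ^ c * g n) * (ln (real n) ^ d * g' n))"
      by (rule landau_o.big.mult)
    then have "(\<lambda>n. f n * f' n) \<in> O(\<lambda>n. ln (real n) ^ (c + d) * (g n * g' n))"
      by (simp add: power_add mult_ac)
    then show ?thesis by (auto simp: soft_O_def)
  qed
  from assms show ?thesis by (auto simp: soft_Theta_def intro: *)
qed

text \<open>Both M and T are squeezed between S - B and S, hence equivalent to K. The error is taken
  to be S - M, so the exact equality holds by definition and the error lies between 0 and B.\<close>

lemma MMSE_expansionI: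
  assumes b: "\<forall>\<^sub>F n in sequentially. S n - B n \<le> M n \<and> M n \<le> T n \<and> T n \<le> S n \<and> K n \<le> S n \<and> K n > 0"
    and SK: "(\<lambda>n. S n / K n) \<longlonglongrightarrow> 1" and BK: "(\<lambda>n. B n / K n) \<longlonglongrightarrow> 0" and Bg: "B \<in> soft_O g"
  shows "MMSE_expansion M S K T g" "asymp_at_least M T"
proof -
  have lim: "(\<lambda>n. M n / K n) \<longlonglongrightarrow> 1" "(\<lambda>n. T n / K n) \<longlonglongrightarrow> 1"
  proof -
    have l: "(\<lambda>n. S n / K n - B n / K n) \<longlonglongrightarrow> 1" using tendsto_diff[OF SK BK] by simp
    show "(\<lambda>n. M n / K n) \<longlonglongrightarrow> 1"
      by (rule tendsto_sandwich[OF _ _ l SK])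
         (use b in eventually_elim, simp add: divide_right_mono flip: diff_divide_distrib)+
    show "(\<lambda>n. T n / K n) \<longlonglongrightarrow> 1"
      by (rule tendsto_sandwich[OF _ _ l SK])
         (use b in eventually_elim, simp add: divide_right_mono flip: diff_divide_distrib)+
  qed
  have Kpos: "\<forall>\<^sub>F n in sequentially. K n > 0" using b by eventually_elim simp
  have equiv: "f \<sim>[sequentially] K" if "(\<lambda>n. f n / K n) \<longlonglongrightarrow> 1" for f
    using that by (intro asymp_equivI') 
  have MT: "M \<sim>[sequentially] T"
    using equiv[OF lim(1)] equiv[OF lim(2)] by (metis asymp_equiv_sym asymp_equiv_trans)
  define err where "err = (\<lambda>n. S n - M n)"
  have "(\<lambda>n. S n / K n - M n / K n) \<longlonglongrightarrow> 0" using tendsto_diff[OF SK lim(1)] by simp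
  then have e0: "(\<lambda>n. err n / K n) \<longlonglongrightarrow> 0" by (simp add: err_def diff_divide_distrib)
  have e1: "(\<lambda>n. 1 - err n / K n) \<longlonglongrightarrow> 1" using tendsto_diff[OF tendsto_const[of 1] e0] by simp
  have "\<forall>\<^sub>F n in sequentially. 1 - err n / K n = (K n - err n) / K n"
    using Kpos by eventually_elim (simp add: diff_divide_distrib)
  with e1 have "(\<lambda>n. (K n - err n) / K n) \<longlonglongrightarrow> 1" by (rule Lim_transform_eventually)
  then have KT: "(\<lambda>n. K n - err n) \<sim>[sequentially] T"
    using equiv[of "\<lambda>n. K n - err n"] equiv[OF lim(2)] by (metis asymp_equiv_sym asymp_equiv_trans)
  have "err \<in> soft_O B"
    by (rule soft_OI[where C = 1 and c = 0]) (use b in eventually_elim, simp add: err_def)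
  then have "err \<in> soft_O g" using Bg by (rule soft_O_trans)
  moreover have "\<forall>\<^sub>F n in sequentially. 0 \<le> err n \<and> M n = S n - err n \<and> M n \<ge> K n - err n"
    using b by eventually_elim (simp add: err_def)
  ultimately show "MMSE_expansion M S K T g"
    using KT MT unfolding MMSE_expansion_def by blast
  \<comment> \<open>The witness \<delta> is M / T - 1, written through the ratios to K whose limits
    are known.\<close>
  have "(\<lambda>n. M n / K n / (T n / K n)) \<longlonglongrightarrow> 1 / 1"
    using lim by (intro tendsto_divide) auto
  then have "(\<lambda>n. M n / K n / (T n / K n) - 1) \<longlonglongrightarrow> 0"
    using tendsto_diff[OF _ tendsto_const[of 1]] by fastforce
  moreover have "\<forall>\<^sub>F n in sequentially. M n \<ge> (1 + (M n / K n / (T n / K n) - 1)) * T n"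
  proof -
    have "\<forall>\<^sub>F n in sequentially. 0 < T n / K n"
      using order_tendstoD(1)[OF lim(2), of 0] by simp
    then show ?thesis using Kpos by eventually_elim (simp add: zero_less_divide_iff)
  qed
  ultimately show "asymp_at_least M T" unfolding asymp_at_least_def by blast
qed

text \<open>The sum of x and its derivative is L n for every x, so the given lam drops out. At x = L
  n the derivative vanishes, which supplies \<open>lam'\<close>; the witness \<open>\<mu>\<close> is
  \<open>pref * L\<close>.\<close>

lemma expansion_from_slope:
  fixes FP MM :: "nat \<Rightarrow> real \<Rightarrow> real"
  assumes L: "\<forall>\<^sub>F n in sequentially. \<forall>x. x + FP n x = L n"
    and Lpos: "\<forall>\<^sub>F n in sequentially. L n > 0"
    and Lh: "L \<in> soft_Theta h" and alg: "lamALG \<in> soft_Theta h"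
    and pref: "pref \<in> soft_Theta (\<lambda>_. 1)" "\<forall>\<^sub>F n in sequentially. pref n > 0"
    and b: "\<forall>\<^sub>F n in sequentially. S n - B n \<le> MM n (pref n * L n) \<and> MM n (pref n * L n) \<le> T n
      \<and> T n \<le> S n \<and> K n \<le> S n \<and> K n > 0"
    and SK: "(\<lambda>n. S n / K n) \<longlonglongrightarrow> 1" and BK: "(\<lambda>n. B n / K n) \<longlonglongrightarrow> 0" and Bg: "B \<in> soft_O g"
  shows "MMSE_expansion (\<lambda>n. MM n (pref n * (lam n + FP n (lam n)))) S K T g
    \<and> (\<exists>lam'. (\<forall>n. lam' n > 0) \<and> lam' \<in> soft_Theta h \<and> lam' \<in> soft_Theta lamALG
        \<and> (\<forall>\<^sub>F n in sequentially. FP n (lam' n) \<ge> 0))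
    \<and> (\<exists>\<mu>. (\<forall>n. \<mu> n > 0) \<and> \<mu> \<in> soft_Theta lamALG \<and> asymp_at_least (\<lambda>n. MM n (\<mu> n)) T)"
proof (intro conjI)
  show "MMSE_expansion (\<lambda>n. MM n (pref n * (lam n + FP n (lam n)))) S K T g"
  proof (rule MMSE_expansionI(1)[OF _ SK BK Bg])
    show "\<forall>\<^sub>F n in sequentially. S n - B n \<le> MM n (pref n * (lam n + FP n (lam n))) \<and>
        MM n (pref n * (lam n + FP n (lam n))) \<le> T n \<and> T n \<le> S n \<and> K n \<le> S n \<and> K n > 0"
      using b L by eventually_elim simp
  qed
  \<comment> \<open>Positivity is claimed at every n but known only eventually; the exceptional
    values are replaced by 1.\<close>
  have pos: "\<exists>f'. (\<forall>n. f' n > 0) \<and> (\<forall>\<^sub>F n in sequentially. f' n = f n)"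
    if "\<forall>\<^sub>F n in sequentially. f n > 0" for f :: "nat \<Rightarrow> real"
    using that by (intro exI[of _ "\<lambda>n. if f n > 0 then f n else 1"]) (auto elim: eventually_mono)
  from pos[OF Lpos] obtain lam' where lam': "\<forall>n. lam' n > 0" "\<forall>\<^sub>F n in sequentially. lam' n = L n"
    by blast
  have h: "lam' \<in> soft_Theta h" using soft_Theta_cong[OF lam'(2)] Lh by (rule soft_Theta_trans)
  have "\<forall>\<^sub>F n in sequentially. FP n (lam' n) \<ge> 0"
    using lam'(2) L
  proof eventually_elim
    case (elim n)
    from elim(2) have "lam' n + FP n (lam' n) = L n" by blast
    then show ?case using elim(1) by simp
  qed
  with lam'(1) h alg show "\<exists>lam'. (\<forall>n. lam' n > 0) \<and> lam' \<in> soft_Theta h \<and> lam' \<in> soft_Theta lamALG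
      \<and> (\<forall>\<^sub>F n in sequentially. FP n (lam' n) \<ge> 0)"
    by (blast intro: soft_Theta_trans soft_Theta_sym)
  have "\<forall>\<^sub>F n in sequentially. pref n * L n > 0" using pref(2) Lpos by eventually_elim simp
  from pos[OF this] obtain \<mu> where \<mu>: "\<forall>n. \<mu> n > 0" "\<forall>\<^sub>F n in sequentially. \<mu> n = pref n * L n"
    by blast
  have "(\<lambda>n. pref n * L n) \<in> soft_Theta h" using soft_Theta_mult[OF pref(1) Lh] by simp
  with soft_Theta_cong[OF \<mu>(2)] have "\<mu> \<in> soft_Theta h" by (rule soft_Theta_trans)
  moreover have "asymp_at_least (\<lambda>n. MM n (\<mu> n)) T"
  proof (rule MMSE_expansionI(2)[OF _ SK BK Bg])
    show "\<forall>\<^sub>F n in sequentially. S n - B n \<le> MM n (\<mu> n) \<and> MM n (\<mu> n) \<le> T n \<and> T n \<le> S n \<and> K n \<le> S n \<and> K n > 0"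
      using b \<mu>(2) by eventually_elim simp
  qed
  ultimately show "\<exists>\<mu>. (\<forall>n. \<mu> n > 0) \<and> \<mu> \<in> soft_Theta lamALG \<and> asymp_at_least (\<lambda>n. MM n (\<mu> n)) T"
    using \<mu>(1) alg by (blast intro: soft_Theta_trans soft_Theta_sym)
qed

lemma trivial_MMSE_le_second_moment: "trivial_MMSE I P \<le> second_moment I P"
  by (simp add: trivial_MMSE_def sum_nonneg)

section \<open>Growth of the degree cutoff and of the sparsity\<close>

lemma degree_cutoff_bounds:
  assumes \<beta>: "0 < \<beta>" "\<beta> < 1"
  shows "\<forall>\<^sub>F n in sequentially. (1 - \<beta>) * ln (real n) - 1 \<le> real (degree_cutoff \<beta> n) \<and>
     real (degree_cutoff \<beta> n) \<le> ln (real n) \<and> 4 \<le> degree_cutoff \<beta> n"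
  using eventually_ln_ge[of "4 / (1 - \<beta>)"] eventually_ln_ge[of 0]
proof eventually_elim
  case (elim n)
  then have 4: "4 \<le> (1 - \<beta>) * ln (real n)" using \<beta> by (simp add: field_simps)
  have "(1 - \<beta>) * ln (real n) \<le> 1 * ln (real n)" using \<beta> elim by (intro mult_right_mono) auto
  then show ?case using 4 unfolding degree_cutoff_def by (auto, linarith+)
qed

context
  fixes \<beta> :: real and k \<epsilon> :: "nat \<Rightarrow> real"
  assumes eps: "\<epsilon> \<longlonglongrightarrow> 0"
    and k: "\<forall>\<^sub>F n in sequentially. k n = real n powr (\<beta> + \<epsilon> n)"
    and \<beta>: "0 < \<beta>" "\<beta> < 1"
begin

lemma k_bounds:
  assumes e: "e > 0"
  shows "\<forall>\<^sub>F n in sequentially. real n powr (\<beta> - e) \<le> k n \<and> k n \<le> real n powr (\<beta> + e)"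
proof -
  have "\<forall>\<^sub>F n in sequentially. \<bar>\<epsilon> n\<bar> < e"
    using tendstoD[OF eps e] by (simp add: dist_real_def)
  with k eventually_gt_at_top[of 1] show ?thesis
    by eventually_elim (auto intro!: powr_mono)
qed

lemma k_filterlim: "filterlim k at_top sequentially"
proof (rule filterlim_at_top_mono)
  show "filterlim (\<lambda>n. real n powr (\<beta> / 2)) at_top sequentially" using \<beta> by real_asymp
  show "\<forall>\<^sub>F n in sequentially. real n powr (\<beta> / 2) \<le> k n"
    using k_bounds[of "\<beta> / 2"] \<beta> by simp (auto elim: eventually_mono)
qed

lemma k_less: "\<forall>\<^sub>F n in sequentially. 0 < k n \<and> k n < real n \<and> (k n / real n)\<^sup>2 \<le> 2 / 3"
proof -
  \<comment> \<open>Half the gap between \<beta> and 1 gives k \<le> n^(1 - d), hence eventually k <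
    n/2. The step probability is then at most 1/4, within the range where the walk is
    unimodal.\<close>
  define d where "d = (1 - \<beta>) / 2"
  have d: "d > 0" "\<beta> + (1 - \<beta>) / 2 = 1 - d" using \<beta> by (auto simp: d_def field_simps)
  have "filterlim (\<lambda>n. real n powr d) at_top sequentially" using d(1) by real_asymp
  then have "\<forall>\<^sub>F n in sequentially. 2 < real n powr d"
    by (simp add: filterlim_at_top_dense)
  then have "\<forall>\<^sub>F n in sequentially. real n powr (\<beta> + (1 - \<beta>) / 2) < 1 / 2 * real n"
    using eventually_gt_at_top[of 0] by eventually_elim (simp add: d powr_diff divide_less_eq)
  moreover have "(1 - \<beta>) / 2 > 0" using \<beta> by simp
  note k_bounds[OF this]
  ultimately have "\<forall>\<^sub>F n in sequentially. 0 < k n \<and> k n < 1 / 2 * real n"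
    using k eventually_gt_at_top[of 0] by eventually_elim auto
  with eventually_gt_at_top[of 0] show ?thesis
  proof eventually_elim
    case (elim n)
    then have "k n / real n \<le> 1 / 2" "0 \<le> k n / real n" by (auto simp: divide_le_eq)
    then have "(k n / real n)\<^sup>2 \<le> (1 / 2)\<^sup>2" by (rule power_mono)
    also have "\<dots> \<le> 2 / 3" by (simp add: power2_eq_square)
    finally show ?case using elim by simp
  qed
qed

text \<open>The ratio lies between 1 and (1 + r/k)^r, and k tends to infinity.\<close>

lemma second_moment_ratio: "(\<lambda>n. tpca_second_moment r n (k n) / k n ^ r) \<longlonglongrightarrow> 1"
proof (rule tendsto_sandwich[of "\<lambda>_. 1" _ _ "\<lambda>n. (1 + real r * inverse (k n)) ^ r"])
  have "(\<lambda>n. (1 + real r * inverse (k n)) ^ r) \<longlonglongrightarrow> (1 + real r * 0) ^ r"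
    by (intro tendsto_intros tendsto_inverse_0_at_top k_filterlim)
  then show "(\<lambda>n. (1 + real r * inverse (k n)) ^ r) \<longlonglongrightarrow> 1" by simp
  show "\<forall>\<^sub>F n in sequentially. 1 \<le> tpca_second_moment r n (k n) / k n ^ r"
    using k_less eventually_gt_at_top[of 0]
    by eventually_elim (simp add: le_divide_eq tensor_second_moment_bounds)
  show "\<forall>\<^sub>F n in sequentially. tpca_second_moment r n (k n) / k n ^ r \<le> (1 + real r * inverse (k n)) ^ r"
    using k_less eventually_gt_at_top[of 0]
  proof eventually_elim
    case (elim n)
    then have "tpca_second_moment r n (k n) \<le> (k n + real r) ^ r"
      by (intro tensor_second_moment_bounds) auto
    also have "k n + real r = k n * (1 + real r * inverse (k n))" using elim by (simp add: field_simps)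
    finally show ?case using elim by (simp add: power_mult_distrib divide_le_eq mult.commute)
  qed
qed simp

end

text \<open>Here \<sigma> is the standard deviation of the walk, and the quantile s lies between
  \<sigma>/2 and \<sigma> (D + 2). The log-ratio over two sites is comparable to s / \<sigma>^2 and
  the step length to s^(r-1), so the slope is \<sigma>^(-r) up to powers of D.\<close>

lemma slope_dense:
  fixes D :: nat
  assumes k: "0 < k" "k < real n" and p: "(k / real n)\<^sup>2 \<le> 2 / 3" and r: "r \<ge> 2" and D: "D \<ge> 4"
    and \<sigma>: "\<sigma> = k / sqrt (real n)" "\<sigma> \<ge> 2" and n: "2 * (\<sigma> * (real D + 2) + 1) \<le> real n"
  obtains L where "\<And>lam. lam + tpca_FP_deriv r n k D lam = L"
    "1 / (4 * real r * (real D + 4) ^ (r - 1)) / \<sigma> ^ r \<le> L" "L \<le> 2 ^ r / \<sigma> ^ r"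
    "real n * (k / real n)\<^sup>2 * (cosh (1 / \<sigma>) - 1) \<le> 1"
proof -
  let ?p = "(k / real n)\<^sup>2"
  have n0: "real n > 0" using k by simp
  have V: "real n * ?p = \<sigma>\<^sup>2" "k\<^sup>2 / real n = \<sigma>\<^sup>2"
    using n0 by (auto simp: \<sigma>(1) power_divide power2_eq_square[of "real n"])
  have p1: "0 \<le> ?p" "?p \<le> 1" using p by auto
  have "cosh (1 / \<sigma>) - 1 \<le> (1 / \<sigma>)\<^sup>2" using \<sigma>(2) by (intro cosh_minus_1_le) auto
  then have "\<sigma>\<^sup>2 * (cosh (1 / \<sigma>) - 1) \<le> \<sigma>\<^sup>2 * (1 / \<sigma>)\<^sup>2" by (intro mult_left_mono) auto
  then have ch: "real n * ?p * (cosh (1 / \<sigma>) - 1) \<le> 1"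
    unfolding V using \<sigma>(2) by (simp add: power_divide)
  define Q where "Q = walk ?p n (\<lambda>t. of_bool (\<bar>t\<bar> > \<sigma> / 2))"
  \<comment> \<open>With y = \<sigma>/2 and a = 1/(8 \<sigma>^2) the first two terms on the right
    stay, for \<sigma> \<ge> 2, a fixed fraction below \<sigma>^2, which leaves a tail of at least
    1/8.\<close>
  have "real n * ?p \<le> (\<sigma> / 2)\<^sup>2 + 1 / (8 * \<sigma>\<^sup>2) * (3 * (real n * ?p)\<^sup>2 + real n * ?p) + Q / (4 * (1 / (8 * \<sigma>\<^sup>2)))"
    unfolding Q_def using \<sigma>(2) by (intro walk_paley_zygmund[OF p1]) auto
  then have "\<sigma>\<^sup>2 \<le> \<sigma>\<^sup>2 / 4 + (3 * \<sigma>\<^sup>2 + 1) / 8 + 2 * \<sigma>\<^sup>2 * Q"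
  proof -
    have e: "1 / (8 * W) * (3 * W\<^sup>2 + W) = (3 * W + 1) / 8" "Q / (4 * (1 / (8 * W))) = 2 * W * Q"
      if "W > 0" for W :: real
      using that by (simp_all add: field_simps power2_eq_square)
    have "\<sigma>\<^sup>2 > 0" using \<sigma>(2) by simp
    assume "real n * ?p \<le> (\<sigma> / 2)\<^sup>2 + 1 / (8 * \<sigma>\<^sup>2) * (3 * (real n * ?p)\<^sup>2 + real n * ?p) + Q / (4 * (1 / (8 * \<sigma>\<^sup>2)))"
    then show ?thesis unfolding V e[OF \<open>\<sigma>\<^sup>2 > 0\<close>] by (simp add: power_divide)
  qed
  moreover have "2\<^sup>2 \<le> \<sigma>\<^sup>2" using \<sigma>(2) by (intro power_mono) auto
  ultimately have "\<sigma>\<^sup>2 * (1 / 8) \<le> \<sigma>\<^sup>2 * Q" by (simp add: field_simps)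
  then have Q: "1 / 8 \<le> Q" using \<sigma>(2) by simp
  \<comment> \<open>D \<ge> 4 makes exp (-D) at most 1/16, below the tail 1/8.\<close>
  have "exp (- real D) \<le> exp (- (4 * 1))" using D by simp
  also have "\<dots> = inverse (exp 1 ^ 4)" by (simp add: exp_minus flip: exp_of_nat_mult)
  also have "\<dots> \<le> inverse (2 ^ 4)"
    using exp_1_ge_2 by (intro le_imp_inverse_le power_mono) auto
  also have "\<dots> < Q" using Q by simp
  finally have Q': "Q > exp (- real D)" .
  have n': "2 * ((real D + 2) / (1 / \<sigma>) + 1) \<le> real n" using n by (simp add: mult.commute)
  have r1: "r \<ge> 1" "D \<ge> 1" "1 / \<sigma> > 0" "0 \<le> \<sigma> / 2" using r D \<sigma>(2) by auto
  obtain s L where s: "\<sigma> / 2 < real s" "real s \<le> (real D + 2) / (1 / \<sigma>)"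
    and L: "\<And>lam. lam + tpca_FP_deriv r n k D lam = L"
      "ln (1 + 2 * (real s + 1) / \<sigma>\<^sup>2) / (2 * real r * (real s + 2) ^ (r - 1)) \<le> L"
      "L \<le> ln (1 + 4 * (real s + 2) / \<sigma>\<^sup>2) / (real s + 2) ^ (r - 1)"
    using FP_slope[OF k p r1(1-3) ch r1(4) Q'[unfolded Q_def] n'] unfolding V by blast
  have sD: "real s + 2 \<le> \<sigma> * (real D + 4)"
  proof -
    have "real s \<le> \<sigma> * (real D + 2)" using s(2) by (simp add: mult.commute)
    then show ?thesis using \<sigma>(2) by (simp add: algebra_simps)
  qed
  obtain r' where r': "r = Suc (Suc r')" using r by (metis One_nat_def Suc_1 Suc_le_D Suc_le_mono)
  \<comment> \<open>The inequality x - x^2 \<ge> x/2 at x = 1/\<sigma> \<le> 1/2.\<close>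
  have "1 / (2 * \<sigma>) \<le> 1 / \<sigma> - (1 / \<sigma>)\<^sup>2"
    using \<sigma>(2) by (simp add: field_simps power2_eq_square)
  also have "\<dots> \<le> ln (1 + 1 / \<sigma>)" using \<sigma>(2) by (intro ln_one_plus_pos_lower_bound) auto
  also have "\<dots> \<le> ln (1 + 2 * (real s + 1) / \<sigma>\<^sup>2)"
  proof (rule ln_mono)
    have "\<sigma> / \<sigma>\<^sup>2 \<le> 2 * (real s + 1) / \<sigma>\<^sup>2" using s(1) by (intro divide_right_mono) auto
    then show "1 + 1 / \<sigma> \<le> 1 + 2 * (real s + 1) / \<sigma>\<^sup>2"
      using \<sigma>(2) by (simp add: power2_eq_square)
  qed (use \<sigma>(2) in \<open>auto intro!: add_pos_nonneg\<close>)
  finally have "1 / (2 * \<sigma>) / (2 * real r * (\<sigma> * (real D + 4)) ^ (r - 1)) \<le>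
      ln (1 + 2 * (real s + 1) / \<sigma>\<^sup>2) / (2 * real r * (real s + 2) ^ (r - 1))"
    using \<sigma>(2) sD r by (intro frac_le mult_left_mono power_mono) auto
  also have "\<dots> \<le> L" by (rule L)
  finally have "1 / (2 * \<sigma>) / (2 * real r * (\<sigma> * (real D + 4)) ^ (r - 1)) \<le> L" .
  have lo: "1 / (4 * real r * (real D + 4) ^ (r - 1)) / \<sigma> ^ r \<le> L"
  proof -
    have sr: "\<sigma> ^ r = \<sigma> * \<sigma> ^ (r - 1)" by (simp add: r')
    have "2 * \<sigma> * (2 * R * (S * A)) = 4 * R * A * (\<sigma> * S)" for R S A :: real by simp
    then have "1 / (2 * \<sigma>) / (2 * real r * (\<sigma> * (real D + 4)) ^ (r - 1)) =
        1 / (4 * real r * (real D + 4) ^ (r - 1)) / \<sigma> ^ r"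
      by (simp only: sr power_mult_distrib divide_divide_eq_left)
    then show ?thesis using \<open>1 / (2 * \<sigma>) / (2 * real r * (\<sigma> * (real D + 4)) ^ (r - 1)) \<le> L\<close> by (simp only:)
  qed
  have "L \<le> ln (1 + 4 * (real s + 2) / \<sigma>\<^sup>2) / (real s + 2) ^ (r - 1)" by (rule L)
  also have "\<dots> \<le> 4 * (real s + 2) / \<sigma>\<^sup>2 / (real s + 2) ^ (r - 1)"
    using \<sigma>(2) by (intro divide_right_mono ln_add_one_self_le_self) auto
  \<comment> \<open>One factor s + 2 cancels against the step length; since r \<ge> 2, the power r -
    2 that remains is bounded below through s > \<sigma>/2.\<close>
  also have "\<dots> = 4 / (\<sigma>\<^sup>2 * (real s + 2) ^ r')"
  proof -
    have "4 * u / W / (u * A) = 4 / (W * A)" if "u \<noteq> 0" for u W A :: real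
      using that by simp
    moreover have "real s + 2 \<noteq> 0" by linarith
    ultimately show ?thesis by (simp only: r' diff_Suc_1 power_Suc)
  qed
  also have "\<dots> \<le> 4 / (\<sigma>\<^sup>2 * (\<sigma> / 2) ^ r')"
    using \<sigma>(2) s(1) by (intro divide_left_mono mult_left_mono power_mono mult_pos_pos) auto
  also have "\<dots> = 2 ^ r / \<sigma> ^ r" by (simp add: r' power_divide power2_eq_square mult_ac)
  finally show ?thesis using L(1) lo ch by (intro that[of L])
qed

text \<open>The variance V is below 1, and \<theta> = - ln V is admissible because V cosh \<theta>
  \<le> V exp \<theta> = 1. Hence s \<le> C, so the slope is bounded below and at most logarithmic
  in 1/V.\<close>

lemma slope_sparse:
  fixes D :: nat
  assumes k: "0 < k" "k < real n" and p: "(k / real n)\<^sup>2 \<le> 2 / 3" and r: "r \<ge> 1" and D: "D \<ge> 1"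
    and V: "V = k\<^sup>2 / real n" "V < 1" "4 * exp (- real D) < V"
    and C: "(real D + 2) / (- ln V) \<le> C" and n: "2 * (C + 1) \<le> real n"
  obtains L where "\<And>lam. lam + tpca_FP_deriv r n k D lam = L"
    "1 / (2 * real r * (C + 2) ^ (r - 1)) \<le> L" "L \<le> ln (9 + 4 * C) - ln V"
    "real n * (k / real n)\<^sup>2 * (cosh (- ln V) - 1) \<le> 1" "- ln V > 0" "C \<ge> 0"
proof -
  let ?p = "(k / real n)\<^sup>2"
  have n0: "real n > 0" using k by simp
  have Vp: "real n * ?p = V" and V0: "V > 0"
    using k by (auto simp: V(1) power_divide power2_eq_square)
  have p1: "0 \<le> ?p" "?p \<le> 1" using p by auto
  have \<theta>: "- ln V > 0" using V0 V(2) by simp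
  have C0: "C \<ge> 0" using C \<theta> by (meson add_nonneg_nonneg divide_nonneg_pos of_nat_0_le_iff order.trans zero_le_numeral)
  have "cosh (- ln V) \<le> exp (- ln V)" using \<theta> V0 V(2) one_le_inverse[of V] by (simp add: cosh_def exp_minus)
  then have "V * (cosh (- ln V) - 1) \<le> V * exp (- ln V)" using V0 by (intro mult_left_mono) auto
  also have "\<dots> = 1" using V0 by (simp add: exp_minus)
  finally have ch: "real n * ?p * (cosh (- ln V) - 1) \<le> 1" unfolding Vp .
  define Q where "Q = walk ?p n (\<lambda>t. of_bool (\<bar>t\<bar> > 0))"
  \<comment> \<open>With y = 0, the choice a = 1/8 and V^2 \<le> V give Q \<ge> V/4; the assumption
    4 exp (-D) < V thus forces s > 0.\<close>
  have "real n * ?p \<le> 0\<^sup>2 + 1 / 8 * (3 * (real n * ?p)\<^sup>2 + real n * ?p) + Q / (4 * (1 / 8))"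
    unfolding Q_def by (intro walk_paley_zygmund[OF p1]) auto
  then have "V \<le> (3 * V\<^sup>2 + V) / 8 + 2 * Q" unfolding Vp by simp
  moreover have "V\<^sup>2 \<le> V" using V0 V(2) by (simp add: power2_eq_square)
  ultimately have "V / 4 \<le> Q" by (simp add: field_simps)
  then have Q: "Q > exp (- real D)" using V(3) by simp
  have n': "2 * ((real D + 2) / (- ln V) + 1) \<le> real n"
    by (rule order.trans[OF _ n]) (intro mult_left_mono add_right_mono C, simp)
  obtain s L where s: "0 < real s" "real s \<le> (real D + 2) / (- ln V)"
    and L: "\<And>lam. lam + tpca_FP_deriv r n k D lam = L"
      "ln (1 + 2 * (real s + 1) / V) / (2 * real r * (real s + 2) ^ (r - 1)) \<le> L"
      "L \<le> ln (1 + 4 * (real s + 2) / V) / (real s + 2) ^ (r - 1)"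
    using FP_slope[OF k p r D \<theta> ch order_refl Q[unfolded Q_def] n'] unfolding V(1) [symmetric] by blast
  have sC: "real s \<le> C" using s(2) C by linarith
  \<comment> \<open>As V < 1, the argument of the logarithm is at least 3, so the logarithm is at
    least 1.\<close>
  have "exp 1 \<le> (3::real)" by (rule exp_le)
  also have "\<dots> \<le> 1 + 2 * (real s + 1) / V"
  proof -
    have "2 \<le> 2 * (real s + 1) / 1" by simp
    also have "\<dots> \<le> 2 * (real s + 1) / V" using V0 V(2) by (intro divide_left_mono) auto
    finally show ?thesis by simp
  qed
  finally have "1 \<le> ln (1 + 2 * (real s + 1) / V)"
    using V0 by (subst ln_ge_iff) (auto intro!: add_pos_nonneg)
  then have "1 / (2 * real r * (C + 2) ^ (r - 1)) \<le>
      ln (1 + 2 * (real s + 1) / V) / (2 * real r * (real s + 2) ^ (r - 1))"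
    using sC r by (intro frac_le mult_left_mono power_mono) auto
  then have lo: "1 / (2 * real r * (C + 2) ^ (r - 1)) \<le> L" using L(2) by linarith
  have "L \<le> ln (1 + 4 * (real s + 2) / V) / (real s + 2) ^ (r - 1)" by (rule L)
  also have "\<dots> \<le> ln (1 + 4 * (real s + 2) / V) / 1"
    using V0 by (intro divide_left_mono) (auto intro: one_le_power)
  also have "\<dots> \<le> ln ((9 + 4 * C) / V)"
  proof -
    have "1 + 4 * (real s + 2) / V \<le> (9 + 4 * C) / V"
    proof -
      have "1 + 4 * (real s + 2) / V = (V + 4 * (real s + 2)) / V" using V0 by (simp add: add_divide_distrib)
      also have "\<dots> \<le> (9 + 4 * C) / V" using V0 V(2) sC by (intro divide_right_mono) auto
      finally show ?thesis .
    qed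
    then show ?thesis using V0 by (simp add: ln_mono add_pos_nonneg)
  qed
  also have "\<dots> = ln (9 + 4 * C) - ln V" using V0 C0 by (simp add: ln_div)
  finally show ?thesis using L(1) lo ch \<theta> C0 by (intro that[of L])
qed

section \<open>The two sparsity regimes\<close>

text \<open>Eventually \<sigma> \<ge> 2, so h = \<sigma>^(-r) is the active side of the minimum in
  the algorithmic threshold. The prefactor is 1 up to logarithms and leaves the soft order of the
  slope unchanged.\<close>

lemma expansion_dense:
  fixes r :: nat and \<beta> :: real and k \<epsilon> :: "nat \<Rightarrow> real"
  assumes r: "r \<ge> 2" and eps: "\<epsilon> \<longlonglongrightarrow> 0"
    and k: "\<forall>\<^sub>F n in sequentially. k n = real n powr (\<beta> + \<epsilon> n)"
    and \<beta>: "1 / 2 < \<beta>" "\<beta> < 1"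
  defines "D \<equiv> degree_cutoff \<beta>"
  defines "pref \<equiv> \<lambda>n. 1 / (real (D n) ^ (r - 2) * ln (real n) powr ((3 * real r + 2) / 2))"
    and "h \<equiv> \<lambda>n. real n powr (real r / 2) / k n ^ r"
    and "g \<equiv> \<lambda>n. k n ^ r / real n powr (real r / 2)"
  shows "\<forall>\<^sub>F n in sequentially. min 1 (h n) = h n"
    and "pref \<in> soft_Theta (\<lambda>_. 1)" and "\<forall>\<^sub>F n in sequentially. pref n > 0"
    and "\<exists>L B. (\<forall>\<^sub>F n in sequentially. \<forall>x. x + tpca_FP_deriv r n (k n) (D n) x = L n)
      \<and> (\<forall>\<^sub>F n in sequentially. L n > 0) \<and> L \<in> soft_Theta h
      \<and> (\<forall>\<^sub>F n in sequentially. tpca_second_moment r n (k n) - B n \<le> tpca_MMSE r n (k n) (D n) (pref n * L n))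
      \<and> (\<lambda>n. B n / k n ^ r) \<longlonglongrightarrow> 0 \<and> B \<in> soft_O g" (is ?slope)
proof -
  have \<beta>': "0 < \<beta>" using \<beta> by simp
  note kl = k_less[OF eps k \<beta>' \<beta>(2)]
  define \<sigma> where "\<sigma> = (\<lambda>n. k n / sqrt (real n))"
  define L where "L = (\<lambda>n. tpca_FP_deriv r n (k n) (D n) 0)"
  define B where "B = (\<lambda>n. 48 * (real r * (real (D n) + 1) * \<sigma> n) ^ r)"
  have ln1: "\<forall>\<^sub>F n in sequentially. 1 \<le> ln (real n)" by (rule eventually_ln_ge)
  have D: "\<forall>\<^sub>F n in sequentially. real (D n) \<le> ln (real n) \<and> 4 \<le> D n"
    using degree_cutoff_bounds[OF \<beta>' \<beta>(2)] by (rule eventually_mono) (simp add: D_def)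
  have sig2: "\<forall>\<^sub>F n in sequentially. 2 \<le> \<sigma> n"
  proof -
    \<comment> \<open>Half of the excess of \<beta> over 1/2 is spent on the o(1) in the exponent of
      k; the other half lifts \<sigma> above 2.\<close>
    define e where "e = (\<beta> - 1 / 2) / 2"
    have e: "e > 0" "\<beta> - e = 1 / 2 + e" using \<beta> by (auto simp: e_def field_simps)
    have "filterlim (\<lambda>n. real n powr e) at_top sequentially" using e(1) by real_asymp
    then have "\<forall>\<^sub>F n in sequentially. 2 \<le> real n powr e" by (simp add: filterlim_at_top)
    with k_bounds[OF eps k \<beta>' \<beta>(2) e(1)] eventually_gt_at_top[of 0] show ?thesis
    proof eventually_elim
      case (elim n)
      have "2 * sqrt (real n) \<le> real n powr e * sqrt (real n)"
        using elim by (intro mult_right_mono) auto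
      also have "\<dots> = real n powr (\<beta> - e)" using elim by (simp add: e powr_add powr_half_sqrt)
      also have "\<dots> \<le> k n" using elim by simp
      finally show ?case using elim by (simp add: \<sigma>_def le_divide_eq)
    qed
  qed
  have sign: "\<forall>\<^sub>F n in sequentially. 2 * (\<sigma> n * (real (D n) + 2) + 1) \<le> real n"
  proof -
    have "\<forall>\<^sub>F n in sequentially. 2 * (sqrt (real n) * (ln (real n) + 2) + 1) \<le> real n"
      by real_asymp
    with kl D eventually_gt_at_top[of 0] show ?thesis
    proof eventually_elim
      case (elim n)
      have "\<sigma> n \<le> sqrt (real n)"
        using elim by (simp add: \<sigma>_def divide_le_eq)
      then have "2 * (\<sigma> n * (real (D n) + 2) + 1) \<le> 2 * (sqrt (real n) * (ln (real n) + 2) + 1)"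
        using elim by (intro mult_left_mono add_right_mono mult_mono add_mono) auto
      then show ?case using elim by linarith
    qed
  qed
  have h: "\<forall>\<^sub>F n in sequentially. h n = 1 / \<sigma> n ^ r \<and> g n = \<sigma> n ^ r"
    using kl eventually_gt_at_top[of 0]
  proof eventually_elim
    case (elim n)
    have "real n powr (real r / 2) = sqrt (real n) ^ r"
      using elim by (simp add: powr_half_sqrt [symmetric] powr_powr powr_realpow [symmetric])
    then show ?case by (simp add: h_def g_def \<sigma>_def power_divide)
  qed
  show "\<forall>\<^sub>F n in sequentially. min 1 (h n) = h n"
    using h sig2
  proof eventually_elim
    case (elim n)
    then have "1 \<le> \<sigma> n ^ r" by (intro one_le_power) auto
    then have "1 / \<sigma> n ^ r \<le> 1" by (intro divide_le_eq_1_pos[THEN iffD2]) auto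
    then show ?case using elim by (simp add: min.absorb2)
  qed
  have slope: "\<forall>\<^sub>F n in sequentially. (\<forall>x. x + tpca_FP_deriv r n (k n) (D n) x = L n) \<and>
     1 / (4 * real r * (real (D n) + 4) ^ (r - 1)) / \<sigma> n ^ r \<le> L n \<and> L n \<le> 2 ^ r / \<sigma> n ^ r \<and>
     real n * (k n / real n)\<^sup>2 * (cosh (1 / \<sigma> n) - 1) \<le> 1"
    using kl D sig2 sign
  proof eventually_elim
    case (elim n)
    obtain L' where L': "\<And>lam. lam + tpca_FP_deriv r n (k n) (D n) lam = L'"
      "1 / (4 * real r * (real (D n) + 4) ^ (r - 1)) / \<sigma> n ^ r \<le> L'" "L' \<le> 2 ^ r / \<sigma> n ^ r"
      "real n * (k n / real n)\<^sup>2 * (cosh (1 / \<sigma> n) - 1) \<le> 1"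
      using slope_dense[of "k n" n r "D n" "\<sigma> n"] elim r unfolding \<sigma>_def by blast
    have "L n = L'" using L'(1)[of 0] by (simp add: L_def)
    then show ?case using L' by auto
  qed
  have pref: "\<forall>\<^sub>F n in sequentially. 0 < pref n \<and> pref n \<le> 1 \<and> 1 \<le> ln (real n) ^ (3 * r) * pref n
      \<and> pref n \<le> 1 / (real (D n) ^ (r - 2) * ln (real n) ^ 4)"
    using D ln1
  proof eventually_elim
    case (elim n)
    let ?l = "ln (real n)" and ?d = "real (D n)"
    have l0: "?l > 0" using elim by simp
    \<comment> \<open>For r \<ge> 2 the exponent (3 r + 2)/2 lies between 4 and 2 r + 2.\<close>
    have "?l powr 4 \<le> ?l powr ((3 * real r + 2) / 2)" using elim r by (intro powr_mono) auto
    then have l4: "?l ^ 4 \<le> ?l powr ((3 * real r + 2) / 2)"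
      using powr_realpow[of ?l 4] l0 by simp
    have "?l powr ((3 * real r + 2) / 2) \<le> ?l powr (real (2 * r + 2))" using elim r by (intro powr_mono) auto
    then have l2: "?l powr ((3 * real r + 2) / 2) \<le> ?l ^ (2 * r + 2)"
      using l0 by (simp only: powr_realpow)
    have d: "1 \<le> ?d ^ (r - 2)" "?d ^ (r - 2) \<le> ?l ^ (r - 2)"
      using elim by (auto intro: one_le_power power_mono)
    have l4': "1 \<le> ?l ^ 4" using elim by (intro one_le_power) auto
    have den: "1 * ?l ^ 4 \<le> ?d ^ (r - 2) * ?l powr ((3 * real r + 2) / 2)"
      using d l4 l4' by (intro mult_mono) auto
    have "?d ^ (r - 2) * ?l powr ((3 * real r + 2) / 2) \<le> ?l ^ (r - 2) * ?l ^ (2 * r + 2)"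
      using d l2 l0 by (intro mult_mono) auto
    also have "\<dots> = ?l ^ (3 * r)"
    proof -
      have "r - 2 + (2 * r + 2) = 3 * r" using r by simp
      then show ?thesis by (simp only: power_add [symmetric])
    qed
    finally have den2: "?d ^ (r - 2) * ?l powr ((3 * real r + 2) / 2) \<le> ?l ^ (3 * r)" .
    have dp: "0 < ?d ^ (r - 2) * ?l powr ((3 * real r + 2) / 2)" using den l4' by linarith
    have "?d ^ (r - 2) * ?l ^ 4 \<le> ?d ^ (r - 2) * ?l powr ((3 * real r + 2) / 2)"
      using d l4 by (intro mult_left_mono) auto
    moreover have "0 < ?d ^ (r - 2) * ?l ^ 4" using elim l0 by (intro mult_pos_pos zero_less_power) auto
    ultimately have "pref n \<le> 1 / (?d ^ (r - 2) * ?l ^ 4)"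
      unfolding pref_def by (intro divide_left_mono) (use dp in auto)
    moreover have "pref n \<le> 1" unfolding pref_def using den l4' dp by (simp add: divide_le_eq_1)
    moreover have "1 \<le> ?l ^ (3 * r) * pref n"
      unfolding pref_def using den2 dp by (simp add: le_divide_eq)
    moreover have "0 < pref n" unfolding pref_def using dp by simp
    ultimately show ?case by blast
  qed
  show "pref \<in> soft_Theta (\<lambda>_. 1)"
  proof (rule soft_ThetaI[where C = 1 and c = 0 and C' = 1 and c' = "3 * r"])
    show "\<forall>\<^sub>F n in sequentially. \<bar>pref n\<bar> \<le> 1 * ln (real n) ^ 0 * \<bar>1\<bar>"
      using pref by eventually_elim simp
    show "\<forall>\<^sub>F n in sequentially. \<bar>1\<bar> \<le> 1 * ln (real n) ^ (3 * r) * \<bar>pref n\<bar>"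
      using pref by eventually_elim simp
  qed
  show "\<forall>\<^sub>F n in sequentially. pref n > 0" using pref by eventually_elim simp
  have lower_pos: "0 < 1 / (4 * real r * (real (D n) + 4) ^ (r - 1))" for n
    using r by (intro divide_pos_pos mult_pos_pos zero_less_power) auto
  have Lpos: "\<forall>\<^sub>F n in sequentially. L n > 0"
    using slope sig2
  proof eventually_elim
    case (elim n)
    have "0 < 1 / (4 * real r * (real (D n) + 4) ^ (r - 1)) / \<sigma> n ^ r"
      using lower_pos elim by (intro divide_pos_pos zero_less_power) auto
    then show ?case using elim by linarith
  qed
  have Lh: "L \<in> soft_Theta h"
  proof (rule soft_ThetaI[where C = "2 ^ r" and c = 0 and C' = "4 * real r * 5 ^ (r - 1)" and c' = "r - 1"])
    show "\<forall>\<^sub>F n in sequentially. \<bar>L n\<bar> \<le> 2 ^ r * ln (real n) ^ 0 * \<bar>h n\<bar>"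
      using slope Lpos h sig2 by eventually_elim simp
    show "\<forall>\<^sub>F n in sequentially. \<bar>h n\<bar> \<le> 4 * real r * 5 ^ (r - 1) * ln (real n) ^ (r - 1) * \<bar>L n\<bar>"
      using slope Lpos h sig2 D ln1
    proof eventually_elim
      case (elim n)
      let ?c = "4 * real r * (real (D n) + 4) ^ (r - 1)"
      have c: "?c > 0" using r by (intro mult_pos_pos zero_less_power) auto
      have "(real (D n) + 4) ^ (r - 1) \<le> (5 * ln (real n)) ^ (r - 1)"
        using elim by (intro power_mono) auto
      then have "?c * L n \<le> (4 * real r * (5 * ln (real n)) ^ (r - 1)) * L n"
        using elim by (intro mult_right_mono mult_left_mono) auto
      moreover have "1 / \<sigma> n ^ r \<le> ?c * L n"
      proof -
        have "1 / x = a * (1 / a / x)" if "a > 0" for a x :: real using that by simp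
        from this[OF c] have "1 / \<sigma> n ^ r = ?c * (1 / ?c / \<sigma> n ^ r)" .
        also have "\<dots> \<le> ?c * L n" using c elim by (intro mult_left_mono) auto
        finally show ?thesis .
      qed
      ultimately have "1 / \<sigma> n ^ r \<le> (4 * real r * (5 * ln (real n)) ^ (r - 1)) * L n" by linarith
      moreover have "\<bar>h n\<bar> = 1 / \<sigma> n ^ r" "\<bar>L n\<bar> = L n" using elim by simp_all
      ultimately show ?case by (simp only: power_mult_distrib mult.assoc)
    qed
  qed
  have MM: "\<forall>\<^sub>F n in sequentially. tpca_second_moment r n (k n) - B n \<le> tpca_MMSE r n (k n) (D n) (pref n * L n)"
    using slope Lpos pref kl sig2 D ln1 eventually_ln_ge[of "100 * (4 * real r) ^ r"]
  proof eventually_elim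
    case (elim n)
    let ?l = "ln (real n)" and ?d = "real (D n)"
    have d4: "4 \<le> ?d" using elim by simp
    \<comment> \<open>The powers of \<sigma> cancel, and D^r / D^(r-2) = D^2 leaves a multiple of
      D^3 / ln^4, hence of 1 / ln. This is where the power D^(r-2) and four logarithms of the
      prefactor are spent.\<close>
    have "?d * (pref n * L n) * (real r * (?d + 1) * \<sigma> n) ^ r
        \<le> ?d * (1 / (?d ^ (r - 2) * ?l ^ 4) * (2 ^ r / \<sigma> n ^ r)) * (real r * (?d + 1) * \<sigma> n) ^ r"
      using elim by (intro mult_right_mono mult_left_mono mult_mono) auto
    also have "\<dots> = ?d * (2 * (real r * (?d + 1))) ^ r / (?d ^ (r - 2) * ?l ^ 4)"
    proof -
      have "d * (1 / P * (2 ^ r / x ^ r)) * (b * x) ^ r = d * (2 * b) ^ r / P" if "x > 0" for d P b x :: real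
        using that by (simp add: power_mult_distrib)
      moreover have "\<sigma> n > 0" using elim by linarith
      ultimately show ?thesis by blast
    qed
    also have "\<dots> \<le> ?d * (4 * real r * ?d) ^ r / (?d ^ (r - 2) * ?l ^ 4)"
    proof (intro divide_right_mono mult_left_mono power_mono)
      have "2 * (real r * (?d + 1)) \<le> 2 * (real r * (2 * ?d))" using d4 by (intro mult_left_mono) auto
      then show "2 * (real r * (?d + 1)) \<le> 4 * real r * ?d" by simp
    qed (use elim in auto)
    also have "\<dots> = (4 * real r) ^ r * ?d ^ 3 / ?l ^ 4"
    proof -
      have "r - 2 + 2 = r" using r by simp
      then have "?d ^ r = ?d ^ (r - 2) * ?d ^ 2" by (metis power_add)
      then show ?thesis using d4 by (simp add: power_mult_distrib power3_eq_cube power2_eq_square field_simps)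
    qed
    also have "\<dots> \<le> (4 * real r) ^ r * ?l ^ 3 / ?l ^ 4"
      using elim by (intro divide_right_mono mult_left_mono power_mono) auto
    also have "\<dots> = (4 * real r) ^ r / ?l"
      using elim by (simp add: field_simps eval_nat_numeral)
    also have "\<dots> \<le> 1 / 100" using elim by (simp add: divide_le_eq)
    finally have small: "?d * (pref n * L n) * (real r * (?d + 1) / (1 / \<sigma> n)) ^ r \<le> 1 / 100" by simp
    have "tpca_second_moment r n (k n) - 48 * (real r * (?d + 1) / (1 / \<sigma> n)) ^ r
        \<le> tpca_MMSE r n (k n) (D n) (pref n * L n)"
      using elim r small by (intro tensor_MMSE_lower_bound) auto
    then show ?case by (simp add: B_def)
  qed
  have Bb: "\<forall>\<^sub>F n in sequentially. 0 \<le> B n \<and> B n \<le> 48 * (2 * real r) ^ r * ln (real n) ^ r * \<sigma> n ^ r"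
    using D ln1 sig2
  proof eventually_elim
    case (elim n)
    have "(real r * (real (D n) + 1) * \<sigma> n) ^ r \<le> (real r * (2 * ln (real n)) * \<sigma> n) ^ r"
      using elim by (intro power_mono mult_right_mono mult_left_mono) auto
    then show ?case using elim by (simp add: B_def power_mult_distrib mult_ac)
  qed
  have "B \<in> soft_O g"
  proof (rule soft_OI)
    show "\<forall>\<^sub>F n in sequentially. \<bar>B n\<bar> \<le> 48 * (2 * real r) ^ r * ln (real n) ^ r * \<bar>g n\<bar>"
      using Bb h sig2 by eventually_elim simp
  qed
  moreover have "(\<lambda>n. B n / k n ^ r) \<longlonglongrightarrow> 0"
  \<comment> \<open>Since \<sigma> / k = 1 / sqrt n, the relative error is a power of ln n / sqrt
    n.\<close>
  proof (rule tendsto_sandwich[of "\<lambda>_. 0" _ _ "\<lambda>n. 48 * (2 * real r * (ln (real n) / sqrt (real n))) ^ r"])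
    show "\<forall>\<^sub>F n in sequentially. 0 \<le> B n / k n ^ r"
      using Bb kl by eventually_elim simp
    show "\<forall>\<^sub>F n in sequentially. B n / k n ^ r \<le> 48 * (2 * real r * (ln (real n) / sqrt (real n))) ^ r"
      using Bb kl eventually_gt_at_top[of 0]
    proof eventually_elim
      case (elim n)
      have "B n / k n ^ r \<le> 48 * (2 * real r) ^ r * ln (real n) ^ r * \<sigma> n ^ r / k n ^ r"
        using elim by (intro divide_right_mono) auto
      also have "\<dots> = 48 * (2 * real r * (ln (real n) / sqrt (real n))) ^ r"
        using elim by (simp add: \<sigma>_def power_mult_distrib power_divide)
      finally show ?case .
    qed
    have "(\<lambda>n. ln (real n) / sqrt (real n)) \<longlonglongrightarrow> 0" by real_asymp
    then have "(\<lambda>n. 48 * (2 * real r * (ln (real n) / sqrt (real n))) ^ r) \<longlonglongrightarrow> 48 * (2 * real r * 0) ^ r"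
      by (intro tendsto_intros)
    moreover have "48 * (2 * real r * 0) ^ r = 0" using r by simp
    ultimately show "(\<lambda>n. 48 * (2 * real r * (ln (real n) / sqrt (real n))) ^ r) \<longlonglongrightarrow> 0"
      by (simp only:)
  qed simp
  moreover have "\<forall>\<^sub>F n in sequentially. \<forall>x. x + tpca_FP_deriv r n (k n) (D n) x = L n"
    using slope by eventually_elim blast
  ultimately show ?slope
    using Lpos Lh MM by blast
qed

text \<open>Eventually k^2 < n, so the minimum in the algorithmic threshold is 1. The error
  \<open>B\<close> is a constant because the ratio of D + 1 to \<theta> = - ln V, the moment scale,
  stays bounded.\<close>

lemma expansion_sparse:
  fixes r :: nat and \<beta> :: real and k \<epsilon> :: "nat \<Rightarrow> real"
  assumes r: "r \<ge> 2" and eps: "\<epsilon> \<longlonglongrightarrow> 0"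
    and k: "\<forall>\<^sub>F n in sequentially. k n = real n powr (\<beta> + \<epsilon> n)"
    and \<beta>: "0 < \<beta>" "\<beta> < 1 / 2"
  defines "D \<equiv> degree_cutoff \<beta>"
  defines "pref \<equiv> \<lambda>n. 1 / ln (real n) ^ 3"
    and "h \<equiv> \<lambda>n. real n powr (real r / 2) / k n ^ r"
  shows "\<forall>\<^sub>F n in sequentially. min 1 (h n) = 1"
    and "pref \<in> soft_Theta (\<lambda>_. 1)" and "\<forall>\<^sub>F n in sequentially. pref n > 0"
    and "\<exists>L B. (\<forall>\<^sub>F n in sequentially. \<forall>x. x + tpca_FP_deriv r n (k n) (D n) x = L n)
      \<and> (\<forall>\<^sub>F n in sequentially. L n > 0) \<and> L \<in> soft_Theta (\<lambda>_. 1)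
      \<and> (\<forall>\<^sub>F n in sequentially. tpca_second_moment r n (k n) - B n \<le> tpca_MMSE r n (k n) (D n) (pref n * L n))
      \<and> (\<lambda>n. B n / k n ^ r) \<longlonglongrightarrow> 0 \<and> B \<in> soft_O (\<lambda>_. 1)" (is ?slope)
proof -
  have \<beta>': "\<beta> < 1" using \<beta> by simp
  note kl = k_less[OF eps k \<beta>(1) \<beta>']
  \<comment> \<open>Two demands on the slack: 2 e \<le> \<beta>/2 keeps V well above exp (-D), and 2
    e \<le> (1 - 2 \<beta>)/2 keeps V below n^(-\<delta>).\<close>
  define e where "e = min (\<beta> / 4) ((1 - 2 * \<beta>) / 4)"
  have "e > 0" using \<beta> by (simp add: e_def)
  moreover have "e \<le> \<beta> / 4" unfolding e_def by (rule min.cobounded1)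
  moreover have "e \<le> (1 - 2 * \<beta>) / 4" unfolding e_def by (rule min.cobounded2)
  ultimately have e: "e > 0" "e \<le> \<beta> / 4" "e \<le> (1 - 2 * \<beta>) / 4" .
  define V where "V = (\<lambda>n. (k n)\<^sup>2 / real n)"
  define \<delta> where "\<delta> = (1 - 2 * \<beta>) / 2"
  have \<delta>: "\<delta> > 0" using \<beta> by (simp add: \<delta>_def)
  \<comment> \<open>Bounds (D + 2) / (- ln V): the numerator is at most 2 ln n, the denominator at
    least \<delta> ln n.\<close>
  define C where "C = 2 / \<delta>"
  have C0: "C > 0" using \<delta> by (simp add: C_def)
  define c where "c = 2 * real r * (C + 2) ^ (r - 1)"
  have c0: "c > 0" using C0 r by (auto simp: c_def intro!: mult_pos_pos zero_less_power)
  define L where "L = (\<lambda>n. tpca_FP_deriv r n (k n) (D n) 0)"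
  have ln1: "\<forall>\<^sub>F n in sequentially. 1 \<le> ln (real n)" by (rule eventually_ln_ge)
  have D: "\<forall>\<^sub>F n in sequentially. (1 - \<beta>) * ln (real n) - 1 \<le> real (D n) \<and> real (D n) \<le> ln (real n) \<and> 4 \<le> D n"
    using degree_cutoff_bounds[OF \<beta>(1) \<beta>'] by (rule eventually_mono) (simp add: D_def)
  have V: "\<forall>\<^sub>F n in sequentially. real n powr (2 * (\<beta> - e) - 1) \<le> V n \<and> V n \<le> real n powr (- \<delta>)"
    using k_bounds[OF eps k \<beta>(1) \<beta>' e(1)] eventually_gt_at_top[of 1]
  proof eventually_elim
    case (elim n)
    have sq: "(real n powr a)\<^sup>2 / real n = real n powr (2 * a - 1)" for a
      using elim by (simp add: powr_diff powr_mult_base power2_eq_square flip: powr_add)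
    have "(real n powr (\<beta> - e))\<^sup>2 / real n \<le> V n"
      unfolding V_def using elim by (intro divide_right_mono power_mono) auto
    moreover have "V n \<le> (real n powr (\<beta> + e))\<^sup>2 / real n"
    proof -
      have "0 \<le> k n" using elim powr_ge_zero[of "real n" "\<beta> - e"] by linarith
      then show ?thesis unfolding V_def using elim by (intro divide_right_mono power_mono) auto
    qed
    moreover have "real n powr (2 * (\<beta> + e) - 1) \<le> real n powr (- \<delta>)"
      using elim e by (intro powr_mono) (auto simp: \<delta>_def field_simps)
    ultimately show ?case unfolding sq by linarith
  qed
  have V1: "\<forall>\<^sub>F n in sequentially. 0 < V n \<and> V n < 1 \<and> \<delta> * ln (real n) \<le> - ln (V n) \<and> - ln (V n) \<le> ln (real n)"
    using V kl eventually_gt_at_top[of 1]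
  proof eventually_elim
    case (elim n)
    have V0: "V n > 0" using elim by (simp add: V_def)
    have "real n powr (- \<delta>) < real n powr 0" using elim \<delta> by (intro powr_less_mono) auto
    then have "V n < 1" using elim by simp
    moreover have "ln (V n) \<le> ln (real n powr (- \<delta>))" using V0 elim by (intro ln_mono) auto
    then have "\<delta> * ln (real n) \<le> - ln (V n)" using elim by (simp add: ln_powr)
    moreover have "real n powr (- 1) \<le> real n powr (2 * (\<beta> - e) - 1)"
      using elim e \<beta> by (intro powr_mono) auto
    then have "ln (real n powr (- 1)) \<le> ln (V n)" using elim V0 by (intro ln_mono) auto
    then have "- ln (V n) \<le> ln (real n)" using elim by (simp add: ln_powr ln_div)
    ultimately show ?case using V0 by blast
  qed
  \<comment> \<open>The floor in D costs a factor exp 1, so exp (-D) is at most exp 1 times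
    n^(\<beta> - 1). V exceeds n^(\<beta> - 1) by a factor of at least n^(\<beta>/2), which beats 4
    exp 1.\<close>
  have VD: "\<forall>\<^sub>F n in sequentially. 4 * exp (- real (D n)) < V n"
  proof -
    have a: "\<beta> / 2 > 0" using \<beta> by simp
    have "filterlim (\<lambda>n. real n powr (\<beta> / 2)) at_top sequentially" using a by real_asymp
    then have "\<forall>\<^sub>F n in sequentially. 4 * exp 1 < real n powr (\<beta> / 2)"
      by (simp add: filterlim_at_top_dense)
    with V D eventually_gt_at_top[of 1] show ?thesis
    proof eventually_elim
      case (elim n)
      have "4 * exp (- real (D n)) \<le> 4 * exp (1 - (1 - \<beta>) * ln (real n))" using elim by simp
      also have "\<dots> = 4 * exp 1 * real n powr (\<beta> - 1)"
        using elim by (simp add: powr_def exp_add [symmetric] algebra_simps)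
      also have "\<dots> < real n powr (\<beta> / 2) * real n powr (\<beta> - 1)"
        using elim by (intro mult_strict_right_mono) auto
      also have "\<dots> = real n powr (3 / 2 * \<beta> - 1)" by (simp add: powr_add [symmetric])
      also have "\<dots> \<le> real n powr (2 * (\<beta> - e) - 1)"
        using elim e by (intro powr_mono) auto
      also have "\<dots> \<le> V n" using elim by simp
      finally show ?case .
    qed
  qed
  have DC: "\<forall>\<^sub>F n in sequentially. (real (D n) + 2) / (- ln (V n)) \<le> C"
    using D V1 eventually_ln_ge[of 2]
  proof eventually_elim
    case (elim n)
    have "real (D n) + 2 \<le> 2 * ln (real n)" using elim by linarith
    moreover have "0 < \<delta> * ln (real n)" using elim \<delta> by simp
    ultimately have "(real (D n) + 2) / (- ln (V n)) \<le> 2 * ln (real n) / (\<delta> * ln (real n))"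
      using elim by (intro frac_le) auto
    also have "\<dots> = C" using elim by (simp add: C_def)
    finally show ?case .
  qed
  have nC: "\<forall>\<^sub>F n in sequentially. 2 * (C + 1) \<le> real n" by real_asymp
  show "\<forall>\<^sub>F n in sequentially. min 1 (h n) = 1"
    using V1 kl eventually_gt_at_top[of 0]
  proof eventually_elim
    case (elim n)
    have "(k n)\<^sup>2 \<le> real n" using elim by (simp add: V_def divide_less_eq)
    then have "k n \<le> sqrt (real n)" by (rule real_le_rsqrt)
    then have "k n ^ r \<le> sqrt (real n) ^ r" using elim by (intro power_mono) auto
    also have "sqrt (real n) ^ r = real n powr (real r / 2)"
      using elim by (simp add: powr_half_sqrt [symmetric] powr_powr powr_realpow [symmetric])
    finally show ?case using elim by (simp add: h_def min_def le_divide_eq)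
  qed
  show pt: "pref \<in> soft_Theta (\<lambda>_. 1)"
  proof (rule soft_ThetaI[where C = 1 and c = 0 and C' = 1 and c' = 3])
    show "\<forall>\<^sub>F n in sequentially. \<bar>pref n\<bar> \<le> 1 * ln (real n) ^ 0 * \<bar>1\<bar>"
      using ln1 by eventually_elim (simp add: pref_def)
    show "\<forall>\<^sub>F n in sequentially. \<bar>1\<bar> \<le> 1 * ln (real n) ^ 3 * \<bar>pref n\<bar>"
      using ln1 by eventually_elim (simp add: pref_def)
  qed
  show "\<forall>\<^sub>F n in sequentially. pref n > 0"
    using ln1 by eventually_elim (simp add: pref_def)
  have slope: "\<forall>\<^sub>F n in sequentially. (\<forall>x. x + tpca_FP_deriv r n (k n) (D n) x = L n) \<and>
     1 / c \<le> L n \<and> L n \<le> 2 * ln (real n) \<and>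
     real n * (k n / real n)\<^sup>2 * (cosh (- ln (V n)) - 1) \<le> 1 \<and> - ln (V n) > 0"
    using kl D V1 VD DC nC eventually_ln_ge[of "ln (9 + 4 * C)"]
  proof eventually_elim
    case (elim n)
    have "r \<ge> 1" "D n \<ge> 1" using r elim by auto
    obtain L' where L': "\<And>lam. lam + tpca_FP_deriv r n (k n) (D n) lam = L'"
      "1 / c \<le> L'" "L' \<le> ln (9 + 4 * C) - ln (V n)"
      "real n * (k n / real n)\<^sup>2 * (cosh (- ln (V n)) - 1) \<le> 1" "- ln (V n) > 0"
      using slope_sparse[of "k n" n r "D n" "V n" C] elim \<open>r \<ge> 1\<close> \<open>D n \<ge> 1\<close>
      unfolding V_def c_def by blast
    have "L n = L'" using L'(1)[of 0] by (simp add: L_def)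
    moreover have "L' \<le> 2 * ln (real n)" using L'(3) elim by linarith
    ultimately show ?case using L' by auto
  qed
  have Lpos: "\<forall>\<^sub>F n in sequentially. L n > 0"
    using slope
  proof eventually_elim
    case (elim n)
    have "0 < 1 / c" using c0 by simp
    then show ?case using elim by linarith
  qed
  have Lh: "L \<in> soft_Theta (\<lambda>_. 1)"
  proof (rule soft_ThetaI[where C = 2 and c = 1 and C' = c and c' = 0])
    show "\<forall>\<^sub>F n in sequentially. \<bar>L n\<bar> \<le> 2 * ln (real n) ^ 1 * \<bar>1\<bar>"
      using slope Lpos by eventually_elim simp
    show "\<forall>\<^sub>F n in sequentially. \<bar>1\<bar> \<le> c * ln (real n) ^ 0 * \<bar>L n\<bar>"
      using slope Lpos by eventually_elim (use c0 in \<open>simp add: divide_le_eq mult.commute\<close>)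
  qed
  define B where "B = 48 * (real r * C) ^ r"
  have MM: "\<forall>\<^sub>F n in sequentially. tpca_second_moment r n (k n) - B \<le> tpca_MMSE r n (k n) (D n) (pref n * L n)"
    using slope Lpos kl D DC ln1 eventually_ln_ge[of "200 * (real r * C) ^ r"]
  proof eventually_elim
    case (elim n)
    let ?l = "ln (real n)" and ?d = "real (D n)" and ?\<theta> = "- ln (V n)"
    have \<theta>: "?\<theta> > 0" using elim by blast
    have "(?d + 1) / ?\<theta> \<le> (?d + 2) / ?\<theta>" using \<theta> by (intro divide_right_mono) auto
    then have "(?d + 1) / ?\<theta> \<le> C" using elim by linarith
    then have "real r * ((?d + 1) / ?\<theta>) \<le> real r * C" by (intro mult_left_mono) auto
    moreover have nn: "0 \<le> real r * (?d + 1) / ?\<theta>" using \<theta> by (intro divide_nonneg_pos) auto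
    ultimately have A: "(real r * (?d + 1) / ?\<theta>) ^ r \<le> (real r * C) ^ r"
      by (intro power_mono) (simp_all only: times_divide_eq_right)
    \<comment> \<open>D and L contribute at most one logarithm each against three in the prefactor,
      so one is left over.\<close>
    have "?d * (pref n * L n) * (real r * (?d + 1) / ?\<theta>) ^ r \<le> ?l * (1 / ?l ^ 3 * (2 * ?l)) * (real r * C) ^ r"
      using A elim C0 zero_le_power[OF nn, of r] unfolding pref_def by (intro mult_mono) auto
    also have "\<dots> = 2 * (real r * C) ^ r / ?l"
      using elim by (simp add: field_simps eval_nat_numeral)
    also have "\<dots> \<le> 1 / 100" using elim by (simp add: divide_le_eq)
    finally have small: "?d * (pref n * L n) * (real r * (?d + 1) / ?\<theta>) ^ r \<le> 1 / 100" .
    have "0 \<le> pref n * L n" using elim by (simp add: pref_def)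
    then have "tpca_second_moment r n (k n) - 48 * (real r * (?d + 1) / ?\<theta>) ^ r
        \<le> tpca_MMSE r n (k n) (D n) (pref n * L n)"
      using elim r small by (intro tensor_MMSE_lower_bound) auto
    then show ?case using A by (simp add: B_def)
  qed
  have "(\<lambda>_. B) \<in> soft_O (\<lambda>_. 1)"
    by (rule soft_OI[where C = "\<bar>B\<bar>" and c = 0]) simp
  moreover have "(\<lambda>n. B / k n ^ r) \<longlonglongrightarrow> 0"
  proof -
    have "filterlim (\<lambda>n. k n ^ r) at_top sequentially"
      using k_filterlim[OF eps k \<beta>(1) \<beta>'] r by (intro filterlim_pow_at_top) auto
    then have "(\<lambda>n. B * inverse (k n ^ r)) \<longlonglongrightarrow> B * 0"
      by (intro tendsto_intros tendsto_inverse_0_at_top)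
    then show ?thesis by (simp add: divide_inverse)
  qed
  moreover have "\<forall>\<^sub>F n in sequentially. \<forall>x. x + tpca_FP_deriv r n (k n) (D n) x = L n"
    using slope by eventually_elim blast
  ultimately show ?slope
    using Lpos Lh MM by (intro exI[of _ L] exI[of _ "\<lambda>_. B"]) blast
qed

theorem theorem3p2:
  fixes r :: nat and \<beta> :: real and k \<epsilon> lam lamALG :: "nat \<Rightarrow> real"
  assumes r: "r \<ge> 2"
    and eps: "\<epsilon> \<longlonglongrightarrow> 0"
    and k: "\<forall>\<^sub>F n in sequentially. k n = real n powr (\<beta> + \<epsilon> n)"
    and lamALG: "lamALG \<in> soft_Theta (\<lambda>n. min 1 (real n powr (real r / 2) / k n ^ r))"
    and lam: "\<And>n. lam n > 0"
  defines "D \<equiv> degree_cutoff \<beta>"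
  shows
    "(1 / 2 < \<beta> \<and> \<beta> < 1 \<longrightarrow>
        MMSE_expansion
          (\<lambda>n. tpca_MMSE r n (k n) (D n)
             (1 / (real (D n) ^ (r - 2) * ln (real n) powr ((3 * real r + 2) / 2))
                * (lam n + tpca_FP_deriv r n (k n) (D n) (lam n))))
          (\<lambda>n. tpca_second_moment r n (k n))
          (\<lambda>n. k n ^ r)
          (\<lambda>n. tpca_trivial_MMSE r n (k n))
          (\<lambda>n. k n ^ r / real n powr (real r / 2))
      \<and> (\<exists>lam'. (\<forall>n. lam' n > 0)
            \<and> lam' \<in> soft_Theta (\<lambda>n. real n powr (real r / 2) / k n ^ r)
            \<and> lam' \<in> soft_Theta lamALG
            \<and> (\<forall>\<^sub>F n in sequentially. tpca_FP_deriv r n (k n) (D n) (lam' n) \<ge> 0))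
      \<and> (\<exists>\<mu>. (\<forall>n. \<mu> n > 0) \<and> \<mu> \<in> soft_Theta lamALG
            \<and> asymp_at_least (\<lambda>n. tpca_MMSE r n (k n) (D n) (\<mu> n))
                 (\<lambda>n. tpca_trivial_MMSE r n (k n))))
   \<and> (0 < \<beta> \<and> \<beta> < 1 / 2 \<longrightarrow>
        MMSE_expansion
          (\<lambda>n. tpca_MMSE r n (k n) (D n)
             (1 / ln (real n) ^ 3 * (lam n + tpca_FP_deriv r n (k n) (D n) (lam n))))
          (\<lambda>n. tpca_second_moment r n (k n))
          (\<lambda>n. k n ^ r)
          (\<lambda>n. tpca_trivial_MMSE r n (k n))
          (\<lambda>n. 1)
      \<and> (\<exists>lam'. (\<forall>n. lam' n > 0)
            \<and> lam' \<in> soft_Theta (\<lambda>n. 1)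
            \<and> lam' \<in> soft_Theta lamALG
            \<and> (\<forall>\<^sub>F n in sequentially. tpca_FP_deriv r n (k n) (D n) (lam' n) \<ge> 0))
      \<and> (\<exists>\<mu>. (\<forall>n. \<mu> n > 0) \<and> \<mu> \<in> soft_Theta lamALG
            \<and> asymp_at_least (\<lambda>n. tpca_MMSE r n (k n) (D n) (\<mu> n))
                 (\<lambda>n. tpca_trivial_MMSE r n (k n))))"
    (is "(_ \<longrightarrow> ?A) \<and> (_ \<longrightarrow> ?B)")
proof -
  \<comment> \<open>The regimes differ in which side of the minimum is active; \<open>alg\<close>
    transfers the threshold to that side.\<close>
  have alg: "lamALG \<in> soft_Theta h'" if "\<forall>\<^sub>F n in sequentially. min 1 (real n powr (real r / 2) / k n ^ r) = h' n" for h'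
    using soft_Theta_trans[OF lamALG soft_Theta_cong[OF that]] .
  \<comment> \<open>The upper half of the squeeze, MMSE \<le> trivial MMSE \<le> second moment, is
    common to both regimes; only the lower half depends on the regime.\<close>
  have bounds: "\<forall>\<^sub>F n in sequentially. tpca_second_moment r n (k n) - B n \<le> tpca_MMSE r n (k n) (D n) (x n)
      \<and> tpca_MMSE r n (k n) (D n) (x n) \<le> tpca_trivial_MMSE r n (k n)
      \<and> tpca_trivial_MMSE r n (k n) \<le> tpca_second_moment r n (k n)
      \<and> k n ^ r \<le> tpca_second_moment r n (k n) \<and> k n ^ r > 0"
    if "0 < \<beta>" "\<beta> < 1"
      "\<forall>\<^sub>F n in sequentially. tpca_second_moment r n (k n) - B n \<le> tpca_MMSE r n (k n) (D n) (x n)" for B x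
    using that(3) k_less[OF eps k that(1,2)] eventually_gt_at_top[of 0]
  proof eventually_elim
    case (elim n)
    then show ?case
      by (simp add: lowdeg_MMSE_le_trivial finite_tensor_index finite_set_tensor_prior
          trivial_MMSE_le_second_moment tensor_second_moment_bounds)
  qed
  show ?thesis
  proof (rule conjI; rule impI)
    assume \<beta>: "1 / 2 < \<beta> \<and> \<beta> < 1"
    then have \<beta>': "0 < \<beta>" "\<beta> < 1" by auto
    note dense = expansion_dense[OF r eps k conjunct1[OF \<beta>] conjunct2[OF \<beta>], folded D_def]
    obtain L B where LB: "\<forall>\<^sub>F n in sequentially. \<forall>x. x + tpca_FP_deriv r n (k n) (D n) x = L n"
      "\<forall>\<^sub>F n in sequentially. L n > 0" "L \<in> soft_Theta (\<lambda>n. real n powr (real r / 2) / k n ^ r)"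
      "\<forall>\<^sub>F n in sequentially. tpca_second_moment r n (k n) - B n \<le> tpca_MMSE r n (k n) (D n)
        (1 / (real (D n) ^ (r - 2) * ln (real n) powr ((3 * real r + 2) / 2)) * L n)"
      "(\<lambda>n. B n / k n ^ r) \<longlonglongrightarrow> 0" "B \<in> soft_O (\<lambda>n. k n ^ r / real n powr (real r / 2))"
      using dense(4) by blast
    note expansion_from_slope[where FP = "\<lambda>n. tpca_FP_deriv r n (k n) (D n)"
        and MM = "\<lambda>n. tpca_MMSE r n (k n) (D n)" and S = "\<lambda>n. tpca_second_moment r n (k n)"
        and T = "\<lambda>n. tpca_trivial_MMSE r n (k n)" and K = "\<lambda>n. k n ^ r" and lam = lam
        and pref = "\<lambda>n. 1 / (real (D n) ^ (r - 2) * ln (real n) powr ((3 * real r + 2) / 2))",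
        OF LB(1-3) alg[OF dense(1)] dense(2,3) bounds[OF \<beta>' LB(4)]
        second_moment_ratio[OF eps k \<beta>'] LB(5,6)]
    then show ?A .
  next
    assume \<beta>: "0 < \<beta> \<and> \<beta> < 1 / 2"
    then have \<beta>': "0 < \<beta>" "\<beta> < 1" by auto
    note sparse = expansion_sparse[OF r eps k conjunct1[OF \<beta>] conjunct2[OF \<beta>], folded D_def]
    obtain L B where LB: "\<forall>\<^sub>F n in sequentially. \<forall>x. x + tpca_FP_deriv r n (k n) (D n) x = L n"
      "\<forall>\<^sub>F n in sequentially. L n > 0" "L \<in> soft_Theta (\<lambda>_. 1)"
      "\<forall>\<^sub>F n in sequentially. tpca_second_moment r n (k n) - B n \<le> tpca_MMSE r n (k n) (D n)
        (1 / ln (real n) ^ 3 * L n)"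
      "(\<lambda>n. B n / k n ^ r) \<longlonglongrightarrow> 0" "B \<in> soft_O (\<lambda>_. 1)"
      using sparse(4) by blast
    note expansion_from_slope[where FP = "\<lambda>n. tpca_FP_deriv r n (k n) (D n)"
        and MM = "\<lambda>n. tpca_MMSE r n (k n) (D n)" and S = "\<lambda>n. tpca_second_moment r n (k n)"
        and T = "\<lambda>n. tpca_trivial_MMSE r n (k n)" and K = "\<lambda>n. k n ^ r" and lam = lam
        and pref = "\<lambda>n. 1 / ln (real n) ^ 3",
        OF LB(1-3) alg[OF sparse(1)] sparse(2,3) bounds[OF \<beta>' LB(4)]
        second_moment_ratio[OF eps k \<beta>'] LB(5,6)]
    then show ?B .
  qed
qed

end
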